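(* Let $d>2$ and let $\langle\cdot\rangle$ be a probability measure on $\Omega$ satisfying (A1), (A2), (A2+) and (A3) for some $\rho>0$ and modulus $\Lambda$. Let $e\in\mathbb R^d$ with $|e|=1$ and, for $T>0$, let $\phi_T$ be the modified corrector. Then for all $T>0$ and all $1\le p<\infty$, $$\langle|\phi_T|^p\rangle^{1/p}\le C,$$ where $C$ depends only on $p$, $\Lambda$, $\rho$ and $d$.
   Context: $\mathbb B^d$ is the set of nearest-neighbour bonds $\{x,x+e_i\}$ of $\mathbb Z^d$; for a bond $b$, $x_b,y_b$ are its endpoints with $y_b-x_b\in\{e_1,\dots,e_d\}$. $\nabla u(b)=u(y_b)-u(x_b)$, $\nabla^*F(x)=\sum_{i=1}^d(F(\{x-e_i,x\})-F(\{x,x+e_i\}))$, and $e$ is identified with the field $e(b)=e\cdot(y_b-x_b)$. $\Omega=[0,1]^{\mathbb B^d}$ with product topology/σ-algebra. Chemical distance: $\mathrm{dist}_a(x,y)=\inf\{\sum_{b\in\pi}a(b)^{-1}:\pi$ a path from $x$ to $y\}$, $1/0:=\infty$. $a^{b,0}$: the field $a$ with $a(b)$ replaced by $0$. Assumptions: (A1) the shifts $a\mapsto a(\cdot+z)$, $z\in\mathbb Z^d$, preserve $\langle\cdot\rangle$; (A2) $\max_i\langle\mathrm{dist}_a(0,e_i)^p\rangle^{1/p}\le\Lambda(p)$ for all $p<\infty$; (A2+) $\max_i\langle\mathrm{dist}_{a^{\{0,e_i\},0}}(0,e_i)^p\rangle^{1/p}\le\Lambda(p)$ for all $p<\infty$;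 (A3) $\langle(\zeta-\langle\zeta\rangle)^2\rangle\le\frac1\rho\sum_b\langle(\zeta-\langle\zeta\rangle_b)^2\rangle$ for all $\zeta\in L^2(\Omega)$, $\langle\zeta\rangle_b$ being the conditional expectation given $\{a(b')\}_{b'\ne b}$. A random field $\varphi:\Omega\times\mathbb Z^d\to\mathbb R$ is stationary if it is measurable and $\varphi(a(\cdot+z),x)=\varphi(a,x+z)$ for all $x,z$ and a.e. $a$. The modified corrector $\phi_T$ is the unique stationary random field with $\langle\phi_T^2\rangle<\infty$ solving $\frac1T\phi_T(x)+\nabla^*\big(a(\nabla\phi_T+e)\big)(x)=0$ for all $x\in\mathbb Z^d$. *)

theory Defs
  imports "HOL-Analysis.Analysis" "HOL-Probability.Probability"
begin

text \<open>Lattice Z^d is int^'d (d = CARD('d)). A bond {x, x+e_i} is encoded as the pair (x, i).\<close>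

type_synonym 'd bond = "(int^'d) \<times> 'd"
type_synonym 'd field = "'d bond \<Rightarrow> real"

definition unitv :: "'d::finite \<Rightarrow> int^'d" where
  "unitv i = axis i 1"

definition x_b :: "'d::finite bond \<Rightarrow> int^'d" where "x_b b = fst b"
definition y_b :: "'d::finite bond \<Rightarrow> int^'d" where "y_b b = fst b + unitv (snd b)"

definition grad :: "(int^'d \<Rightarrow> real) \<Rightarrow> 'd::finite bond \<Rightarrow> real" where
  "grad u b = u (y_b b) - u (x_b b)"

definition div_star :: "('d::finite bond \<Rightarrow> real) \<Rightarrow> int^'d \<Rightarrow> real" where
  "div_star F x = (\<Sum>i\<in>UNIV. F (x - unitv i, i) - F (x, i))"

text \<open>The constant field e(b) = e . (y_b - x_b).\<close>
definition e_field :: "real^'d \<Rightarrow> 'd::finite bond \<Rightarrow> real" where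
  "e_field e b = e $ snd b"

definition shift :: "int^'d \<Rightarrow> 'd field \<Rightarrow> 'd::finite field" where
  "shift z a = (\<lambda>(x, i). a (x + z, i))"

definition Omega :: "'d::finite field measure" where
  "Omega = PiM UNIV (\<lambda>_. restrict_space borel {0..(1::real)})"

text \<open>Nearest neighbour paths and chemical distance (with 1/0 = infinity).\<close>
definition adj :: "int^'d \<Rightarrow> int^'d \<Rightarrow> bool" where
  "adj u v \<longleftrightarrow> (\<exists>i::'d::finite. v = u + unitv i \<or> u = v + unitv i)"

definition bond_of :: "int^'d \<Rightarrow> int^'d \<Rightarrow> 'd::finite bond" where
  "bond_of u v = (if \<exists>i. v = u + unitv i then (u, SOME i. v = u + unitv i)
                  else (v, SOME i. u = v + unitv i))"

definition is_path :: "(int^'d::finite) list \<Rightarrow> int^'d \<Rightarrow> int^'d \<Rightarrow> bool" where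
  "is_path xs x y \<longleftrightarrow> xs \<noteq> [] \<and> hd xs = x \<and> last xs = y \<and>
     (\<forall>k. Suc k < length xs \<longrightarrow> adj (xs ! k) (xs ! Suc k))"

definition path_cost :: "'d::finite field \<Rightarrow> (int^'d) list \<Rightarrow> ennreal" where
  "path_cost a xs = (\<Sum>k<length xs - 1. inverse (ennreal (a (bond_of (xs ! k) (xs ! Suc k)))))"

definition chem_dist :: "'d::finite field \<Rightarrow> int^'d \<Rightarrow> int^'d \<Rightarrow> ennreal" where
  "chem_dist a x y = (INF xs \<in> {xs. is_path xs x y}. path_cost a xs)"

definition kill_bond :: "'d::finite field \<Rightarrow> 'd bond \<Rightarrow> 'd field" where
  "kill_bond a b = a(b := 0)"

definition enn_powr :: "ennreal \<Rightarrow> real \<Rightarrow> ennreal" where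
  "enn_powr X p = (if X = \<top> then \<top> else ennreal (enn2real X powr p))"

text \<open>Moment bound  <X^p>^(1/p) \<le> L, written as <X^p> \<le> L^p.\<close>
definition moment_bound :: "'a measure \<Rightarrow> ('a \<Rightarrow> ennreal) \<Rightarrow> real \<Rightarrow> real \<Rightarrow> bool" where
  "moment_bound P X p L \<longleftrightarrow> (\<integral>\<^sup>+ a. enn_powr (X a) p \<partial>P) \<le> enn_powr (ennreal L) p"

definition others_alg :: "'d::finite field measure \<Rightarrow> 'd bond \<Rightarrow> 'd field measure" where
  "others_alg P b = sigma (space P)
     {(\<lambda>a. a b') -` A \<inter> space P | b' A. b' \<noteq> b \<and> A \<in> sets (borel :: real measure)}"

definition A1 :: "'d::finite field measure \<Rightarrow> bool" where
  "A1 P \<longleftrightarrow> (\<forall>z. distr P P (shift z) = P)"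

definition A2 :: "'d::finite field measure \<Rightarrow> (real \<Rightarrow> real) \<Rightarrow> bool" where
  "A2 P \<Lambda> \<longleftrightarrow> (\<forall>p>0. \<forall>i. moment_bound P (\<lambda>a. chem_dist a 0 (unitv i)) p (\<Lambda> p))"

definition A2plus :: "'d::finite field measure \<Rightarrow> (real \<Rightarrow> real) \<Rightarrow> bool" where
  "A2plus P \<Lambda> \<longleftrightarrow> (\<forall>p>0. \<forall>i.
      moment_bound P (\<lambda>a. chem_dist (kill_bond a (0, i)) 0 (unitv i)) p (\<Lambda> p))"

definition A3 :: "'d::finite field measure \<Rightarrow> real \<Rightarrow> bool" where
  "A3 P \<rho> \<longleftrightarrow> (\<forall>\<zeta>. \<zeta> \<in> borel_measurable P \<and> integrable P (\<lambda>a. (\<zeta> a)\<^sup>2) \<longrightarrow>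
      ennreal (\<integral> a. (\<zeta> a - (\<integral> a'. \<zeta> a' \<partial>P))\<^sup>2 \<partial>P)
        \<le> ennreal (1 / \<rho>) *
          (\<integral>\<^sup>+ b. (\<integral>\<^sup>+ a. ennreal ((\<zeta> a - real_cond_exp P (others_alg P b) \<zeta> a)\<^sup>2) \<partial>P)
             \<partial>count_space UNIV))"

definition is_modified_corrector ::
  "'d::finite field measure \<Rightarrow> real^'d \<Rightarrow> real \<Rightarrow> ('d field \<Rightarrow> int^'d \<Rightarrow> real) \<Rightarrow> bool" where
  "is_modified_corrector P e T \<phi> \<longleftrightarrow>
     (\<forall>x. (\<lambda>a. \<phi> a x) \<in> borel_measurable P) \<and>
     (\<forall>x z. AE a in P. \<phi> (shift z a) x = \<phi> a (x + z)) \<and>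
     integrable P (\<lambda>a. (\<phi> a 0)\<^sup>2) \<and>
     (AE a in P. \<forall>x. (1 / T) * \<phi> a x
        + div_star (\<lambda>b. a b * (grad (\<phi> a) b + e_field e b)) x = 0)"

end

theory Submission
  imports Defs
begin

text \<open>The modified corrector is almost surely the bounded solution \<open>corr\<close> obtained from the resolvent
  of \<open>l = 1 / T\<close>. Removing a bond \<open>b\<close> changes its value at the origin, up to sign, by
  \<open>a b * X * grad (green l a) b\<close>, where \<open>X\<close> is the gradient at \<open>b\<close> after the removal; a detour around \<open>b\<close> bounds \<open>X\<close> by a power of the
  chemical length of \<open>b\<close> times the gradient before it. So the spectral gap controls a high even moment of the
  corrector by a weighted sum of \<open>a b * (grad (green l a) b)^2\<close> times gradient moments, and everything
  depends on a quenched bound \<open>\<Sum> a b * (grad (green l a) b)^2 * (1 + |b|)^\<epsilon> \<le> C(a)\<close>, uniform in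
  \<open>T\<close>, with a random constant that has all moments.

  For that bound, chemical distances grow sublinearly up to a random factor, so the energy dominates the
  full Dirichlet sum in a ball of radius \<open>R\<close> up to a factor \<open>K * R^(1/32)\<close>. For \<open>d > 2\<close> averaging over
  large cubes then gives a Hardy inequality with the same loss; splitting the Green function at a level
  and applying Hardy below it and a Chebyshev count above it gains a power of \<open>R\<close> in the local square sum,
  and the Caccioppoli inequality turns this gain into decay of the energy outside a ball.

  Finally, a gradient moment of order \<open>2n + 1\<close> is controlled by the moment of order \<open>2n\<close> of the corrector:
  testing the equation with its power \<open>2n + 1\<close> bounds \<open>a (grad \<phi>)^2 \<phi>^(2n)\<close>, and along a path the factor
  \<open>\<phi>^(2n)\<close> dominates a power of the gradient. Young's inequality then absorbs this moment on the left.\<close>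

text \<open>Two spare powers of the gradient make the moment argument close. The tested energy
  controls order 2n + 2, but only through paths of random length; the sensitivity of the corrector
  asks for order 2n, but multiplied by the random quenched constant. Going from 2n + 2 to 2n + 1
  pays for the lengths, going from 2n + 1 to 2n pays for that constant, so no independence is used
  and only moments of the lengths enter. A positive \<open>l\<close> makes the Green function
  summable and the corrector bounded, with bounds that blow up as \<open>l\<close> tends to 0. They
  justify summation by parts, iteration and absorption, but none of them enters a final constant;
  this is how uniformity in \<open>T\<close> arises. Bonds are removed rather than resampled because
  a detour then avoids the bond altogether, and its length is the variable controlled by
  \<open>A2plus\<close>. Radii are written as t^32 so that every loss and every gain is a whole
  power of t.\<close>

section \<open>Lattice norm, balls and cubes\<close>

definition nrm :: "int^'d::finite \<Rightarrow> nat" where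
  "nrm x = (\<Sum>i\<in>UNIV. nat \<bar>x $ i\<bar>)"

definition bll :: "nat \<Rightarrow> (int^'d::finite) set" where
  "bll R = {x. nrm x \<le> R}"

lemma nrm_triangle: "nrm (x + y) \<le> nrm x + nrm y"
  unfolding nrm_def sum.distrib[symmetric] by (rule sum_mono) simp

lemma nrm_uminus [simp]: "nrm (- x) = nrm x"
  by (simp add: nrm_def)

lemma nrm_0 [simp]: "nrm 0 = 0"
  by (simp add: nrm_def)

lemma nrm_unitv [simp]: "nrm (unitv i) = 1"
proof -
  have "nrm (unitv i) = (\<Sum>j\<in>UNIV. if j = i then 1 else 0)"
    unfolding nrm_def unitv_def by (rule sum.cong) (auto simp: axis_def)
  then show ?thesis by simp
qed

lemma nrm_diff: "nrm (x - y) \<le> nrm x + nrm y"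
  using nrm_triangle[of x "-y"] by simp

lemma nrm_eq_0 [simp]: "nrm x = 0 \<longleftrightarrow> x = 0"
  by (auto simp: nrm_def vec_eq_iff)

lemma coord_le_nrm: "nat \<bar>x $ i\<bar> \<le> nrm x"
  unfolding nrm_def by (rule member_le_sum) auto

lemma unitv_nonzero [simp]: "unitv i \<noteq> 0"
  using nrm_unitv[of i] by (metis nrm_0 zero_neq_one)

definition cube :: "int \<Rightarrow> int \<Rightarrow> (int^'d::finite) set" where
  "cube l u = {x. \<forall>i. x $ i \<in> {l..<u}}"

text \<open>Moves cubes to \<open>PiE\<close>, where cardinalities and sums of products factorise
  over the coordinates.\<close>

lemma cube_eq: "(cube l u :: (int^'d::finite) set) = vec_lambda ` (PiE UNIV (\<lambda>_. {l..<u}))"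
proof safe
  fix x :: "int^'d" assume "x \<in> cube l u"
  then have "(\<lambda>i. x $ i) \<in> PiE UNIV (\<lambda>_. {l..<u})" by (auto simp: cube_def)
  then show "x \<in> vec_lambda ` (PiE UNIV (\<lambda>_. {l..<u}))"
    by (metis imageI vec_nth_inverse vec_lambda_eta)
qed (auto simp: cube_def PiE_def)

lemma inj_vec_lambda: "inj_on vec_lambda A"
  by (rule inj_onI) (metis vec_lambda_inverse UNIV_I)

lemma finite_cube [simp]: "finite (cube l u)"
  unfolding cube_eq by (intro finite_imageI finite_PiE) auto

lemma card_cube: "card (cube l u :: (int^'d::finite) set) = nat (u - l) ^ CARD('d)"
  unfolding cube_eq by (subst card_image[OF inj_vec_lambda]) (simp add: card_PiE)

lemma bll_subset_cube: "bll R \<subseteq> cube (- int R) (int R + 1)"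
proof
  fix x :: "int^'d" assume "x \<in> bll R"
  then have "nat \<bar>x $ i\<bar> \<le> R" for i using coord_le_nrm[of x i] by (simp add: bll_def)
  then show "x \<in> cube (- int R) (int R + 1)" unfolding cube_def by (auto simp: abs_le_iff nat_le_iff) 
     (smt (verit, best))+
qed

lemma finite_bll [simp]: "finite (bll R)"
  using bll_subset_cube finite_cube by (rule finite_subset)

lemma card_bll: "card (bll R :: (int^'d::finite) set) \<le> (2 * R + 1) ^ CARD('d)"
proof -
  have "card (bll R :: (int^'d) set) \<le> card (cube (- int R) (int R + 1) :: (int^'d) set)"
    by (intro card_mono bll_subset_cube finite_cube)
  also have "\<dots> = (2 * R + 1) ^ CARD('d)" by (simp add: card_cube nat_add_distrib nat_mult_distrib)
  finally show ?thesis .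
qed

lemma bll_mono: "R \<le> S \<Longrightarrow> bll R \<subseteq> bll S"
  by (auto simp: bll_def)

lemma nrm_cube: 
  assumes "z \<in> (cube 0 (int s) :: (int^'d::finite) set)" 
  shows "nrm z \<le> CARD('d) * s"
proof -
  have "nrm z \<le> (\<Sum>i\<in>(UNIV::'d set). s)"
    unfolding nrm_def using assms by (intro sum_mono) (auto simp: cube_def nat_le_iff less_imp_le)
  then show ?thesis by simp
qed

lemma translate_sum_le:
  fixes f :: "int^'d::finite \<Rightarrow> real"
  assumes "\<And>x. 0 \<le> f x" "nrm z \<le> S"
  shows "(\<Sum>x\<in>bll R. f (x + z)) \<le> (\<Sum>x\<in>bll (R + S). f x)"
proof -
  have "(\<Sum>x\<in>bll R. f (x + z)) = (\<Sum>x\<in>(\<lambda>x. x + z) ` bll R. f x)"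
    by (subst sum.reindex) (auto intro: inj_onI)
  also have "\<dots> \<le> (\<Sum>x\<in>bll (R + S). f x)"
  proof (rule sum_mono2)
    show "(\<lambda>x. x + z) ` bll R \<subseteq> bll (R + S)"
      using assms(2) nrm_triangle[of _ z] by (force simp: bll_def intro: order_trans[OF nrm_triangle add_mono])
  qed (use assms in auto)
  finally show ?thesis .
qed

subsection \<open>Weights\<close>

text \<open>The subtracted term carries the induction: 1 / (n + 2)^2 is at most 1 / (n + 1) - 1 / (n
  + 2), and these differences telescope.\<close>

lemma inv_sq_sum_le: "(\<Sum>k\<le>n. 1 / (1 + real k)\<^sup>2) \<le> 2 - 1 / (real n + 1)"
proof (induction n)
  case 0 then show ?case by simp
next
  case (Suc n)
  have "1 / (real n + 2)\<^sup>2 \<le> 1 / ((real n + 1) * (real n + 2))"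
    by (intro divide_left_mono) (auto simp: power2_eq_square)
  also have "\<dots> = 1 / (real n + 1) - 1 / (real n + 2)"
    by (simp add: field_simps)
  finally have "1 / (real n + 2)\<^sup>2 \<le> 1 / (real n + 1) - 1 / (real n + 2)" .
  then show ?case using Suc by (simp add: add.commute)
qed

lemma inv_sq_int_sum_le: "(\<Sum>m\<in>{- int R..<int R + 1}. 1 / (1 + \<bar>real_of_int m\<bar>)\<^sup>2) \<le> 4"
proof -
  let ?f = "\<lambda>m. 1 / (1 + \<bar>real_of_int m\<bar>)\<^sup>2"
  have *: "(\<Sum>m\<in>int ` {..R}. ?f m) \<le> 2" "(\<Sum>m\<in>(\<lambda>k. - int k) ` {..R}. ?f m) \<le> 2"
    using inv_sq_sum_le[of R] 
    by (subst sum.reindex; auto intro!: inj_onI order_trans[OF inv_sq_sum_le])+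
  have "{- int R..<int R + 1} \<subseteq> int ` {..R} \<union> (\<lambda>k. - int k) ` {..R}"
  proof
    fix m assume m: "m \<in> {- int R..<int R + 1}"
    show "m \<in> int ` {..R} \<union> (\<lambda>k. - int k) ` {..R}"
    proof (cases "m \<ge> 0")
      case True then show ?thesis using m by (auto intro!: image_eqI[of _ _ "nat m"])
    next
      case False then show ?thesis using m by (intro UnI2 image_eqI[of _ _ "nat (-m)"]) auto
    qed
  qed
  then have "(\<Sum>m\<in>{- int R..<int R + 1}. ?f m) \<le> (\<Sum>m\<in>int ` {..R} \<union> (\<lambda>k. - int k) ` {..R}. ?f m)"
    by (intro sum_mono2) auto
  also have "\<dots> \<le> (\<Sum>m\<in>int ` {..R}. ?f m) + (\<Sum>m\<in>(\<lambda>k. - int k) ` {..R}. ?f m)"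
    by (subst sum.union_inter[symmetric]) (auto intro!: sum_nonneg)
  finally show ?thesis using * by linarith
qed

definition wgt :: "int^'d::finite \<Rightarrow> real" where
  "wgt x = 1 / (1 + real (nrm x)) ^ (2 * CARD('d))"

lemma wgt_nonneg [simp]: "0 \<le> wgt x"
  by (auto simp: wgt_def add_nonneg_pos)

lemma finite_subset_bll:
  assumes "finite B" obtains R where "B \<subseteq> bll R"
proof
  show "B \<subseteq> bll (Max (insert 0 (nrm ` B)))"
    using assms by (auto simp: bll_def intro!: Max_ge)
qed

text \<open>Every 1 + |x_i| is at most 1 + \<open>nrm x\<close>, so the exponent 2d puts
  \<open>wgt\<close> below a product of one-dimensional inverse squares, whose sum over a cube
  factorises.\<close>

lemma sum_wgt_le:
  assumes "finite (B :: (int^'d::finite) set)"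
  shows "(\<Sum>x\<in>B. wgt x) \<le> 4 ^ CARD('d)"
proof -
  obtain R where R: "B \<subseteq> bll R" using finite_subset_bll[OF assms] .
  let ?f = "\<lambda>m. 1 / (1 + \<bar>real_of_int m\<bar>)\<^sup>2"
  have w: "wgt x \<le> (\<Prod>i\<in>UNIV. ?f (x $ i))" for x :: "int^'d"
  proof -
    have "(\<Prod>i\<in>(UNIV::'d set). (1 + \<bar>real_of_int (x $ i)\<bar>)\<^sup>2) \<le> (\<Prod>i\<in>(UNIV::'d set). (1 + real (nrm x))\<^sup>2)"
    proof (intro prod_mono conjI power_mono add_left_mono)
      fix i show "\<bar>real_of_int (x $ i)\<bar> \<le> real (nrm x)" using coord_le_nrm[of x i] by linarith
    qed auto
    also have "\<dots> = (1 + real (nrm x)) ^ (2 * CARD('d))" by (simp add: power_mult)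
    finally have "wgt x \<le> 1 / (\<Prod>i\<in>(UNIV::'d set). (1 + \<bar>real_of_int (x $ i)\<bar>)\<^sup>2)"
      unfolding wgt_def by (intro divide_left_mono mult_pos_pos) (auto intro!: prod_pos simp: add_nonneg_pos)
    then show ?thesis by (simp add: prod_dividef)
  qed
  have "(\<Sum>x\<in>B. wgt x) \<le> (\<Sum>x\<in>(cube (- int R) (int R + 1) :: (int^'d) set). wgt x)"
    using R bll_subset_cube by (intro sum_mono2) auto
  also have "\<dots> \<le> (\<Sum>x\<in>(cube (- int R) (int R + 1) :: (int^'d) set). \<Prod>i\<in>UNIV. ?f (x $ i))"
    by (intro sum_mono w)
  also have "\<dots> = (\<Prod>i\<in>(UNIV::'d set). \<Sum>m\<in>{- int R..<int R + 1}. ?f m)"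
    unfolding cube_eq by (subst sum.reindex[OF inj_vec_lambda], subst prod_sum_PiE) auto
  also have "\<dots> \<le> (\<Prod>i\<in>(UNIV::'d set). 4)"
    by (intro prod_mono conjI inv_sq_int_sum_le sum_nonneg) auto
  finally show ?thesis by simp
qed

lemma ennreal_inverse_le:
  assumes "(x::ennreal) \<le> y" shows "inverse y \<le> inverse x"
  
proof (cases "x = 0 \<or> y = \<top>")
  case False
  with assms have "x \<noteq> \<top>" by (auto simp: top.extremum_unique)
  with False obtain r s where "x = ennreal r" "y = ennreal s" "0 < r" "0 \<le> s"
    by (metis ennreal_cases ennreal_neg less_eq_real_def linorder_not_less ennreal_0)
  moreover from this have "r \<le> s" using assms by (simp add: ennreal_le_iff)
  ultimately show ?thesis by (simp add: inverse_ennreal ennreal_leI le_imp_inverse_le)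
qed auto

section \<open>Paths\<close>

lemma x_b_pair [simp]: "x_b (x, i) = x" and y_b_pair [simp]: "y_b (x, i) = x + unitv i"
  by (auto simp: x_b_def y_b_def)

lemma grad_pair: "grad u (x, i) = u (x + unitv i) - u x"
  by (simp add: grad_def)

lemma bond_of_cases:
  assumes "adj u v"
  shows "(x_b (bond_of u v) = u \<and> y_b (bond_of u v) = v) \<or> (x_b (bond_of u v) = v \<and> y_b (bond_of u v) = u)"
proof (cases "\<exists>i. v = u + unitv i")
  case True
  then have "v = u + unitv (SOME i. v = u + unitv i)" by (rule someI_ex)
  then show ?thesis using True by (simp add: bond_of_def x_b_def y_b_def)
next
  case False
  then have "\<exists>i. u = v + unitv i" using assms by (auto simp: adj_def)
  then have "u = v + unitv (SOME i. u = v + unitv i)" by (rule someI_ex)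
  then show ?thesis using False by (simp add: bond_of_def x_b_def y_b_def)
qed

lemma adj_nrm: "adj u v \<Longrightarrow> nrm (v - u) = 1"
  using nrm_uminus[of "v - u"] by (auto simp: adj_def)

lemma path_nrm:
  assumes "is_path xs x y" "k < length xs"
  shows "nrm (xs ! k - x) \<le> k"
  using assms(2)
proof (induction k)
  case 0 then show ?case using assms(1) by (simp add: is_path_def hd_conv_nth)
next
  case (Suc k)
  have "adj (xs ! k) (xs ! Suc k)" using assms(1) Suc.prems by (auto simp: is_path_def)
  then have "nrm (xs ! Suc k - xs ! k) = 1" by (rule adj_nrm)
  then show ?case using Suc nrm_triangle[of "xs ! Suc k - xs ! k" "xs ! k - x"] by simp
qed

text \<open>Conductances are at most 1, so a path of cost below h has fewer than h bonds, and no
  single bond costs more than h. The increment of u is spread over these bonds, hence one of them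
  carries at least the fraction 1 / h. A single bond instead of a sum along the path keeps later
  comparisons pointwise.\<close>

lemma chem_dist_witness:
  fixes a :: "'d::finite field" and u :: "int^'d \<Rightarrow> real"
  assumes a: "\<And>b. 0 \<le> a b \<and> a b \<le> 1" and h: "chem_dist a x y < ennreal h" and "x \<noteq> y"
  obtains b where "real (nrm (x_b b - x)) \<le> h" "1 \<le> h * a b" "\<bar>u y - u x\<bar> \<le> h * \<bar>grad u b\<bar>"
proof -
  obtain xs where p: "is_path xs x y" and c: "path_cost a xs < ennreal h"
    using h unfolding chem_dist_def by (auto simp: INF_less_iff)
  define n where "n = length xs - 1"
  define B where "B k = bond_of (xs ! k) (xs ! Suc k)" for k
  have ne: "xs \<noteq> []" using p by (simp add: is_path_def)
  then have len: "length xs = Suc n" by (simp add: n_def)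
  have hp: "h > 0" using c by (metis ennreal_neg linorder_not_less zero_le)
  have x0: "xs ! 0 = x" and yn: "xs ! n = y" using p ne by (auto simp: is_path_def hd_conv_nth last_conv_nth n_def)
  then have n0: "n \<noteq> 0" using \<open>x \<noteq> y\<close> by metis
  have adj: "adj (xs ! k) (xs ! Suc k)" if "k < n" for k using p that len by (auto simp: is_path_def)
  have inv1: "1 \<le> inverse (ennreal (a b))" for b
    using a[of b] ennreal_le_1 by (metis ennreal_inverse_1 ennreal_inverse_le)
  have cost: "path_cost a xs = (\<Sum>k<n. inverse (ennreal (a (B k))))"
    by (simp add: path_cost_def n_def B_def)
  have "of_nat n \<le> (\<Sum>k<n. inverse (ennreal (a (B k))))"
    using sum_mono[of "{..<n}" "\<lambda>_. 1::ennreal" "\<lambda>k. inverse (ennreal (a (B k)))"] inv1 by simp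
  then have "ennreal (real n) < ennreal h" using c cost by (simp add: ennreal_of_nat_eq_real_of_nat)
  then have nh: "real n < h" by (simp add: ennreal_less_iff)
  have ha: "1 \<le> h * a (B k)" if "k < n" for k
  proof -
    have "inverse (ennreal (a (B k))) \<le> (\<Sum>k<n. inverse (ennreal (a (B k))))"
      using that by (intro member_le_sum) auto
    then have l: "inverse (ennreal (a (B k))) < ennreal h" using c cost by simp
    have "a (B k) \<noteq> 0" using l by auto
    then have "a (B k) > 0" using a[of "B k"] by linarith
    then have "inverse (a (B k)) < h" using l by (simp add: inverse_ennreal ennreal_less_iff)
    then show ?thesis using \<open>a (B k) > 0\<close> by (simp add: field_simps)
  qed
  have "\<exists>k<n. \<bar>u y - u x\<bar> \<le> h * \<bar>u (xs ! Suc k) - u (xs ! k)\<bar>"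
  proof (rule ccontr)
    assume "\<not> ?thesis"
    then have l: "h * \<bar>u (xs ! Suc k) - u (xs ! k)\<bar> < \<bar>u y - u x\<bar>" if "k < n" for k using that by force
    have "u y - u x = (\<Sum>k<n. u (xs ! Suc k) - u (xs ! k))"
      by (simp add: sum_lessThan_telescope[of "\<lambda>k. u (xs ! k)"] x0 yn)
    then have "h * \<bar>u y - u x\<bar> \<le> h * (\<Sum>k<n. \<bar>u (xs ! Suc k) - u (xs ! k)\<bar>)"
      using hp by (simp add: sum_abs)
    also have "\<dots> = (\<Sum>k<n. h * \<bar>u (xs ! Suc k) - u (xs ! k)\<bar>)" by (simp add: sum_distrib_left)
    also have "\<dots> < (\<Sum>k<n. \<bar>u y - u x\<bar>)" using n0 l by (intro sum_strict_mono) auto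
    also have "\<dots> \<le> h * \<bar>u y - u x\<bar>" using nh by (simp add: mult_right_mono)
    finally show False by simp
  qed
  then obtain k where k: "k < n" "\<bar>u y - u x\<bar> \<le> h * \<bar>u (xs ! Suc k) - u (xs ! k)\<bar>" by blast
  have "x_b (B k) = xs ! k \<and> y_b (B k) = xs ! Suc k \<or> x_b (B k) = xs ! Suc k \<and> y_b (B k) = xs ! k"
    unfolding B_def by (rule bond_of_cases[OF adj[OF k(1)]])
  moreover have "nrm (xs ! k - x) \<le> n" "nrm (xs ! Suc k - x) \<le> n"
    using path_nrm[OF p, of k] path_nrm[OF p, of "Suc k"] k(1) len by auto
  ultimately have "nrm (x_b (B k) - x) \<le> n \<and> \<bar>grad u (B k)\<bar> = \<bar>u (xs ! Suc k) - u (xs ! k)\<bar>"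
    by (auto simp: grad_def abs_minus_commute)
  then show thesis using that[of "B k"] nh ha[OF k(1)] k by (smt (verit) of_nat_le_iff)
qed

text \<open>Cancelling z makes the conditions under \<open>SOME\<close> literally the same, so the
  chosen index agrees without any appeal to its uniqueness.\<close>

lemma bond_of_add:
  "bond_of (u + z) (v + z) = (case bond_of u v of (x, i) \<Rightarrow> (x + z, i))"
proof -
  have *: "v + z = u + z + w \<longleftrightarrow> v = u + w" for u v w by (auto simp: algebra_simps)
  show ?thesis unfolding bond_of_def * by auto
qed

text \<open>Translating a path preserves its cost. One inequality is enough, since lengths are only
  ever bounded from above.\<close>

lemma chem_dist_shift_le: "chem_dist a (x + z) (y + z) \<le> chem_dist (shift z a) x y"
  unfolding chem_dist_def
proof (rule INF_mono)
  fix xs assume "xs \<in> {xs. is_path xs x y}"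
  then have p: "is_path xs x y" by simp
  let ?ys = "map (\<lambda>u. u + z) xs"
  have "adj (u + z) (v + z) \<longleftrightarrow> adj u v" for u v by (auto simp: adj_def algebra_simps)
  then have "is_path ?ys (x + z) (y + z)" using p by (auto simp: is_path_def hd_map last_map)
  moreover have "path_cost a ?ys = path_cost (shift z a) xs"
    unfolding path_cost_def by (intro sum.cong) (auto simp: bond_of_add shift_def split: prod.split)
  ultimately show "\<exists>m\<in>{xs. is_path xs (x + z) (y + z)}. path_cost a m \<le> path_cost (shift z a) xs"
    by (intro bexI[of _ ?ys]) auto
qed

lemma chem_dist_kill_le:
  assumes "\<And>b. 0 \<le> a b"
  shows "chem_dist a x y \<le> chem_dist (kill_bond a b) x y"
  unfolding chem_dist_def path_cost_def
proof (rule INF_mono)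
  fix xs assume "xs \<in> {xs. is_path xs x y}"
  moreover have "inverse (ennreal (a b')) \<le> inverse (ennreal (kill_bond a b b'))" for b'
    using assms by (intro ennreal_inverse_le ennreal_leI) (simp add: kill_bond_def)
  ultimately show "\<exists>m\<in>{xs. is_path xs x y}. (\<Sum>k<length m - 1. inverse (ennreal (a (bond_of (m ! k) (m ! Suc k)))))
      \<le> (\<Sum>k<length xs - 1. inverse (ennreal (kill_bond a b (bond_of (xs ! k) (xs ! Suc k)))))"
    by (intro bexI[of _ xs] sum_mono) auto
qed

section \<open>Summation by parts\<close>

lemma has_sum_diff_real:
  fixes f g :: "'a \<Rightarrow> real"
  assumes "(f has_sum a) A" "(g has_sum b) A"
  shows "((\<lambda>x. f x - g x) has_sum (a - b)) A"
  using has_sum_add[OF assms(1) has_sum_uminusI[OF assms(2)]] by simp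

lemma has_sum_finite_add:
  fixes f :: "'i \<Rightarrow> 'a \<Rightarrow> real"
  assumes "finite I" "\<And>i. i \<in> I \<Longrightarrow> (f i has_sum s i) A"
  shows "((\<lambda>x. \<Sum>i\<in>I. f i x) has_sum (\<Sum>i\<in>I. s i)) A"
  using assms by (induction rule: finite_induct) (auto intro!: has_sum_add)

lemma bij_add: "bij (\<lambda>x. x + (z :: int^'d::finite))"
  by (rule bijI) (auto intro: injI surjI[of _ "\<lambda>x. x - z"])

text \<open>Summability of the two halves separately permits reindexing one of them by the
  translation \<open>unitv i\<close>; on the whole lattice no boundary term arises.\<close>

lemma has_sum_div_star:
  fixes v :: "int^'d::finite \<Rightarrow> real"
  assumes "\<And>i. (\<lambda>x. v x * F (x, i)) summable_on UNIV"
    and "\<And>i. (\<lambda>x. v (x + unitv i) * F (x, i)) summable_on UNIV"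
  shows "((\<lambda>x. v x * div_star F x) has_sum (\<Sum>i\<in>UNIV. \<Sum>\<^sub>\<infinity>x. F (x, i) * grad v (x, i))) UNIV"
    and "(\<lambda>x. F (x, i) * grad v (x, i)) summable_on UNIV"
proof -
  have 1: "((\<lambda>x. v x * F (x, i)) has_sum (\<Sum>\<^sub>\<infinity>x. v x * F (x, i))) UNIV" for i
    using assms(1) by simp
  have 2: "((\<lambda>x. v (x + unitv i) * F (x, i)) has_sum (\<Sum>\<^sub>\<infinity>x. v (x + unitv i) * F (x, i))) UNIV" for i
    using assms(2) by simp
  have sh: "((\<lambda>x. v x * F (x - unitv i, i)) has_sum (\<Sum>\<^sub>\<infinity>x. v (x + unitv i) * F (x, i))) UNIV" for i
    using 2[of i] has_sum_reindex_bij_betw[OF bij_add[of "unitv i"], of "\<lambda>x. v x * F (x - unitv i, i)"] by simp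
  have g: "((\<lambda>x. F (x, i) * grad v (x, i)) has_sum
      ((\<Sum>\<^sub>\<infinity>x. v (x + unitv i) * F (x, i)) - (\<Sum>\<^sub>\<infinity>x. v x * F (x, i)))) UNIV" for i
    using has_sum_diff_real[OF 2[of i] 1[of i]] by (simp add: grad_pair algebra_simps)
  show "(\<lambda>x. F (x, i) * grad v (x, i)) summable_on UNIV"
    using g by (auto simp: summable_on_def)
  have "((\<lambda>x. \<Sum>i\<in>UNIV. v x * F (x - unitv i, i) - v x * F (x, i)) has_sum
     (\<Sum>i\<in>UNIV. (\<Sum>\<^sub>\<infinity>x. v (x + unitv i) * F (x, i)) - (\<Sum>\<^sub>\<infinity>x. v x * F (x, i)))) UNIV"
    by (intro has_sum_finite_add has_sum_diff_real 1 sh) auto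
  moreover have "(\<lambda>x. \<Sum>i\<in>UNIV. v x * F (x - unitv i, i) - v x * F (x, i)) = (\<lambda>x. v x * div_star F x)"
    by (simp add: div_star_def sum_distrib_left algebra_simps)
  ultimately show "((\<lambda>x. v x * div_star F x) has_sum (\<Sum>i\<in>UNIV. \<Sum>\<^sub>\<infinity>x. F (x, i) * grad v (x, i))) UNIV"
    by (simp add: infsumI[OF g])
qed

section \<open>Summability with explicit bounds\<close>

text \<open>A bound over finite sets passes through the Jacobi series term by term, and yields both
  summability and a supremum bound with the same constant.\<close>

definition l1_le :: "('a \<Rightarrow> real) \<Rightarrow> real \<Rightarrow> bool" where
  "l1_le u W \<longleftrightarrow> (\<forall>B. finite B \<longrightarrow> (\<Sum>x\<in>B. \<bar>u x\<bar>) \<le> W)"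

lemma l1_le_abs: "l1_le u W \<Longrightarrow> \<bar>u x\<bar> \<le> W"
  unfolding l1_le_def by (erule allE[of _ "{x}"]) simp

lemma l1_le_summable:
  fixes u :: "'a \<Rightarrow> real"
  assumes "l1_le u W" "\<And>x. \<bar>c x\<bar> \<le> C"
  shows "(\<lambda>x. c x * u x) summable_on UNIV"
proof -
  have "(\<lambda>x. norm (c x * u x)) summable_on UNIV"
  proof (rule nonneg_bdd_above_summable_on)
    show "bdd_above (sum (\<lambda>x. norm (c x * u x)) ` {F. F \<subseteq> UNIV \<and> finite F})"
    proof (rule bdd_aboveI2)
      fix B assume B: "B \<in> {F::'a set. F \<subseteq> UNIV \<and> finite F}"
      have C0: "0 \<le> C" using assms(2)[of undefined] by linarith
      have "(\<Sum>x\<in>B. norm (c x * u x)) \<le> (\<Sum>x\<in>B. C * \<bar>u x\<bar>)"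
        using assms(2) by (intro sum_mono) (simp add: abs_mult mult_right_mono)
      also have "\<dots> = C * (\<Sum>x\<in>B. \<bar>u x\<bar>)" by (simp add: sum_distrib_left)
      also have "\<dots> \<le> C * W" using assms(1) B C0 by (intro mult_left_mono) (auto simp: l1_le_def)
      finally show "(\<Sum>x\<in>B. norm (c x * u x)) \<le> C * W" .
    qed
  qed auto
  then show ?thesis by (rule abs_summable_summable)
qed

lemma l1_le_inj:
  fixes g :: "'b \<Rightarrow> 'a"
  assumes "l1_le u W" "inj g" shows "l1_le (\<lambda>x. u (g x)) W"
  unfolding l1_le_def
proof (intro allI impI)
  fix B :: "'b set" assume "finite B"
  then have "(\<Sum>x\<in>g ` B. \<bar>u x\<bar>) \<le> W" using assms by (simp add: l1_le_def)
  then show "(\<Sum>x\<in>B. \<bar>u (g x)\<bar>) \<le> W" using assms(2) by (simp add: sum.reindex inj_on_subset)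
qed

lemma l1_le_shift: "l1_le u W \<Longrightarrow> l1_le (\<lambda>x. u (x + (z :: int^'d::finite))) W"
  by (erule l1_le_inj) (auto intro: injI)

lemma l1_le_cmult:
  assumes "l1_le u W" shows "l1_le (\<lambda>x. c * u x) (\<bar>c\<bar> * W)"
  unfolding l1_le_def
proof (intro allI impI)
  fix B :: "'a set" assume "finite B"
  then have "\<bar>c\<bar> * (\<Sum>x\<in>B. \<bar>u x\<bar>) \<le> \<bar>c\<bar> * W" using assms by (intro mult_left_mono) (auto simp: l1_le_def)
  then show "(\<Sum>x\<in>B. \<bar>c * u x\<bar>) \<le> \<bar>c\<bar> * W" by (simp add: sum_distrib_left abs_mult)
qed

lemma l1_le_add:
  assumes "l1_le u U" "l1_le v V" shows "l1_le (\<lambda>x. u x + v x) (U + V)"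
  unfolding l1_le_def
proof (intro allI impI)
  fix B :: "'a set" assume B: "finite B"
  have "(\<Sum>x\<in>B. \<bar>u x + v x\<bar>) \<le> (\<Sum>x\<in>B. \<bar>u x\<bar>) + (\<Sum>x\<in>B. \<bar>v x\<bar>)"
    unfolding sum.distrib[symmetric] by (intro sum_mono) simp
  then show "(\<Sum>x\<in>B. \<bar>u x + v x\<bar>) \<le> U + V" using assms B by (fastforce simp: l1_le_def)
qed

lemma sum_bonds_le_infsum:
  fixes f :: "'d::finite bond \<Rightarrow> real"
  assumes "finite B" "\<And>b. 0 \<le> f b" "\<And>i. (\<lambda>x. f (x, i)) summable_on UNIV"
  shows "(\<Sum>b\<in>B. f b) \<le> (\<Sum>i\<in>UNIV. \<Sum>\<^sub>\<infinity>x. f (x, i))"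
proof -
  have "(\<Sum>b\<in>B. f b) \<le> (\<Sum>b\<in>fst ` B \<times> UNIV. f b)"
    using assms by (intro sum_mono2) (auto intro: rev_image_eqI)
  also have "\<dots> = (\<Sum>i\<in>UNIV. \<Sum>x\<in>fst ` B. f (x, i))"
    by (subst sum.swap) (simp add: sum.cartesian_product)
  also have "\<dots> \<le> (\<Sum>i\<in>UNIV. \<Sum>\<^sub>\<infinity>x. f (x, i))"
    using assms by (intro sum_mono finite_sum_le_infsum) auto
  finally show ?thesis .
qed

section \<open>The resolvent\<close>

definition unit_field :: "'d::finite field \<Rightarrow> bool" where
  "unit_field a \<longleftrightarrow> (\<forall>b. 0 \<le> a b \<and> a b \<le> 1)"

lemma unit_fieldD: "unit_field a \<Longrightarrow> 0 \<le> a b" "unit_field a \<Longrightarrow> a b \<le> 1"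
  unfolding unit_field_def by blast+

text \<open>Jacobi iteration: the equation for \<open>u\<close> reads \<open>(l + 2d) u = f + jump a u\<close>. The diagonal terms \<open>1 - a\<close> make
  \<open>jump a\<close> positive and symmetric with row sums \<open>2d\<close>, so the series converges both in the supremum norm
  and in \<open>l1\<close>, whatever the field is.\<close>
definition jump :: "'d::finite field \<Rightarrow> (int^'d \<Rightarrow> real) \<Rightarrow> int^'d \<Rightarrow> real" where
  "jump a u x = (\<Sum>i\<in>UNIV. a (x - unitv i, i) * u (x - unitv i) + (1 - a (x - unitv i, i)) * u x
     + a (x, i) * u (x + unitv i) + (1 - a (x, i)) * u x)"

lemma div_star_grad:
  fixes u :: "int^'d::finite \<Rightarrow> real"
  shows "div_star (\<lambda>b. a b * grad u b) x = 2 * real CARD('d) * u x - jump a u x"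
proof -
  have "2 * real CARD('d) * u x = (\<Sum>i\<in>(UNIV::'d set). 2 * u x)" by simp
  then show ?thesis unfolding div_star_def jump_def
    by (simp only: sum_subtractf[symmetric]) (simp add: grad_pair algebra_simps del: sum_constant)
qed

lemma jump_bound:
  fixes F :: real
  assumes "unit_field a" "\<And>x. \<bar>u x\<bar> \<le> F"
  shows "\<bar>jump a u (x :: int^'d::finite)\<bar> \<le> 2 * real CARD('d) * F"
proof -
  have c: "\<bar>t * p + (1 - t) * q\<bar> \<le> F" if "0 \<le> t" "t \<le> 1" "\<bar>p\<bar> \<le> F" "\<bar>q\<bar> \<le> F" for t p q :: real
  proof -
    have "\<bar>t * p + (1 - t) * q\<bar> \<le> t * \<bar>p\<bar> + (1 - t) * \<bar>q\<bar>"
      using that by (intro order_trans[OF abs_triangle_ineq]) (simp add: abs_mult)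
    also have "\<dots> \<le> t * F + (1 - t) * F" using that by (intro add_mono mult_left_mono) auto
    finally show ?thesis by (simp add: algebra_simps)
  qed
  have "\<bar>jump a u x\<bar> \<le> (\<Sum>i\<in>(UNIV::'d set). 2 * F)"
    unfolding jump_def
  proof (intro order_trans[OF sum_abs] sum_mono)
    fix i
    show "\<bar>a (x - unitv i, i) * u (x - unitv i) + (1 - a (x - unitv i, i)) * u x
      + a (x, i) * u (x + unitv i) + (1 - a (x, i)) * u x\<bar> \<le> 2 * F"
      using c[of "a (x - unitv i, i)" "u (x - unitv i)" "u x"] c[of "a (x, i)" "u (x + unitv i)" "u x"]
        assms unit_fieldD by (smt (verit))
  qed
  then show ?thesis by simp
qed

lemma jump_nonneg:
  assumes "unit_field a" "\<And>x. 0 \<le> u x"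
  shows "0 \<le> jump a u x"
  unfolding jump_def using assms unit_fieldD[OF assms(1)] by (intro sum_nonneg add_nonneg_nonneg mult_nonneg_nonneg) auto

text \<open>Symmetry makes column sums equal to row sums: after translation, each point of the
  enlarged set \<open>D\<close> collects the weights a and 1 - a of the same bond, which add up to
  1.\<close>

lemma jump_l1:
  fixes u :: "int^'d::finite \<Rightarrow> real"
  assumes a: "unit_field a" and u: "l1_le u F"
  shows "l1_le (jump a u) (2 * real CARD('d) * F)"
  unfolding l1_le_def
proof (intro allI impI)
  fix B :: "(int^'d) set" assume B: "finite B"
  have i: "(\<Sum>x\<in>B. a (x - unitv i, i) * \<bar>u (x - unitv i)\<bar> + (1 - a (x - unitv i, i)) * \<bar>u x\<bar>
     + a (x, i) * \<bar>u (x + unitv i)\<bar> + (1 - a (x, i)) * \<bar>u x\<bar>) \<le> 2 * F" for i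
  proof -
    define D where "D = B \<union> (\<lambda>x. x - unitv i) ` B \<union> (\<lambda>x. x + unitv i) ` B"
    have D: "finite D" using B by (simp add: D_def)
    note [simp] = unit_fieldD[OF a]
    have 1: "(\<Sum>x\<in>B. a (x - unitv i, i) * \<bar>u (x - unitv i)\<bar>) \<le> (\<Sum>x\<in>D. a (x, i) * \<bar>u x\<bar>)"
    proof -
      have "(\<Sum>x\<in>B. a (x - unitv i, i) * \<bar>u (x - unitv i)\<bar>) = (\<Sum>x\<in>(\<lambda>x. x - unitv i) ` B. a (x, i) * \<bar>u x\<bar>)"
        by (subst sum.reindex) (auto simp: inj_on_def)
      also have "\<dots> \<le> (\<Sum>x\<in>D. a (x, i) * \<bar>u x\<bar>)"
        by (rule sum_mono2[OF D]) (auto simp: D_def)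
      finally show ?thesis .
    qed
    have 2: "(\<Sum>x\<in>B. (1 - a (x, i)) * \<bar>u x\<bar>) \<le> (\<Sum>x\<in>D. (1 - a (x, i)) * \<bar>u x\<bar>)"
      by (intro sum_mono2 D) (auto simp: D_def)
    have 3: "(\<Sum>x\<in>B. a (x, i) * \<bar>u (x + unitv i)\<bar>) \<le> (\<Sum>x\<in>D. a (x - unitv i, i) * \<bar>u x\<bar>)"
    proof -
      have "(\<Sum>x\<in>B. a (x, i) * \<bar>u (x + unitv i)\<bar>) = (\<Sum>x\<in>(\<lambda>x. x + unitv i) ` B. a (x - unitv i, i) * \<bar>u x\<bar>)"
        by (subst sum.reindex) (auto simp: inj_on_def)
      also have "\<dots> \<le> (\<Sum>x\<in>D. a (x - unitv i, i) * \<bar>u x\<bar>)"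
        by (rule sum_mono2[OF D]) (auto simp: D_def)
      finally show ?thesis .
    qed
    have 4: "(\<Sum>x\<in>B. (1 - a (x - unitv i, i)) * \<bar>u x\<bar>) \<le> (\<Sum>x\<in>D. (1 - a (x - unitv i, i)) * \<bar>u x\<bar>)"
      by (intro sum_mono2 D) (auto simp: D_def)
    have 5: "(\<Sum>x\<in>D. a (x, i) * \<bar>u x\<bar>) + (\<Sum>x\<in>D. (1 - a (x, i)) * \<bar>u x\<bar>) = (\<Sum>x\<in>D. \<bar>u x\<bar>)"
      unfolding sum.distrib[symmetric] by (simp add: algebra_simps)
    have 6: "(\<Sum>x\<in>D. a (x - unitv i, i) * \<bar>u x\<bar>) + (\<Sum>x\<in>D. (1 - a (x - unitv i, i)) * \<bar>u x\<bar>) = (\<Sum>x\<in>D. \<bar>u x\<bar>)"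
      unfolding sum.distrib[symmetric] by (simp add: algebra_simps)
    have "(\<Sum>x\<in>D. \<bar>u x\<bar>) \<le> F" using u D by (simp add: l1_le_def)
    then show ?thesis using 1 2 3 4 5 6 by (simp add: sum.distrib)
  qed
  have "(\<Sum>x\<in>B. \<bar>jump a u x\<bar>) \<le> (\<Sum>x\<in>B. \<Sum>i\<in>UNIV. a (x - unitv i, i) * \<bar>u (x - unitv i)\<bar> + (1 - a (x - unitv i, i)) * \<bar>u x\<bar>
     + a (x, i) * \<bar>u (x + unitv i)\<bar> + (1 - a (x, i)) * \<bar>u x\<bar>)"
    unfolding jump_def
  proof (intro sum_mono order_trans[OF sum_abs])
    fix x :: "int^'d" and i :: 'd
    have "\<bar>p + q + r + s\<bar> \<le> \<bar>p\<bar> + \<bar>q\<bar> + \<bar>r\<bar> + \<bar>s\<bar>" for p q r s :: real by linarith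
    from this[of "a (x - unitv i, i) * u (x - unitv i)" "(1 - a (x - unitv i, i)) * u x" "a (x, i) * u (x + unitv i)" "(1 - a (x, i)) * u x"]
    show "\<bar>a (x - unitv i, i) * u (x - unitv i) + (1 - a (x - unitv i, i)) * u x
      + a (x, i) * u (x + unitv i) + (1 - a (x, i)) * u x\<bar> \<le> a (x - unitv i, i) * \<bar>u (x - unitv i)\<bar> + (1 - a (x - unitv i, i)) * \<bar>u x\<bar>
     + a (x, i) * \<bar>u (x + unitv i)\<bar> + (1 - a (x, i)) * \<bar>u x\<bar>"
      using unit_fieldD[OF a] by (simp add: abs_mult)
  qed
  also have "\<dots> \<le> (\<Sum>i\<in>(UNIV::'d set). 2 * F)"
    by (subst sum.swap) (rule sum_mono, rule i)
  finally show "(\<Sum>x\<in>B. \<bar>jump a u x\<bar>) \<le> 2 * real CARD('d) * F" by simp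
qed

lemma jump_iter_bound:
  assumes "unit_field a" "\<And>x. \<bar>f x\<bar> \<le> F"
  shows "\<bar>(jump a ^^ k) f (x :: int^'d::finite)\<bar> \<le> (2 * real CARD('d)) ^ k * F"
  using assms(2)
proof (induction k arbitrary: x)
  case (Suc k)
  show ?case using jump_bound[OF assms(1), of "(jump a ^^ k) f" "(2 * real CARD('d)) ^ k * F" x] Suc by (simp add: mult.assoc)
qed simp

lemma jump_iter_l1:
  assumes "unit_field a" "l1_le f F"
  shows "l1_le ((jump a ^^ k) (f :: int^'d::finite \<Rightarrow> real)) ((2 * real CARD('d)) ^ k * F)"
proof (induction k)
  case (Suc k)
  show ?case using jump_l1[OF assms(1) Suc] by (simp add: mult.assoc)
qed (use assms in simp)

definition resolvent :: "real \<Rightarrow> 'd::finite field \<Rightarrow> (int^'d \<Rightarrow> real) \<Rightarrow> int^'d \<Rightarrow> real" where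
  "resolvent l a f x = (\<Sum>k. (jump a ^^ k) f x / (l + 2 * real CARD('d)) ^ Suc k)"

context
  fixes l :: real and a :: "'d::finite field"
  assumes l: "0 < l" and a: "unit_field a"
begin

text \<open>The ratio 2d / (l + 2d) is below 1 only thanks to \<open>l\<close>; every later factor 1
  / l originates here.\<close>

lemma geom_sums:
  "(\<lambda>k. (2 * real CARD('d)) ^ k * F / (l + 2 * real CARD('d)) ^ Suc k) sums (F / l)"
proof -
  let ?r = "2 * real CARD('d) / (l + 2 * real CARD('d))"
  have p: "0 < l + 2 * real CARD('d)" using l by (simp add: add_pos_nonneg)
  have S: "(\<lambda>k. F / (l + 2 * real CARD('d)) * ?r ^ k) sums (F / (l + 2 * real CARD('d)) * (1 / (1 - ?r)))"
    using l p by (intro sums_mult geometric_sums) (auto simp: field_simps)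
  have e1: "F / (l + 2 * real CARD('d)) * (1 / (1 - ?r)) = F / l"
  proof -
    have "1 - ?r = l / (l + 2 * real CARD('d))" using p by (simp add: field_simps)
    then show ?thesis using l p by simp
  qed
  have e2: "(\<lambda>k. F / (l + 2 * real CARD('d)) * ?r ^ k) = (\<lambda>k. (2 * real CARD('d)) ^ k * F / (l + 2 * real CARD('d)) ^ Suc k)"
    by (simp add: power_divide mult.commute)
  show ?thesis using S unfolding e1 e2 .
qed

lemma resolvent_abs_summable:
  fixes f :: "int^'d \<Rightarrow> real" and x :: "int^'d"
  assumes "\<And>x. \<bar>f x\<bar> \<le> F"
  shows "summable (\<lambda>k. \<bar>((jump a ^^ k) f :: int^'d \<Rightarrow> real) x / (l + 2 * real CARD('d)) ^ Suc k\<bar>)"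
proof (rule summable_comparison_test'[OF sums_summable[OF geom_sums[of F]], of 0])
  fix k
  have "0 < l + 2 * real CARD('d)" using l by (simp add: add_pos_nonneg)
  then show "norm \<bar>(jump a ^^ k) f x / (l + 2 * real CARD('d)) ^ Suc k\<bar> \<le> (2 * real CARD('d)) ^ k * F / (l + 2 * real CARD('d)) ^ Suc k"
    using jump_iter_bound[where f=f and F=F and k=k and x=x, OF a assms] by (simp add: divide_right_mono abs_mult)
qed

lemma resolvent_sums:
  assumes "\<And>x. \<bar>f x\<bar> \<le> F"
  shows "(\<lambda>k. (jump a ^^ k) f x / (l + 2 * real CARD('d)) ^ Suc k) sums resolvent l a f x"
  unfolding resolvent_def
  by (rule summable_sums[OF summable_rabs_cancel[OF resolvent_abs_summable[where f=f and F=F, OF assms]]])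

lemma resolvent_bound:
  assumes "\<And>x. \<bar>f x\<bar> \<le> F"
  shows "\<bar>resolvent l a f x\<bar> \<le> F / l"
proof -
  have p: "0 < l + 2 * real CARD('d)" using l by (simp add: add_pos_nonneg)
  have "\<bar>resolvent l a f x\<bar> \<le> (\<Sum>k. \<bar>(jump a ^^ k) f x / (l + 2 * real CARD('d)) ^ Suc k\<bar>)"
    unfolding resolvent_def by (rule summable_rabs[OF resolvent_abs_summable[where f=f and F=F, OF assms]])
  also have "\<dots> \<le> (\<Sum>k. (2 * real CARD('d)) ^ k * F / (l + 2 * real CARD('d)) ^ Suc k)"
    using jump_iter_bound[where f=f and F=F, OF a assms] p resolvent_abs_summable[where f=f and F=F, OF assms] sums_summable[OF geom_sums]
    by (intro suminf_le) (simp_all add: divide_right_mono abs_mult)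
  also have "\<dots> = F / l" by (rule sums_unique[OF geom_sums, symmetric])
  finally show ?thesis .
qed

lemma resolvent_l1:
  assumes "l1_le f F"
  shows "l1_le (resolvent l a f) (F / l)"
  unfolding l1_le_def
proof (intro allI impI)
  fix B :: "(int^'d) set" assume B: "finite B"
  have p: "0 < l + 2 * real CARD('d)" using l by (simp add: add_pos_nonneg)
  note bd = l1_le_abs[OF assms]
  have "(\<Sum>x\<in>B. \<bar>resolvent l a f x\<bar>) \<le> (\<Sum>x\<in>B. \<Sum>k. \<bar>(jump a ^^ k) f x / (l + 2 * real CARD('d)) ^ Suc k\<bar>)"
    unfolding resolvent_def by (intro sum_mono summable_rabs resolvent_abs_summable[where f=f and F=F, OF bd])
  also have "\<dots> = (\<Sum>k. \<Sum>x\<in>B. \<bar>(jump a ^^ k) f x / (l + 2 * real CARD('d)) ^ Suc k\<bar>)"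
    by (rule suminf_sum[symmetric]) (rule resolvent_abs_summable[where f=f and F=F, OF bd])
  also have "\<dots> \<le> (\<Sum>k. (2 * real CARD('d)) ^ k * F / (l + 2 * real CARD('d)) ^ Suc k)"
  proof (intro suminf_le summable_sum resolvent_abs_summable[where f=f and F=F, OF bd] sums_summable[OF geom_sums])
    fix k
    have "(\<Sum>x\<in>B. \<bar>(jump a ^^ k) f x\<bar>) \<le> (2 * real CARD('d)) ^ k * F"
      using jump_iter_l1[OF a assms] B by (simp add: l1_le_def)
    then have "(\<Sum>x\<in>B. \<bar>(jump a ^^ k) f x\<bar>) / (l + 2 * real CARD('d)) ^ Suc k \<le> (2 * real CARD('d)) ^ k * F / (l + 2 * real CARD('d)) ^ Suc k"
      using p by (intro divide_right_mono) auto
    then show "(\<Sum>x\<in>B. \<bar>(jump a ^^ k) f x / (l + 2 * real CARD('d)) ^ Suc k\<bar>) \<le> (2 * real CARD('d)) ^ k * F / (l + 2 * real CARD('d)) ^ Suc k"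
      using p by (simp add: sum_divide_distrib abs_mult)
  qed
  also have "\<dots> = F / l" by (rule sums_unique[OF geom_sums, symmetric])
  finally show "(\<Sum>x\<in>B. \<bar>resolvent l a f x\<bar>) \<le> F / l" .
qed

lemma resolvent_nonneg:
  assumes "\<And>x. \<bar>f x\<bar> \<le> F" "\<And>x. 0 \<le> f x"
  shows "0 \<le> resolvent l a f x"
proof -
  have p: "0 < l + 2 * real CARD('d)" using l by (simp add: add_pos_nonneg)
  have "0 \<le> (jump a ^^ k) f x" for k x
    by (induction k arbitrary: x) (auto simp: assms intro: jump_nonneg[OF a])
  then show ?thesis using p sums_le[OF _ sums_zero resolvent_sums[where f=f and F=F, OF assms(1)]] by simp
qed

lemma resolvent_eq:
  assumes "\<And>x. \<bar>f x\<bar> \<le> F"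
  shows "l * resolvent l a f x + div_star (\<lambda>b. a b * grad (resolvent l a f) b) x = f x"
proof -
  let ?c = "l + 2 * real CARD('d)"
  have p: "0 < ?c" using l by (simp add: add_pos_nonneg)
  have S: "(\<lambda>k. (jump a ^^ k) f y / ?c ^ Suc k) sums resolvent l a f y" for y
    by (rule resolvent_sums[where f=f and F=F, OF assms])
  have "(\<lambda>k. \<Sum>i\<in>UNIV. a (x - unitv i, i) * ((jump a ^^ k) f (x - unitv i) / ?c ^ Suc k) + (1 - a (x - unitv i, i)) * ((jump a ^^ k) f x / ?c ^ Suc k)
     + a (x, i) * ((jump a ^^ k) f (x + unitv i) / ?c ^ Suc k) + (1 - a (x, i)) * ((jump a ^^ k) f x / ?c ^ Suc k)) sums jump a (resolvent l a f) x"
    unfolding jump_def[of a "resolvent l a f"] by (intro sums_sum sums_add sums_mult S)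
  moreover have "(\<Sum>i\<in>UNIV. a (x - unitv i, i) * ((jump a ^^ k) f (x - unitv i) / ?c ^ Suc k) + (1 - a (x - unitv i, i)) * ((jump a ^^ k) f x / ?c ^ Suc k)
     + a (x, i) * ((jump a ^^ k) f (x + unitv i) / ?c ^ Suc k) + (1 - a (x, i)) * ((jump a ^^ k) f x / ?c ^ Suc k))
     = ?c * ((jump a ^^ Suc k) f x / ?c ^ Suc (Suc k))" for k
  proof -
    have "?c * ((jump a ^^ Suc k) f x / ?c ^ Suc (Suc k)) = jump a ((jump a ^^ k) f) x / ?c ^ Suc k"
      using p by simp
    then show ?thesis by (simp only: jump_def[of a "(jump a ^^ k) f"] sum_divide_distrib add_divide_distrib times_divide_eq_right)
  qed
  ultimately have J: "(\<lambda>k. ?c * ((jump a ^^ Suc k) f x / ?c ^ Suc (Suc k))) sums jump a (resolvent l a f) x" by simp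
  \<comment> \<open>Applying \<open>jump\<close> shifts the series by one index; what is missing is
    the term of index 0.\<close>
  have "(\<lambda>k. (jump a ^^ Suc k) f x / ?c ^ Suc (Suc k)) sums (resolvent l a f x - f x / ?c)"
    using S[of x] by (subst sums_Suc_iff) simp
  from sums_mult[OF this, of ?c] J have "jump a (resolvent l a f) x = ?c * (resolvent l a f x - f x / ?c)"
    using sums_unique2 by blast
  then have "jump a (resolvent l a f) x = ?c * resolvent l a f x - f x"
    using p by (simp add: right_diff_distrib)
  then show ?thesis by (simp add: div_star_grad algebra_simps)
qed

text \<open>A solution is a fixed point of \<open>jump\<close> divided by l + 2d, which contracts
  the supremum norm; boundedness starts the iteration.\<close>

lemma resolvent_unique:
  assumes "\<And>x. \<bar>w x\<bar> \<le> W" "\<And>x. l * w x + div_star (\<lambda>b. a b * grad w b) x = 0"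
  shows "w x = 0"
proof -
  let ?c = "l + 2 * real CARD('d)" and ?r = "2 * real CARD('d) / (l + 2 * real CARD('d))"
  have p: "0 < ?c" using l by (simp add: add_pos_nonneg)
  have w: "w x = jump a w x / ?c" for x
    using assms(2)[of x] p unfolding div_star_grad by (simp add: nonzero_eq_divide_eq algebra_simps)
  have "\<bar>w x\<bar> \<le> ?r ^ k * W" for k x
  proof (induction k arbitrary: x)
    case (Suc k)
    have "\<bar>w x\<bar> = \<bar>jump a w x\<bar> / ?c" using p by (subst w) simp
    also have "\<dots> \<le> (2 * real CARD('d) * (?r ^ k * W)) / ?c"
      using p by (intro divide_right_mono jump_bound[where u=w and F="?r ^ k * W", OF a Suc]) auto
    finally show ?case by (simp add: mult.assoc)
  qed (simp add: assms)
  moreover have "(\<lambda>k. ?r ^ k * W) \<longlonglongrightarrow> 0 * W"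
    using l p by (intro tendsto_mult_right LIMSEQ_power_zero) (auto simp: field_simps)
  ultimately have "\<bar>w x\<bar> \<le> 0 * W" by (intro LIMSEQ_le_const) auto
  then show ?thesis by simp
qed

end

section \<open>Green function and corrector\<close>

lemma div_star_add: "div_star (\<lambda>b. F b + H b) x = div_star F x + div_star H x"
  by (simp add: div_star_def sum.distrib[symmetric] algebra_simps)

lemma div_star_minus: "div_star (\<lambda>b. - F b) x = - div_star F x"
  by (simp add: div_star_def sum_negf[symmetric])

lemma div_star_diff: "div_star (\<lambda>b. F b - H b) x = div_star F x - div_star H x"
  using div_star_add[of F "\<lambda>b. - H b" x] by (simp add: div_star_minus)

lemma grad_diff: "grad (\<lambda>x. u x - v x) b = grad u b - grad v b"
  by (simp add: grad_def)

lemma l1_le_mult_bdd: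
  assumes "l1_le u W" "\<And>x. \<bar>c x\<bar> \<le> 1"
  shows "l1_le (\<lambda>x. c x * u x) W"
  unfolding l1_le_def
proof (intro allI impI)
  fix B :: "'a set" assume "finite B"
  then have "(\<Sum>x\<in>B. \<bar>u x\<bar>) \<le> W" using assms(1) by (simp add: l1_le_def)
  moreover have "(\<Sum>x\<in>B. \<bar>c x * u x\<bar>) \<le> (\<Sum>x\<in>B. \<bar>u x\<bar>)"
    using assms(2) by (intro sum_mono) (simp add: abs_mult mult_left_le_one_le)
  ultimately show "(\<Sum>x\<in>B. \<bar>c x * u x\<bar>) \<le> W" by linarith
qed

lemma l1_le_grad:
  assumes "l1_le u W" shows "l1_le (\<lambda>x. grad u (x, i)) (2 * W)"
  using l1_le_add[OF l1_le_shift[OF assms, of "unitv i"] l1_le_cmult[OF assms, of "-1"]]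
  by (simp add: grad_pair)

lemma grad_bound:
  assumes "\<And>x. \<bar>u x\<bar> \<le> W" shows "\<bar>grad u b\<bar> \<le> 2 * W"
  unfolding grad_def using assms[of "y_b b"] assms[of "x_b b"] by linarith

text \<open>A flux through one bond. Its divergence is a dipole, the source created by changing a
  single conductance.\<close>

definition point_source :: "'d::finite bond \<Rightarrow> real \<Rightarrow> 'd bond \<Rightarrow> real" where
  "point_source b c b' = (if b' = b then c else 0)"

lemma has_sum_single:
  fixes f :: "'a \<Rightarrow> real"
  assumes "\<And>x. x \<noteq> y \<Longrightarrow> f x = 0" shows "(f has_sum f y) UNIV"
proof -
  have "(f has_sum sum f {y}) {y}" by (rule has_sum_finite) simp
  then show ?thesis using assms has_sum_cong_neutral[of UNIV "{y}" f f] by simp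
qed

lemma point_source_pairing:
  "(\<Sum>i\<in>UNIV. \<Sum>\<^sub>\<infinity>x. point_source b c (x, i) * f (x, i)) = c * f b"
proof -
  obtain y j where b: "b = (y, j)" by (cases b)
  have "(\<Sum>\<^sub>\<infinity>x. point_source b c (x, i) * f (x, i)) = (if i = j then c * f b else 0)" for i
    using infsumI[OF has_sum_single[of y "\<lambda>x. point_source b c (x, i) * f (x, i)"]]
    by (auto simp: point_source_def b)
  then show ?thesis by simp
qed

lemma point_source_l1: "l1_le (\<lambda>x. point_source b c (x, i)) \<bar>c\<bar>"
  unfolding l1_le_def
proof (intro allI impI)
  fix B :: "(int^'a) set" assume "finite B"
  have "(\<Sum>x\<in>B. \<bar>point_source b c (x, i)\<bar>) \<le> (\<Sum>x\<in>insert (fst b) B. \<bar>point_source b c (x, i)\<bar>)"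
    using \<open>finite B\<close> by (intro sum_mono2) auto
  also have "\<dots> \<le> (\<Sum>x\<in>insert (fst b) B. if x = fst b then \<bar>c\<bar> else 0)"
    by (intro sum_mono) (auto simp: point_source_def)
  also have "\<dots> = \<bar>c\<bar>" using \<open>finite B\<close> by simp
  finally show "(\<Sum>x\<in>B. \<bar>point_source b c (x, i)\<bar>) \<le> \<bar>c\<bar>" .
qed

lemma div_star_l1:
  fixes F :: "'d::finite bond \<Rightarrow> real"
  assumes "\<And>i. l1_le (\<lambda>x. F (x, i)) W"
  shows "l1_le (div_star F) (2 * real CARD('d) * W)"
  unfolding l1_le_def
proof (intro allI impI)
  fix B :: "(int^'d) set" assume B: "finite B"
  have "(\<Sum>x\<in>B. \<bar>div_star F x\<bar>) \<le> (\<Sum>x\<in>B. \<Sum>i\<in>UNIV. \<bar>F (x - unitv i, i)\<bar> + \<bar>F (x, i)\<bar>)"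
    unfolding div_star_def by (intro sum_mono order_trans[OF sum_abs]) linarith
  also have "\<dots> = (\<Sum>i\<in>UNIV. (\<Sum>x\<in>B. \<bar>F (x - unitv i, i)\<bar>) + (\<Sum>x\<in>B. \<bar>F (x, i)\<bar>))"
    by (subst sum.swap) (simp add: sum.distrib)
  also have "\<dots> \<le> (\<Sum>i\<in>(UNIV::'d set). W + W)"
  proof (intro sum_mono add_mono)
    fix i
    show "(\<Sum>x\<in>B. \<bar>F (x - unitv i, i)\<bar>) \<le> W"
      using l1_le_shift[OF assms[of i], of "- unitv i"] B by (simp add: l1_le_def)
    show "(\<Sum>x\<in>B. \<bar>F (x, i)\<bar>) \<le> W" using assms B by (simp add: l1_le_def)
  qed
  finally show "(\<Sum>x\<in>B. \<bar>div_star F x\<bar>) \<le> 2 * real CARD('d) * W" by (simp add: algebra_simps)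
qed

definition green :: "real \<Rightarrow> 'd::finite field \<Rightarrow> int^'d \<Rightarrow> real" where
  "green l a = resolvent l a (\<lambda>x. if x = 0 then 1 else 0)"

definition corr_rhs :: "real^'d \<Rightarrow> 'd::finite field \<Rightarrow> int^'d \<Rightarrow> real" where
  "corr_rhs e a x = - div_star (\<lambda>b. a b * e_field e b) x"

definition corr :: "real \<Rightarrow> real^'d \<Rightarrow> 'd::finite field \<Rightarrow> int^'d \<Rightarrow> real" where
  "corr l e a = resolvent l a (corr_rhs e a)"

text \<open>The gradient of the corrected affine function; multiplied by the conductance it is the
  flux.\<close>

definition flux_grad :: "real \<Rightarrow> real^'d \<Rightarrow> 'd::finite field \<Rightarrow> 'd bond \<Rightarrow> real" where
  "flux_grad l e a b = grad (corr l e a) b + e_field e b"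

lemma e_field_bound: "\<bar>e_field e b\<bar> \<le> norm e"
  unfolding e_field_def by (rule component_le_norm_cart)

lemma corr_rhs_bound:
  fixes e :: "real^'d"
  assumes "unit_field a" "norm e \<le> 1"
  shows "\<bar>corr_rhs e (a :: 'd::finite field) x\<bar> \<le> 2 * real CARD('d)"
proof -
  have *: "\<bar>a b * e_field e b\<bar> \<le> 1" for b
    using unit_fieldD[OF assms(1), of b] e_field_bound[of e b] assms(2)
    by (simp add: abs_mult mult_le_one)
  have "\<bar>corr_rhs e a x\<bar> \<le> (\<Sum>i\<in>(UNIV::'d set). 2)"
    unfolding corr_rhs_def div_star_def abs_minus_cancel
  proof (intro order_trans[OF sum_abs] sum_mono)
    fix i
    show "\<bar>a (x - unitv i, i) * e_field e (x - unitv i, i) - a (x, i) * e_field e (x, i)\<bar> \<le> 2"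
      using *[of "(x - unitv i, i)"] *[of "(x, i)"] by linarith
  qed
  then show ?thesis by simp
qed

lemma unit_field_kill: "unit_field a \<Longrightarrow> unit_field (kill_bond a b)"
  by (auto simp: unit_field_def kill_bond_def)

context
  fixes l :: real and a :: "'d::finite field"
  assumes l: "0 < l" and a: "unit_field a"
begin

lemma delta_l1: "l1_le (\<lambda>x :: int^'d. if x = 0 then 1 else 0) 1"
  using point_source_l1[of "(0, undefined)" 1 undefined] by (simp add: point_source_def)

lemma green_nonneg: "0 \<le> green l a x"
  unfolding green_def by (rule resolvent_nonneg[OF l a, where F=1]) auto

lemma green_l1: "l1_le (green l a) (1 / l)"
  unfolding green_def by (rule resolvent_l1[OF l a delta_l1])

lemma green_bound: "\<bar>green l a x\<bar> \<le> 1 / l"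
  by (rule l1_le_abs[OF green_l1])

lemma green_eq: "l * green l a x + div_star (\<lambda>b. a b * grad (green l a) b) x = (if x = 0 then 1 else 0)"
  unfolding green_def by (rule resolvent_eq[OF l a, where F=1]) simp

lemma conductance_l1: "l1_le u W \<Longrightarrow> l1_le (\<lambda>x. a (x, i) * grad u (x, i)) (2 * W)"
  using unit_fieldD[OF a] by (intro l1_le_mult_bdd l1_le_grad) auto

lemma has_sum_energy:
  assumes u: "l1_le u W" and v: "\<And>x. \<bar>v x\<bar> \<le> V"
  shows "((\<lambda>x. v x * div_star (\<lambda>b. a b * grad u b) x) has_sum
     (\<Sum>i\<in>UNIV. \<Sum>\<^sub>\<infinity>x. a (x, i) * grad u (x, i) * grad v (x, i))) UNIV"
    and "(\<lambda>x. a (x, i) * grad u (x, i) * grad v (x, i)) summable_on UNIV"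
  using has_sum_div_star[where F="\<lambda>b. a b * grad u b" and v=v]
    l1_le_summable[OF conductance_l1[OF u], where c=v and C=V]
    l1_le_summable[OF conductance_l1[OF u], where c="\<lambda>x. v (x + unitv _)" and C=V] v by auto

text \<open>The weak form of the Green equation. Every bounded test function is admissible because
  the Green function is summable, so energy estimates reduce to choosing v.\<close>

lemma green_test:
  assumes v: "\<And>x. \<bar>v x\<bar> \<le> V"
  shows "(\<lambda>x. v x * green l a x) summable_on UNIV"
    "(\<lambda>x. a (x, i) * grad (green l a) (x, i) * grad v (x, i)) summable_on UNIV"
    "l * (\<Sum>\<^sub>\<infinity>x. v x * green l a x) + (\<Sum>i\<in>UNIV. \<Sum>\<^sub>\<infinity>x. a (x, i) * grad (green l a) (x, i) * grad v (x, i)) = v 0"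
proof -
  show s: "(\<lambda>x. v x * green l a x) summable_on UNIV"
    by (rule l1_le_summable[where c=v and C=V, OF green_l1 v])
  show "(\<lambda>x. a (x, i) * grad (green l a) (x, i) * grad v (x, i)) summable_on UNIV"
    by (rule has_sum_energy(2)[where v=v and V=V, OF green_l1 v])
  let ?S = "\<Sum>i\<in>UNIV. \<Sum>\<^sub>\<infinity>x. a (x, i) * grad (green l a) (x, i) * grad v (x, i)"
  have "((\<lambda>x. l * (v x * green l a x) + v x * div_star (\<lambda>b. a b * grad (green l a) b) x) has_sum
      (l * (\<Sum>\<^sub>\<infinity>x. v x * green l a x) + ?S)) UNIV"
    using s has_sum_energy(1)[where v=v and V=V, OF green_l1 v] by (intro has_sum_add has_sum_cmult_right) auto
  moreover have "l * (v x * green l a x) + v x * div_star (\<lambda>b. a b * grad (green l a) b) x = v x * (if x = 0 then 1 else 0)" for x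
    by (subst green_eq[of x, symmetric]) (simp add: algebra_simps)
  moreover have "((\<lambda>x. v x * (if x = 0 then 1 else 0)) has_sum v 0) UNIV"
    using has_sum_single[of 0 "\<lambda>x. v x * (if x = 0 then 1 else 0)"] by simp
  ultimately show "l * (\<Sum>\<^sub>\<infinity>x. v x * green l a x) + ?S = v 0"
    using has_sum_unique by auto
qed

text \<open>Testing the equation of w with the Green function, and that of the Green function with
  w, produces the same Dirichlet pairing. Only the value at the origin is wanted, so a single pole
  suffices.\<close>

lemma green_representation:
  assumes w: "\<And>x. \<bar>w x\<bar> \<le> W"
    and eq: "\<And>x. l * w x + div_star (\<lambda>b. a b * grad w b) x = - div_star (point_source b c) x"
  shows "w 0 = - c * grad (green l a) b"
proof -
  let ?G = "green l a"
  have aw: "\<bar>a b * grad w b\<bar> \<le> 2 * W" for b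
  proof -
    have "\<bar>a b * grad w b\<bar> \<le> \<bar>grad w b\<bar>"
      using unit_fieldD[OF a, of b] by (simp add: abs_mult mult_left_le_one_le)
    also have "\<dots> \<le> 2 * W" by (rule grad_bound[OF w])
    finally show ?thesis .
  qed
  let ?S = "\<Sum>i\<in>UNIV. \<Sum>\<^sub>\<infinity>x. a (x, i) * grad w (x, i) * grad ?G (x, i)"
  have s1: "(\<lambda>x. ?G x * (a (x, i) * grad w (x, i))) summable_on UNIV" for i
    using l1_le_summable[where c="\<lambda>x. a (x, i) * grad w (x, i)" and C="2 * W", OF green_l1 aw]
    by (simp only: mult.commute)
  have s2: "(\<lambda>x. ?G (x + unitv i) * (a (x, i) * grad w (x, i))) summable_on UNIV" for i
    using l1_le_summable[where c="\<lambda>x. a (x, i) * grad w (x, i)" and C="2 * W", OF l1_le_shift[OF green_l1] aw]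
    by (simp only: mult.commute)
  have 1: "((\<lambda>x. ?G x * div_star (\<lambda>b. a b * grad w b) x) has_sum ?S) UNIV"
    using has_sum_div_star(1)[where F="\<lambda>b. a b * grad w b" and v="?G", OF s1 s2] .
  have p1: "(\<lambda>x. ?G x * point_source b c (x, i)) summable_on UNIV" for i
    by (rule l1_le_summable[where C="1 / l", OF point_source_l1 green_bound])
  have p2: "(\<lambda>x. ?G (x + unitv i) * point_source b c (x, i)) summable_on UNIV" for i
    by (rule l1_le_summable[where C="1 / l", OF point_source_l1 green_bound])
  have 2: "((\<lambda>x. ?G x * div_star (point_source b c) x) has_sum (c * grad ?G b)) UNIV"
    using has_sum_div_star(1)[where F="point_source b c" and v="?G", OF p1 p2] unfolding point_source_pairing .
  have 3: "((\<lambda>x. l * (w x * ?G x)) has_sum (l * (\<Sum>\<^sub>\<infinity>x. w x * ?G x))) UNIV"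
    using green_test(1)[where v=w and V=W, OF w] by (intro has_sum_cmult_right) auto
  have "((\<lambda>x. l * (w x * ?G x) + ?G x * div_star (\<lambda>b. a b * grad w b) x) has_sum
      (l * (\<Sum>\<^sub>\<infinity>x. w x * ?G x) + ?S)) UNIV"
    by (rule has_sum_add[OF 3 1])
  moreover have "l * (w x * ?G x) + ?G x * div_star (\<lambda>b. a b * grad w b) x = - (?G x * div_star (point_source b c) x)" for x
    using arg_cong[OF eq[of x], of "\<lambda>t. ?G x * t"] by (simp add: algebra_simps)
  ultimately have "((\<lambda>x. - (?G x * div_star (point_source b c) x)) has_sum (l * (\<Sum>\<^sub>\<infinity>x. w x * ?G x) + ?S)) UNIV" by simp
  moreover have "((\<lambda>x. - (?G x * div_star (point_source b c) x)) has_sum - (c * grad ?G b)) UNIV"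
    using has_sum_uminusI[OF 2] .
  ultimately have "l * (\<Sum>\<^sub>\<infinity>x. w x * ?G x) + ?S = - (c * grad ?G b)" by (rule has_sum_unique)
  moreover have "?S = (\<Sum>i\<in>UNIV. \<Sum>\<^sub>\<infinity>x. a (x, i) * grad ?G (x, i) * grad w (x, i))"
    by (simp add: mult.assoc mult.commute[of "grad w _"])
  ultimately show ?thesis using green_test(3)[where v=w and V=W, OF w] by simp
qed

text \<open>Test with w itself: the mass term has a sign, and the dipole pairs to the gradient at
  its bond. The l1 bound makes w admissible.\<close>

lemma point_source_energy:
  assumes w: "l1_le w W"
    and eq: "\<And>x. l * w x + div_star (\<lambda>b. a b * grad w b) x = - div_star (point_source b c) x"
    and B: "finite B"
  shows "(\<Sum>b\<in>B. a b * (grad w b)\<^sup>2) \<le> \<bar>c\<bar> * \<bar>grad w b\<bar>"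
proof -
  note wb = l1_le_abs[OF w]
  let ?S = "\<Sum>i\<in>UNIV. \<Sum>\<^sub>\<infinity>x. a (x, i) * grad w (x, i) * grad w (x, i)"
  have 1: "((\<lambda>x. w x * div_star (\<lambda>b. a b * grad w b) x) has_sum ?S) UNIV"
    by (rule has_sum_energy(1)[where v=w and V=W, OF w wb])
  have p1: "(\<lambda>x. w x * point_source b c (x, i)) summable_on UNIV" for i
    by (rule l1_le_summable[where C=W, OF point_source_l1 wb])
  have p2: "(\<lambda>x. w (x + unitv i) * point_source b c (x, i)) summable_on UNIV" for i
    by (rule l1_le_summable[where C=W, OF point_source_l1 wb])
  have 2: "((\<lambda>x. w x * div_star (point_source b c) x) has_sum (c * grad w b)) UNIV"
    using has_sum_div_star(1)[where F="point_source b c" and v=w, OF p1 p2] unfolding point_source_pairing .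
  have 3: "((\<lambda>x. l * (w x * w x)) has_sum (l * (\<Sum>\<^sub>\<infinity>x. w x * w x))) UNIV"
    using l1_le_summable[where c=w and C=W, OF w wb] by (intro has_sum_cmult_right) auto
  have "l * (w x * w x) + w x * div_star (\<lambda>b. a b * grad w b) x = - (w x * div_star (point_source b c) x)" for x
    using arg_cong[OF eq[of x], of "\<lambda>t. w x * t"] by (simp add: algebra_simps)
  then have "((\<lambda>x. - (w x * div_star (point_source b c) x)) has_sum (l * (\<Sum>\<^sub>\<infinity>x. w x * w x) + ?S)) UNIV"
    using has_sum_add[OF 3 1] by simp
  then have "l * (\<Sum>\<^sub>\<infinity>x. w x * w x) + ?S = - (c * grad w b)"
    using has_sum_unique has_sum_uminusI[OF 2] by blast
  moreover have "0 \<le> l * (\<Sum>\<^sub>\<infinity>x. w x * w x)" using l infsum_nonneg[of UNIV "\<lambda>x. w x * w x"] by simp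
  ultimately have "?S \<le> \<bar>c\<bar> * \<bar>grad w b\<bar>" by (simp add: abs_mult[symmetric])
  moreover have "(\<Sum>b\<in>B. a b * grad w b * grad w b) \<le> ?S"
    using unit_fieldD[OF a] has_sum_energy(2)[where v=w and V=W, OF w wb] by (intro sum_bonds_le_infsum B) (auto simp: mult.assoc)
  ultimately show ?thesis by (simp add: power2_eq_square mult.assoc)
qed

lemma corr_bound:
  assumes "norm e \<le> 1"
  shows "\<bar>corr l e a x\<bar> \<le> 2 * real CARD('d) / l"
  unfolding corr_def by (rule resolvent_bound[OF l a, where f="corr_rhs e a", OF corr_rhs_bound[OF a assms]])

lemma corr_eq:
  assumes "norm e \<le> 1"
  shows "l * corr l e a x + div_star (\<lambda>b. a b * flux_grad l e a b) x = 0"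
proof -
  have "l * corr l e a x + div_star (\<lambda>b. a b * grad (corr l e a) b) x = corr_rhs e a x"
    unfolding corr_def by (rule resolvent_eq[OF l a, where f="corr_rhs e a", OF corr_rhs_bound[OF a assms]])
  moreover have "div_star (\<lambda>b. a b * flux_grad l e a b) x = div_star (\<lambda>b. a b * grad (corr l e a) b) x + div_star (\<lambda>b. a b * e_field e b) x"
    unfolding div_star_add[symmetric] by (simp add: flux_grad_def algebra_simps)
  ultimately show ?thesis by (simp add: corr_rhs_def)
qed

end

text \<open>The difference w of the correctors solves two dipole problems. With the intact field the
  strength contains the gradient \<open>X0\<close> after the removal, and w at the origin is read
  off from the Green function. With the field after removal the strength contains the gradient
  \<open>X\<close> before it, and the energy of w, evaluated on a detour around b, bounds
  \<open>X0\<close> by \<open>X\<close>.\<close>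

lemma corr_kill_estimate:
  fixes a :: "'d::finite field"
  assumes l: "0 < l" and a: "unit_field a" and e: "norm e \<le> 1"
    and h: "chem_dist (kill_bond a b) (x_b b) (y_b b) < ennreal h"
  shows "(corr l e a 0 - corr l e (kill_bond a b) 0)\<^sup>2
    \<le> a b * (grad (green l a) b)\<^sup>2 * ((1 + h ^ 3)\<^sup>2 * (flux_grad l e a b)\<^sup>2)"
proof -
  let ?k = "kill_bond a b"
  note k = unit_field_kill[OF a, of b]
  define w where "w x = corr l e a x - corr l e ?k x" for x
  define X where "X = flux_grad l e a b"
  define X0 where "X0 = flux_grad l e ?k b"
  have gw: "grad w b' = flux_grad l e a b' - flux_grad l e ?k b'" for b'
    unfolding w_def flux_grad_def grad_diff by simp
  have wb: "\<bar>w x\<bar> \<le> 2 * (2 * real CARD('d) / l)" for x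
    using corr_bound[OF l a e, of x] corr_bound[OF l k e, of x] unfolding w_def by linarith
  have E: "l * w x + (div_star (\<lambda>b'. a b' * flux_grad l e a b') x - div_star (\<lambda>b'. ?k b' * flux_grad l e ?k b') x) = 0" for x
    using corr_eq[OF l a e, of x] corr_eq[OF l k e, of x] by (simp add: w_def algebra_simps)
  have eq1: "l * w x + div_star (\<lambda>b'. a b' * grad w b') x = - div_star (point_source b (a b * X0)) x" for x
  proof -
    have "(\<lambda>b'. a b' * grad w b') = (\<lambda>b'. (a b' * flux_grad l e a b' - ?k b' * flux_grad l e ?k b') + - point_source b (a b * X0) b')"
      by (rule ext) (simp add: gw kill_bond_def point_source_def X0_def algebra_simps)
    then show ?thesis using E[of x] by (simp add: div_star_add div_star_diff div_star_minus)
  qed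
  have eq2: "l * w x + div_star (\<lambda>b'. ?k b' * grad w b') x = - div_star (point_source b (a b * X)) x" for x
  proof -
    have "(\<lambda>b'. ?k b' * grad w b') = (\<lambda>b'. (a b' * flux_grad l e a b' - ?k b' * flux_grad l e ?k b') + - point_source b (a b * X) b')"
      by (rule ext) (simp add: gw kill_bond_def point_source_def X_def algebra_simps)
    then show ?thesis using E[of x] by (simp add: div_star_add div_star_diff div_star_minus)
  qed
  have w0: "w 0 = - (a b * X0) * grad (green l a) b"
    by (rule green_representation[where w=w, OF l a wb eq1])
  \<comment> \<open>So far w is only known to be bounded; identifying it with the resolvent of a
    summable source gives the l1 bound that the energy estimate requires.\<close>
  define f where "f = (\<lambda>x. - div_star (point_source b (a b * X)) x)"
  have f1: "l1_le f (2 * real CARD('d) * \<bar>a b * X\<bar>)"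
    using l1_le_cmult[OF div_star_l1[where F="point_source b (a b * X)", OF point_source_l1], of "-1"] by (simp add: f_def)
  note fb = l1_le_abs[OF f1]
  have w_res: "w x = resolvent l ?k f x" for x
  proof -
    have "w x - resolvent l ?k f x = 0"
    proof (rule resolvent_unique[OF l k, where w="\<lambda>x. w x - resolvent l ?k f x"])
      fix x
      show "\<bar>w x - resolvent l ?k f x\<bar> \<le> 2 * (2 * real CARD('d) / l) + 2 * real CARD('d) * \<bar>a b * X\<bar> / l"
        using wb[of x] resolvent_bound[OF l k, where f=f, OF fb, of x] by linarith
      have "(\<lambda>b'. ?k b' * grad (\<lambda>x. w x - resolvent l ?k f x) b') = (\<lambda>b'. ?k b' * grad w b' - ?k b' * grad (resolvent l ?k f) b')"
        by (simp add: grad_diff algebra_simps)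
      then show "l * (w x - resolvent l ?k f x) + div_star (\<lambda>b'. ?k b' * grad (\<lambda>x. w x - resolvent l ?k f x) b') x = 0"
        using eq2[of x] resolvent_eq[OF l k, where f=f, OF fb, of x] by (simp add: div_star_diff f_def algebra_simps)
    qed
    then show ?thesis by simp
  qed
  have w1: "l1_le w (2 * real CARD('d) * \<bar>a b * X\<bar> / l)"
    using resolvent_l1[OF l k f1] w_res by (simp add: l1_le_def)
  have "x_b b \<noteq> y_b b" by (simp add: x_b_def y_b_def)
  moreover have "0 \<le> ?k b' \<and> ?k b' \<le> 1" for b' using unit_fieldD[OF k] by blast
  ultimately obtain b' where b': "1 \<le> h * ?k b'" "\<bar>w (y_b b) - w (x_b b)\<bar> \<le> h * \<bar>grad w b'\<bar>"
    using chem_dist_witness[where a="?k" and u=w, OF _ h] by metis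
  have hp: "0 < h" using h by (metis ennreal_neg linorder_not_less zero_le)
  \<comment> \<open>Two powers of h come from squaring the increment and one from the conductance of
    \<open>b'\<close>; one factor \<open>grad w b\<close> cancels.\<close>
  have gwb: "\<bar>grad w b\<bar> \<le> h ^ 3 * \<bar>X\<bar>"
  proof (cases "grad w b = 0")
    case False
    have "(grad w b)\<^sup>2 \<le> (h * \<bar>grad w b'\<bar>)\<^sup>2"
      using b'(2) hp by (subst abs_le_square_iff[symmetric]) (simp add: grad_def abs_mult)
    also have "\<dots> = h\<^sup>2 * (1 * (grad w b')\<^sup>2)" by (simp add: power_mult_distrib)
    also have "\<dots> \<le> h\<^sup>2 * ((h * ?k b') * (grad w b')\<^sup>2)"
      using b'(1) by (intro mult_left_mono mult_right_mono) auto
    also have "\<dots> = h ^ 3 * (?k b' * (grad w b')\<^sup>2)" by (simp add: power2_eq_square power3_eq_cube)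
    also have "\<dots> \<le> h ^ 3 * (\<bar>a b * X\<bar> * \<bar>grad w b\<bar>)"
      using point_source_energy[where w=w and B="{b'}", OF l k w1 eq2] hp by (intro mult_left_mono) auto
    also have "\<dots> \<le> h ^ 3 * (\<bar>X\<bar> * \<bar>grad w b\<bar>)"
      using unit_fieldD[OF a, of b] hp by (intro mult_left_mono mult_right_mono) (auto simp: abs_mult mult_left_le_one_le)
    finally have "\<bar>grad w b\<bar> * \<bar>grad w b\<bar> \<le> (h ^ 3 * \<bar>X\<bar>) * \<bar>grad w b\<bar>" by (simp only: power2_eq_square abs_mult_self_eq mult.assoc)
    then show ?thesis using False by (simp only: mult_le_cancel_right zero_less_abs_iff simp_thms)
  qed (use hp in simp)
  then have "\<bar>X0\<bar> \<le> (1 + h ^ 3) * \<bar>X\<bar>"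
    using gw[of b] unfolding X_def[symmetric] X0_def[symmetric] by (simp add: algebra_simps)
  then have "\<bar>X0\<bar> \<le> \<bar>(1 + h ^ 3) * X\<bar>" using hp by (simp add: abs_mult)
  then have X0: "X0\<^sup>2 \<le> (1 + h ^ 3)\<^sup>2 * X\<^sup>2"
    unfolding abs_le_square_iff by (simp add: power_mult_distrib)
  \<comment> \<open>Of the two factors \<open>a b\<close>, one stays with the Green gradient to form
    its energy density and the other is bounded by 1.\<close>
  have "(w 0)\<^sup>2 = a b * (a b * (grad (green l a) b)\<^sup>2) * X0\<^sup>2"
    unfolding w0 by (simp add: power2_eq_square algebra_simps)
  also have "\<dots> \<le> (a b * (grad (green l a) b)\<^sup>2) * ((1 + h ^ 3)\<^sup>2 * X\<^sup>2)"
    using unit_fieldD[OF a, of b] X0 by (intro mult_mono) (auto intro!: mult_left_le_one_le)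
  finally show ?thesis by (simp add: w_def X_def)
qed

section \<open>Local norms\<close>

definition sq_sum :: "nat \<Rightarrow> (int^'d::finite \<Rightarrow> real) \<Rightarrow> real" where
  "sq_sum R v = (\<Sum>x\<in>bll R. (v x)\<^sup>2)"

definition grad_sum :: "nat \<Rightarrow> (int^'d::finite \<Rightarrow> real) \<Rightarrow> real" where
  "grad_sum R v = (\<Sum>x\<in>bll R. \<Sum>i\<in>UNIV. (grad v (x, i))\<^sup>2)"

definition energy_le :: "'d::finite field \<Rightarrow> (int^'d \<Rightarrow> real) \<Rightarrow> real \<Rightarrow> bool" where
  "energy_le a v E \<longleftrightarrow> (\<forall>B. finite B \<longrightarrow> (\<Sum>b\<in>B. a b * (grad v b)\<^sup>2) \<le> E)"

lemma sq_sum_nonneg: "0 \<le> sq_sum R v" and grad_sum_nonneg: "0 \<le> grad_sum R v"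
  unfolding sq_sum_def grad_sum_def by (auto intro!: sum_nonneg)

lemma sq_sum_mono: "R \<le> S \<Longrightarrow> sq_sum R v \<le> sq_sum S v"
  unfolding sq_sum_def by (intro sum_mono2 bll_mono) auto

lemma sum_image_le:
  fixes g :: "'b \<Rightarrow> real"
  assumes "finite A" "\<And>y. 0 \<le> g y" "\<And>y. real (card {x \<in> A. f x = y}) \<le> N"
  shows "(\<Sum>x\<in>A. g (f x)) \<le> N * (\<Sum>y\<in>f ` A. g y)"
proof -
  have "(\<Sum>x\<in>A. g (f x)) = (\<Sum>y\<in>f ` A. \<Sum>x | x \<in> A \<and> f x = y. g (f x))"
    by (rule sum.image_gen[OF assms(1)])
  also have "\<dots> = (\<Sum>y\<in>f ` A. real (card {x \<in> A. f x = y}) * g y)"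
    by (intro sum.cong refl) simp
  also have "\<dots> \<le> (\<Sum>y\<in>f ` A. N * g y)"
    using assms by (intro sum_mono mult_right_mono) auto
  finally show ?thesis by (simp add: sum_distrib_left)
qed

text \<open>Each bond of the ball is charged to a witness bond of conductance at least 1 / h. The
  witness lies within distance h, so in each direction it serves at most (2h + 1)^d starting
  points.\<close>

lemma grad_sum_le_energy:
  fixes a :: "'d::finite field"
  assumes a: "unit_field a" and h: "1 \<le> h"
    and dist: "\<And>x i. x \<in> bll R \<Longrightarrow> chem_dist a x (x + unitv i) < ennreal h"
    and E: "energy_le a v E"
  shows "grad_sum R v \<le> real CARD('d) * (3 * h) ^ CARD('d) * h ^ 3 * E"
proof -
  define g where "g b = a b * (grad v b)\<^sup>2" for b
  have g0: "0 \<le> g b" for b using unit_fieldD[OF a] by (simp add: g_def)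
  have "\<exists>b. real (nrm (x_b b - x)) \<le> h \<and> (grad v (x, i))\<^sup>2 \<le> h ^ 3 * g b" if x: "x \<in> bll R" for x i
  proof -
    have u: "0 \<le> a b \<and> a b \<le> 1" for b using unit_fieldD[OF a] by blast
    have "x \<noteq> x + unitv i" by simp
    with chem_dist_witness[where a=a and u=v, OF u dist[OF x, of i]]
    obtain b where b: "real (nrm (x_b b - x)) \<le> h" "1 \<le> h * a b" "\<bar>v (x + unitv i) - v x\<bar> \<le> h * \<bar>grad v b\<bar>"
      by metis
    have "(grad v (x, i))\<^sup>2 \<le> (h * \<bar>grad v b\<bar>)\<^sup>2"
      using b(3) h by (subst abs_le_square_iff[symmetric]) (simp add: grad_pair abs_mult)
    also have "\<dots> = h\<^sup>2 * (1 * (grad v b)\<^sup>2)" by (simp add: power_mult_distrib)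
    also have "\<dots> \<le> h\<^sup>2 * ((h * a b) * (grad v b)\<^sup>2)"
      using b(2) by (intro mult_left_mono mult_right_mono) auto
    also have "\<dots> = h ^ 3 * g b" by (simp add: g_def power2_eq_square power3_eq_cube)
    finally show ?thesis using b(1) by blast
  qed
  then obtain f where f: "\<And>x i. x \<in> bll R \<Longrightarrow> real (nrm (x_b (f x i) - x)) \<le> h"
    "\<And>x i. x \<in> bll R \<Longrightarrow> (grad v (x, i))\<^sup>2 \<le> h ^ 3 * g (f x i)" by metis
  have card_fib: "real (card {x \<in> bll R. f x i = b}) \<le> (3 * h) ^ CARD('d)" for i b
  proof -
    have "{x \<in> bll R. f x i = b} \<subseteq> (\<lambda>y. x_b b - y) ` bll (nat \<lfloor>h\<rfloor>)"
    proof
      fix x assume x: "x \<in> {x \<in> bll R. f x i = b}"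
      then have "real (nrm (x_b b - x)) \<le> h" using f(1)[of x i] by auto
      then have "x_b b - x \<in> bll (nat \<lfloor>h\<rfloor>)" by (simp add: bll_def le_nat_floor)
      then show "x \<in> (\<lambda>y. x_b b - y) ` bll (nat \<lfloor>h\<rfloor>)" by (intro image_eqI[of _ _ "x_b b - x"]) auto
    qed
    then have "card {x \<in> bll R. f x i = b} \<le> card (bll (nat \<lfloor>h\<rfloor>) :: (int^'d) set)"
      by (intro order_trans[OF card_mono card_image_le]) auto
    also have "\<dots> \<le> (2 * nat \<lfloor>h\<rfloor> + 1) ^ CARD('d)" by (rule card_bll)
    finally have "real (card {x \<in> bll R. f x i = b}) \<le> real ((2 * nat \<lfloor>h\<rfloor> + 1) ^ CARD('d))"
      by (rule of_nat_mono)
    also have "\<dots> = (2 * real (nat \<lfloor>h\<rfloor>) + 1) ^ CARD('d)" by (simp add: add.commute)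
    also have "\<dots> \<le> (3 * h) ^ CARD('d)" using h by (intro power_mono) linarith+
    finally show ?thesis .
  qed
  have "grad_sum R v \<le> (\<Sum>x\<in>bll R. \<Sum>i\<in>UNIV. h ^ 3 * g (f x i))"
    unfolding grad_sum_def by (intro sum_mono f(2))
  also have "\<dots> = (\<Sum>i\<in>UNIV. h ^ 3 * (\<Sum>x\<in>bll R. g (f x i)))"
    by (subst sum.swap) (simp add: sum_distrib_left)
  also have "\<dots> \<le> (\<Sum>i\<in>(UNIV::'d set). h ^ 3 * ((3 * h) ^ CARD('d) * E))"
  proof (intro sum_mono mult_left_mono)
    fix i
    have "(\<Sum>x\<in>bll R. g (f x i)) \<le> (3 * h) ^ CARD('d) * (\<Sum>b\<in>(\<lambda>x. f x i) ` bll R. g b)"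
      by (rule sum_image_le[where f="\<lambda>x. f x i"]) (use g0 card_fib in auto)
    also have "\<dots> \<le> (3 * h) ^ CARD('d) * E"
      using E h unfolding energy_le_def g_def by (intro mult_left_mono) auto
    finally show "(\<Sum>x\<in>bll R. g (f x i)) \<le> (3 * h) ^ CARD('d) * E" .
  qed (use h in auto)
  finally show ?thesis by (simp add: algebra_simps)
qed

lemma nrm_decompose:
  assumes "nrm (z :: int^'d::finite) = Suc n"
  obtains z' i where "nrm z' = n" "z = z' + unitv i \<or> z' = z + unitv i"
proof -
  have "z \<noteq> 0" using assms by (metis nrm_0 old.nat.distinct(1))
  then obtain i where i: "z $ i \<noteq> 0" by (auto simp: vec_eq_iff)
  define z' where "z' = (if 0 < z $ i then z - unitv i else z + unitv i)"
  have "nrm z = nat \<bar>z $ i\<bar> + (\<Sum>j\<in>UNIV - {i}. nat \<bar>z $ j\<bar>)"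
    unfolding nrm_def by (subst sum.remove[of _ i]) auto
  moreover have "nrm z' = nat \<bar>z' $ i\<bar> + (\<Sum>j\<in>UNIV - {i}. nat \<bar>z' $ j\<bar>)"
    unfolding nrm_def by (subst sum.remove[of _ i]) auto
  moreover have "(\<Sum>j\<in>UNIV - {i}. nat \<bar>z' $ j\<bar>) = (\<Sum>j\<in>UNIV - {i}. nat \<bar>z $ j\<bar>)"
    by (intro sum.cong) (auto simp: z'_def unitv_def axis_def)
  moreover have "nat \<bar>z $ i\<bar> = Suc (nat \<bar>z' $ i\<bar>)"
    using i by (auto simp: z'_def unitv_def)
  ultimately have "nrm z' = n" using assms by simp
  then show thesis using that[of z' i] by (auto simp: z'_def split: if_splits)
qed

lemma grad_sum_ge_translate:
  assumes "R + nrm z \<le> S"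
  shows "(\<Sum>x\<in>bll R. (grad v (x + z, i))\<^sup>2) \<le> grad_sum S v"
proof -
  have "(\<Sum>x\<in>bll R. (grad v (x + z, i))\<^sup>2) \<le> (\<Sum>x\<in>bll (R + nrm z). (grad v (x, i))\<^sup>2)"
    by (rule translate_sum_le) auto
  also have "\<dots> \<le> (\<Sum>x\<in>bll S. (grad v (x, i))\<^sup>2)"
    using assms by (intro sum_mono2 bll_mono) auto
  also have "\<dots> \<le> grad_sum S v"
    unfolding grad_sum_def by (intro sum_mono member_le_sum) auto
  finally show ?thesis .
qed

text \<open>The l2 triangle inequality along \<open>nrm z\<close> unit steps, carried out on
  squares; the larger radius leaves room for all intermediate translates.\<close>

lemma translate_diff_le:
  fixes v :: "int^'d::finite \<Rightarrow> real"
  assumes "R + nrm z \<le> S"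
  shows "(\<Sum>x\<in>bll R. (v (x + z) - v x)\<^sup>2) \<le> (real (nrm z))\<^sup>2 * grad_sum S v"
  using assms
proof (induction "nrm z" arbitrary: z)
  case 0
  then have "z = 0" using nrm_eq_0 by metis
  then show ?case by simp
next
  case (Suc n)
  then obtain z' i where z': "nrm z' = n" "z = z' + unitv i \<or> z' = z + unitv i"
    using nrm_decompose by metis
  have step: "(\<Sum>x\<in>bll R. (v (x + z) - v (x + z'))\<^sup>2) \<le> grad_sum S v"
    using z'(2)
  proof
    assume "z = z' + unitv i"
    then show ?thesis using grad_sum_ge_translate[of R z' S v i] Suc z'(1) by (simp add: grad_pair add.assoc)
  next
    assume "z' = z + unitv i"
    then show ?thesis using grad_sum_ge_translate[of R z S v i] Suc by (simp add: grad_pair add.assoc power2_commute)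
  qed
  have IH: "(\<Sum>x\<in>bll R. (v (x + z') - v x)\<^sup>2) \<le> (real n)\<^sup>2 * grad_sum S v"
    using Suc(1)[of z'] z'(1) Suc(2,3) by simp
  show ?case
  proof (cases "n = 0")
    case True
    then have "z' = 0" using z'(1) by simp
    then show ?thesis using step True Suc(2)[symmetric] by simp
  next
    case False
    define c where "c = real n"
    have c: "c > 0" using False by (simp add: c_def)
    \<comment> \<open>With c = n the weights reproduce the square: (1 + n) + (1 + 1 / n) * n^2 = (n
      + 1)^2.\<close>
    have yng: "(p + q)\<^sup>2 \<le> (1 + c) * p\<^sup>2 + (1 + 1 / c) * q\<^sup>2" for p q
    proof -
      have "0 \<le> (c * p - q)\<^sup>2 / c" using c by simp
      also have "\<dots> = (1 + c) * p\<^sup>2 + (1 + 1 / c) * q\<^sup>2 - (p + q)\<^sup>2"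
        using c by (simp add: field_simps power2_eq_square)
      finally show ?thesis by simp
    qed
    have "(\<Sum>x\<in>bll R. (v (x + z) - v x)\<^sup>2) \<le> (\<Sum>x\<in>bll R. (1 + c) * (v (x + z) - v (x + z'))\<^sup>2 + (1 + 1 / c) * (v (x + z') - v x)\<^sup>2)"
      by (intro sum_mono order_trans[OF _ yng]) simp
    also have "\<dots> = (1 + c) * (\<Sum>x\<in>bll R. (v (x + z) - v (x + z'))\<^sup>2) + (1 + 1 / c) * (\<Sum>x\<in>bll R. (v (x + z') - v x)\<^sup>2)"
      by (simp add: sum.distrib sum_distrib_left)
    also have "\<dots> \<le> (1 + c) * grad_sum S v + (1 + 1 / c) * (c\<^sup>2 * grad_sum S v)"
      using step IH c by (intro add_mono mult_left_mono) (auto simp: c_def)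
    also have "\<dots> = (1 + c)\<^sup>2 * grad_sum S v"
      using c by (simp add: field_simps power2_eq_square)
    also have "(1 + c) = real (nrm z)" using Suc(2) by (simp add: c_def)
    finally show ?thesis .
  qed
qed

section \<open>Averages over cubes\<close>

definition avg :: "nat \<Rightarrow> (int^'d::finite \<Rightarrow> real) \<Rightarrow> int^'d \<Rightarrow> real" where
  "avg s v x = (\<Sum>z\<in>cube 0 (int s). v (x + z)) / real s ^ CARD('d)"

lemma real_card_cube: "real (card (cube 0 (int s) :: (int^'d::finite) set)) = real s ^ CARD('d)"
  by (simp add: card_cube)

text \<open>A Poincare inequality: the deviation from the average is a mean of translation
  differences, each over at most d * s unit steps.\<close>

lemma sq_sum_le_avg:
  fixes v :: "int^'d::finite \<Rightarrow> real"
  assumes s: "0 < s" and S: "R + CARD('d) * s \<le> S"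
  shows "sq_sum R v \<le> 2 * (real CARD('d) * real s)\<^sup>2 * grad_sum S v + 2 * (\<Sum>x\<in>bll R. (avg s v x)\<^sup>2)"
proof -
  let ?C = "cube 0 (int s) :: (int^'d) set" and ?m = "real s ^ CARD('d)"
  have m: "0 < ?m" using s by simp
  have pt: "(v x)\<^sup>2 \<le> 2 * ((\<Sum>z\<in>?C. (v (x + z) - v x)\<^sup>2) / ?m) + 2 * (avg s v x)\<^sup>2" for x
  proof -
    define p where "p = (\<Sum>z\<in>?C. v (x + z) - v x) / ?m"
    have vx: "v x = avg s v x - p"
      using m by (simp add: p_def avg_def sum_subtractf real_card_cube diff_divide_distrib)
    have "p\<^sup>2 = (\<Sum>z\<in>?C. v (x + z) - v x)\<^sup>2 / ?m\<^sup>2" by (simp add: p_def power_divide)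
    also have "\<dots> \<le> (?m * (\<Sum>z\<in>?C. (v (x + z) - v x)\<^sup>2)) / ?m\<^sup>2"
      using sum_squared_le_sum_of_squares[of "\<lambda>z. v (x + z) - v x" ?C] m
      by (intro divide_right_mono) (auto simp: real_card_cube mult.commute)
    also have "\<dots> = (\<Sum>z\<in>?C. (v (x + z) - v x)\<^sup>2) / ?m" using m by (simp add: power2_eq_square)
    finally have p2: "p\<^sup>2 \<le> (\<Sum>z\<in>?C. (v (x + z) - v x)\<^sup>2) / ?m" .
    have "(v x)\<^sup>2 \<le> 2 * p\<^sup>2 + 2 * (avg s v x)\<^sup>2"
      unfolding vx using zero_le_power2[of "avg s v x + p"] by (simp add: power2_eq_square algebra_simps)
    then show ?thesis using p2 by linarith
  qed
  have "sq_sum R v \<le> (\<Sum>x\<in>bll R. 2 * ((\<Sum>z\<in>?C. (v (x + z) - v x)\<^sup>2) / ?m) + 2 * (avg s v x)\<^sup>2)"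
    unfolding sq_sum_def by (intro sum_mono pt)
  also have "\<dots> = 2 * ((\<Sum>z\<in>?C. \<Sum>x\<in>bll R. (v (x + z) - v x)\<^sup>2) / ?m) + 2 * (\<Sum>x\<in>bll R. (avg s v x)\<^sup>2)"
    by (subst sum.swap) (simp add: sum.distrib sum_distrib_left sum_divide_distrib)
  also have "(\<Sum>z\<in>?C. \<Sum>x\<in>bll R. (v (x + z) - v x)\<^sup>2) \<le> (\<Sum>z\<in>?C. (real CARD('d) * real s)\<^sup>2 * grad_sum S v)"
  proof (rule sum_mono)
    fix z :: "int^'d" assume "z \<in> ?C"
    then have n: "nrm z \<le> CARD('d) * s" by (rule nrm_cube)
    have "(\<Sum>x\<in>bll R. (v (x + z) - v x)\<^sup>2) \<le> (real (nrm z))\<^sup>2 * grad_sum S v"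
      using n S by (intro translate_diff_le) simp
    also have "\<dots> \<le> (real CARD('d) * real s)\<^sup>2 * grad_sum S v"
      using n by (intro mult_right_mono power_mono grad_sum_nonneg) (auto simp flip: of_nat_mult)
    finally show "(\<Sum>x\<in>bll R. (v (x + z) - v x)\<^sup>2) \<le> (real CARD('d) * real s)\<^sup>2 * grad_sum S v" .
  qed
  also have "\<dots> = ?m * ((real CARD('d) * real s)\<^sup>2 * grad_sum S v)" by (simp add: card_cube)
  finally show ?thesis using m by (simp add: divide_right_mono mult.assoc)
qed

text \<open>For cubes much larger than the ball: a squared average is at most the mean of the
  squares, and the ball has few points compared with the cube.\<close>

lemma avg_le_ball:
  fixes v :: "int^'d::finite \<Rightarrow> real"
  assumes s: "0 < s" and S: "R + CARD('d) * s \<le> S"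
  shows "(\<Sum>x\<in>bll R. (avg s v x)\<^sup>2) \<le> ((2 * real R + 1) / real s) ^ CARD('d) * sq_sum S v"
proof -
  let ?C = "cube 0 (int s) :: (int^'d) set" and ?m = "real s ^ CARD('d)"
  have m: "0 < ?m" using s by simp
  have pt: "(avg s v x)\<^sup>2 \<le> sq_sum S v / ?m" if x: "x \<in> bll R" for x
  proof -
    have "(avg s v x)\<^sup>2 = (\<Sum>z\<in>?C. v (x + z))\<^sup>2 / ?m\<^sup>2" by (simp add: avg_def power_divide)
    also have "\<dots> \<le> (?m * (\<Sum>z\<in>?C. (v (x + z))\<^sup>2)) / ?m\<^sup>2"
      using sum_squared_le_sum_of_squares[of "\<lambda>z. v (x + z)" ?C]
      by (intro divide_right_mono) (auto simp: real_card_cube mult.commute)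
    also have "\<dots> = (\<Sum>z\<in>?C. (v (x + z))\<^sup>2) / ?m" using m by (simp add: power2_eq_square)
    also have "(\<Sum>z\<in>?C. (v (x + z))\<^sup>2) = (\<Sum>y\<in>(\<lambda>z. x + z) ` ?C. (v y)\<^sup>2)"
      by (subst sum.reindex) (auto intro: inj_onI)
    also have "\<dots> \<le> sq_sum S v" unfolding sq_sum_def
    proof (rule sum_mono2)
      show "(\<lambda>z. x + z) ` ?C \<subseteq> bll S"
      proof safe
        fix z assume "z \<in> ?C"
        then show "x + z \<in> bll S" using nrm_cube[of z s] nrm_triangle[of x z] x S by (simp add: bll_def)
      qed
    qed auto
    finally show ?thesis using m by (simp add: divide_right_mono)
  qed
  have "(\<Sum>x\<in>bll R. (avg s v x)\<^sup>2) \<le> real (card (bll R :: (int^'d) set)) * (sq_sum S v / ?m)"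
    using sum_mono[OF pt] by simp
  also have "\<dots> \<le> (2 * real R + 1) ^ CARD('d) * (sq_sum S v / ?m)"
    using of_nat_mono[OF card_bll[of R, where 'd='d], where 'a=real] m sq_sum_nonneg[of S v] 
    by (intro mult_right_mono) (auto simp: add.commute)
  finally show ?thesis by (simp add: power_divide)
qed

text \<open>For small supports: Cauchy-Schwarz on the support alone, since a cube meets at most N
  points where v is nonzero. The cube may then be far smaller than the ball.\<close>

lemma avg_le_support:
  fixes v :: "int^'d::finite \<Rightarrow> real"
  assumes s: "0 < s" and S: "R + CARD('d) * s \<le> S" and N: "real (card {y \<in> bll S. v y \<noteq> 0}) \<le> N"
  shows "(\<Sum>x\<in>bll R. (avg s v x)\<^sup>2) \<le> N / real s ^ CARD('d) * sq_sum S v"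
proof -
  let ?C = "cube 0 (int s) :: (int^'d) set" and ?m = "real s ^ CARD('d)"
  have m: "0 < ?m" using s by simp
  have sub: "x + z \<in> bll S" if "x \<in> bll R" "z \<in> ?C" for x z
    using that nrm_cube[of z s] nrm_triangle[of x z] S by (simp add: bll_def)
  have pt: "(avg s v x)\<^sup>2 \<le> N * (\<Sum>z\<in>?C. (v (x + z))\<^sup>2) / ?m\<^sup>2" if x: "x \<in> bll R" for x
  proof -
    let ?D = "{z \<in> ?C. v (x + z) \<noteq> 0}"
    have "card ?D = card ((\<lambda>z. x + z) ` ?D)" by (subst card_image) (auto intro: inj_onI)
    also have "\<dots> \<le> card {y \<in> bll S. v y \<noteq> 0}" using sub[OF x] by (intro card_mono) auto
    finally have cD: "real (card ?D) \<le> N" using N by linarith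
    have "(\<Sum>z\<in>?C. v (x + z))\<^sup>2 = (\<Sum>z\<in>?D. v (x + z))\<^sup>2"
      by (intro arg_cong[where f="\<lambda>t. t\<^sup>2"] sum.mono_neutral_right) auto
    also have "\<dots> \<le> (\<Sum>z\<in>?D. (v (x + z))\<^sup>2) * real (card ?D)"
      by (rule sum_squared_le_sum_of_squares)
    also have "\<dots> \<le> (\<Sum>z\<in>?C. (v (x + z))\<^sup>2) * N"
      using cD by (intro mult_mono sum_mono2) (auto intro: sum_nonneg)
    finally show ?thesis unfolding avg_def power_divide by (intro divide_right_mono) (auto simp: mult.commute)
  qed
  have N0: "0 \<le> N" using N of_nat_0_le_iff order_trans by blast
  have "(\<Sum>x\<in>bll R. (avg s v x)\<^sup>2) \<le> (\<Sum>x\<in>bll R. N * (\<Sum>z\<in>?C. (v (x + z))\<^sup>2) / ?m\<^sup>2)"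
    by (intro sum_mono pt)
  also have "\<dots> = N * (\<Sum>z\<in>?C. \<Sum>x\<in>bll R. (v (x + z))\<^sup>2) / ?m\<^sup>2"
    by (subst sum.swap) (simp add: sum_distrib_left sum_divide_distrib)
  also have "\<dots> \<le> N * (\<Sum>z\<in>?C. sq_sum S v) / ?m\<^sup>2"
  proof (intro divide_right_mono mult_left_mono sum_mono N0)
    fix z :: "int^'d" assume "z \<in> ?C"
    then have n: "nrm z \<le> CARD('d) * s" by (rule nrm_cube)
    have "(\<Sum>x\<in>bll R. (v (x + z))\<^sup>2) \<le> sq_sum (R + nrm z) v"
      unfolding sq_sum_def by (rule translate_sum_le) auto
    also have "\<dots> \<le> sq_sum S v" using n S by (intro sq_sum_mono) simp
    finally show "(\<Sum>x\<in>bll R. (v (x + z))\<^sup>2) \<le> sq_sum S v" .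
  qed auto
  also have "\<dots> = N / ?m * sq_sum S v" using m by (simp add: card_cube power2_eq_square)
  finally show ?thesis .
qed

section \<open>A Hardy inequality\<close>

text \<open>The ratio between the averaging cube and the ball. Passing to the larger ball gains a factor
  \<open>2 (3 / s)^d\<close> and multiplies the radius by \<open>1 + d s\<close>; since \<open>d \<ge> 3 > 65 / 32\<close>, iteration converges for
  large \<open>s\<close>.\<close>
definition hardy_scale :: "nat \<Rightarrow> nat" where
  "hardy_scale d = (864 * d ^ 3)\<^sup>2"

definition hardy_const :: "nat \<Rightarrow> real" where
  "hardy_const d = 4 * (real d * real (hardy_scale d))\<^sup>2 * (1 + real d * real (hardy_scale d))"

text \<open>Put s = m^2 with m = 864 d^3. Since d is at least 3, the cube factor is at most 54 /
  m^6; relaxing the exponent 65/32 to 5/2 bounds the radius factor by 8 d^3 m^5. The product is 432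
  d^3 / m = 1 / 2.\<close>

lemma hardy_ratio:
  assumes "3 \<le> d"
  defines "s \<equiv> real (hardy_scale d)"
  shows "2 * (3 / s) ^ d * (1 + real d * s) powr (65 / 32) \<le> 1 / 2" "2 * (3 / s) ^ d \<le> 1 / 2"
proof -
  define m where "m = 864 * real d ^ 3"
  have sm: "s = m\<^sup>2" by (simp add: s_def hardy_scale_def m_def)
  have d3: "1 \<le> real d ^ 3" using assms by (intro one_le_power) simp
  then have m1: "864 \<le> m" unfolding m_def by simp
  have s3: "3 \<le> s" using m1 mult_mono[of 864 m 864 m] by (simp add: sm power2_eq_square)
  have k: "2 * (3 / s) ^ d \<le> 54 / m ^ 6"
  proof -
    have "(3 / s) ^ d \<le> (3 / s) ^ 3" using s3 assms by (intro power_decreasing) auto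
    also have "\<dots> = 27 / m ^ 6" by (simp add: sm power_divide flip: power_mult)
    finally show ?thesis by simp
  qed
  have ds: "1 \<le> real d * s" using s3 assms mult_mono[of 1 "real d" 1 s] by simp
  have "(1 + real d * s) powr (65 / 32) \<le> (2 * real d * m\<^sup>2) powr (65 / 32)"
    using ds by (intro powr_mono2) (auto simp: sm)
  also have "\<dots> \<le> (2 * real d * m\<^sup>2) powr (5 / 2)"
    using ds by (intro powr_mono) (auto simp: sm)
  also have "\<dots> = (2 * real d) powr (5 / 2) * m ^ 5"
  proof -
    have "(m\<^sup>2) powr (5 / 2) = (m powr 2) powr (5 / 2)" using m1 by (simp add: powr_numeral)
    also have "\<dots> = m powr 5" by (simp add: powr_powr)
    also have "\<dots> = m ^ 5" using m1 by (simp add: powr_numeral)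
    finally show ?thesis using m1 by (subst powr_mult) auto
  qed
  also have "\<dots> \<le> (2 * real d) powr 3 * m ^ 5"
    using assms m1 by (intro mult_right_mono powr_mono) auto
  also have "\<dots> = 8 * real d ^ 3 * m ^ 5"
    using assms by (simp add: powr_numeral power_mult_distrib)
  finally have l: "(1 + real d * s) powr (65 / 32) \<le> 8 * real d ^ 3 * m ^ 5" .
  have "2 * (3 / s) ^ d * (1 + real d * s) powr (65 / 32) \<le> 54 / m ^ 6 * (8 * real d ^ 3 * m ^ 5)"
    using k l m1 by (intro mult_mono) auto
  also have "\<dots> = 1 / 2" using m1 assms by (simp add: m_def field_simps)
  finally show "2 * (3 / s) ^ d * (1 + real d * s) powr (65 / 32) \<le> 1 / 2" .
  have "1 * 864 \<le> m ^ 5 * m" using m1 by (intro mult_mono one_le_power) auto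
  then have "54 / m ^ 6 \<le> 1 / 2" by (simp add: divide_le_eq flip: power_Suc2)
  then show "2 * (3 / s) ^ d \<le> 1 / 2" using k by linarith
qed

text \<open>Iterated over balls growing by the factor \<open>la\<close>. The a priori bound M is
  needed only for the remainder, which vanishes in the limit, so the constant does not see
  it.\<close>

lemma hardy:
  fixes v :: "int^'d::finite \<Rightarrow> real"
  assumes d: "3 \<le> CARD('d)" and M: "\<And>R. sq_sum R v \<le> M"
    and A: "\<And>R. 1 \<le> R \<Longrightarrow> grad_sum R v \<le> A * real R powr (1 / 32)" and R: "1 \<le> R"
  shows "sq_sum R v \<le> hardy_const CARD('d) * A * real R powr (65 / 32)"
proof -
  let ?d = "CARD('d)"
  define th where "th = hardy_scale ?d"
  define la where "la = 1 + ?d * th"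
  define ka where "ka = 2 * (3 / real th) ^ ?d"
  define c1 where "c1 = 2 * (real ?d * real th)\<^sup>2 * real la"
  have ka: "ka * real la powr (65 / 32) \<le> 1 / 2" "ka \<le> 1 / 2" "0 \<le> ka"
    using hardy_ratio[OF d] by (auto simp: ka_def la_def th_def)
  have th: "0 < th" by (simp add: th_def hardy_scale_def)
  have la1: "1 \<le> la" by (simp add: la_def)
  have A0: "0 \<le> A" using A[of 1] grad_sum_nonneg[of 1 v] by simp
  have M0: "0 \<le> M" using M[of 0] sq_sum_nonneg[of 0 v] by linarith
  have step: "sq_sum R v \<le> c1 * A * real R powr (65 / 32) + ka * sq_sum (la * R) v" if R: "1 \<le> R" for R
  proof -
    have S: "R + ?d * (th * R) \<le> la * R" by (simp add: la_def algebra_simps)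
    have thR: "0 < th * R" using th R by simp
    have laR: "1 \<le> la * R" using la1 R by (metis mult_le_mono nat_mult_1)
    have g: "grad_sum (la * R) v \<le> A * (real la * real R powr (1 / 32))"
    proof -
      have "grad_sum (la * R) v \<le> A * real (la * R) powr (1 / 32)" by (rule A[OF laR])
      also have "real (la * R) powr (1 / 32) = real la powr (1 / 32) * real R powr (1 / 32)"
        by (simp add: powr_mult)
      also have "real la powr (1 / 32) \<le> real la powr 1" using la1 by (intro powr_mono) auto
      finally show ?thesis using A0 by (simp add: mult_left_mono mult_right_mono)
    qed
    have "(2 * real R + 1) / real (th * R) \<le> 3 / real th"
      using th R by (simp add: field_simps)
    then have k: "((2 * real R + 1) / real (th * R)) ^ ?d \<le> (3 / real th) ^ ?d"
      by (intro power_mono) auto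
    have "sq_sum R v \<le> 2 * (real ?d * real (th * R))\<^sup>2 * grad_sum (la * R) v + 2 * (\<Sum>x\<in>bll R. (avg (th * R) v x)\<^sup>2)"
      by (rule sq_sum_le_avg[OF thR S])
    also have "\<dots> \<le> 2 * (real ?d * real (th * R))\<^sup>2 * (A * (real la * real R powr (1 / 32))) + 2 * ((3 / real th) ^ ?d * sq_sum (la * R) v)"
      using order_trans[OF avg_le_ball[OF thR S, of v] mult_right_mono[OF k sq_sum_nonneg]]
      by (intro add_mono mult_left_mono g) auto
    finally have F: "sq_sum R v \<le> 2 * ((real ?d * real (th * R))\<^sup>2 * (A * (real la * real R powr (1 / 32)))) + 2 * ((3 / real th) ^ ?d * sq_sum (la * R) v)"
      by (simp only: mult.assoc)
    \<comment> \<open>Two powers of R come from the Poincare inequality and 1/32 is the loss in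
      coercivity.\<close>
    have "real R powr 2 * real R powr (1 / 32) = real R powr (65 / 32)"
      by (simp only: powr_add[symmetric]) simp
    then have "(real R)\<^sup>2 * real R powr (1 / 32) = real R powr (65 / 32)"
      using R by (simp add: powr_numeral)
    then have e: "(real ?d * real (th * R))\<^sup>2 * (A * (real la * real R powr (1 / 32))) = (real ?d * real th)\<^sup>2 * real la * A * real R powr (65 / 32)"
      by (simp add: power_mult_distrib)
    show ?thesis using F unfolding e by (simp only: c1_def ka_def mult.assoc)
  qed
  have c1: "0 \<le> c1" by (simp add: c1_def)
  \<comment> \<open>The factor 2 reproduces itself: growth of the radius and contraction together
    contribute at most 1 / 2.\<close>
  have it: "sq_sum R v \<le> 2 * c1 * A * real R powr (65 / 32) + ka ^ m * M" if "1 \<le> R" for R m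
    using that
  proof (induction m arbitrary: R)
    case 0
    have "0 \<le> 2 * c1 * A * real R powr (65 / 32)" using c1 A0 by simp
    from add_mono[OF this M[of R]] show ?case by simp
  next
    case (Suc m)
    have laR: "1 \<le> la * R" using la1 Suc.prems by (metis mult_le_mono nat_mult_1)
    let ?t = "c1 * A * real R powr (65 / 32)"
    have t: "0 \<le> ?t" using c1 A0 by simp
    have "sq_sum R v \<le> ?t + ka * sq_sum (la * R) v" by (rule step[OF Suc.prems])
    also have "\<dots> \<le> ?t + ka * (2 * c1 * A * real (la * R) powr (65 / 32) + ka ^ m * M)"
      using Suc.IH[OF laR] ka by (intro add_left_mono mult_left_mono) auto
    also have "\<dots> = ?t + 2 * (ka * real la powr (65 / 32)) * ?t + ka ^ Suc m * M"
      by (simp add: powr_mult algebra_simps)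
    also have "\<dots> \<le> ?t + 1 * ?t + ka ^ Suc m * M"
      using ka t A0 M0 by (intro add_mono mult_right_mono) auto
    finally show ?case by (simp add: mult_ac)
  qed
  have "(\<lambda>m. 2 * c1 * A * real R powr (65 / 32) + ka ^ m * M) \<longlonglongrightarrow> 2 * c1 * A * real R powr (65 / 32) + 0 * M"
    using ka by (intro tendsto_intros LIMSEQ_power_zero) auto
  then have "sq_sum R v \<le> 2 * c1 * A * real R powr (65 / 32) + 0 * M"
    by (rule LIMSEQ_le_const) (use it[OF R] in auto)
  moreover have "hardy_const ?d = 2 * c1"
    by (simp add: hardy_const_def c1_def la_def th_def)
  ultimately show ?thesis by simp
qed

section \<open>Decay of the Green function\<close>

text \<open>A substitute for uniform ellipticity, with a loss of a small power of the radius.\<close>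
definition coercive :: "'d::finite field \<Rightarrow> real \<Rightarrow> bool" where
  "coercive a K \<longleftrightarrow> (\<forall>v E R. energy_le a v E \<longrightarrow> 1 \<le> R \<longrightarrow> grad_sum R v \<le> K * E * real R powr (1 / 32))"

text \<open>A layer-cake weight comparable to \<open>|x|^(1/32)\<close>, which keeps the summation over dyadic scales free of real
  exponents.\<close>
definition scale_weight :: "int^'d::finite \<Rightarrow> real" where
  "scale_weight x = 1 + (\<Sum>j | 2 * 2 ^ (32 * j) < nrm x. 2 ^ j)"

text \<open>Twice the bounds for the parts of the Green function below and above the level; 1 + d is
  the ratio of the two radii used there.\<close>

definition decay_const :: "nat \<Rightarrow> real" where
  "decay_const d = 2 * hardy_const d + 2 * (2 * (real d)\<^sup>2 * (1 + real d) * hardy_const d + 2 * hardy_const d ^ 3 * (1 + real d) ^ 6)"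

definition green_const :: "nat \<Rightarrow> real" where
  "green_const d = hardy_const d + 2 * (real d * 2 ^ 57 * decay_const d)"

lemma hardy_const_ge_1:
  assumes "1 \<le> d" shows "1 \<le> hardy_const d"
proof -
  have "1 \<le> hardy_scale d" using assms by (simp add: hardy_scale_def)
  then have "1 \<le> real d * real (hardy_scale d)" using assms
    using mult_mono[of 1 "real d" 1 "real (hardy_scale d)"] by simp
  then have "1 * 1 \<le> (real d * real (hardy_scale d))\<^sup>2 * (1 + real d * real (hardy_scale d))"
    by (intro mult_mono one_le_power) auto
  then show ?thesis by (simp add: hardy_const_def)
qed

lemma decay_const_nonneg: "1 \<le> d \<Longrightarrow> 0 \<le> decay_const d"
  using hardy_const_ge_1[of d] by (simp add: decay_const_def)

lemma green_const_ge_1: "1 \<le> d \<Longrightarrow> 1 \<le> green_const d"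
  using hardy_const_ge_1[of d] decay_const_nonneg[of d] unfolding green_const_def
  by (simp add: add_increasing2)

lemma finite_scales: "finite {j. 2 * 2 ^ (32 * j) < (n::nat)}"
proof (rule finite_subset)
  show "{j. 2 * 2 ^ (32 * j) < n} \<subseteq> {..<n}"
  proof
    fix j assume "j \<in> {j. 2 * 2 ^ (32 * j) < n}"
    then have "2 * 2 ^ (32 * j) < n" by simp
    moreover have "j < (2::nat) ^ j" by simp
    moreover have "(2::nat) ^ j \<le> 2 ^ (32 * j)" by (rule power_increasing) auto
    ultimately have "j < n" by linarith
    then show "j \<in> {..<n}" by simp
  qed
qed simp

lemma scale_weight_ge_1: "1 \<le> scale_weight x"
  unfolding scale_weight_def by (simp add: sum_nonneg)

text \<open>The largest scale in the sum suffices, because the next one already exceeds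
  \<open>nrm x\<close> up to the factor 2.\<close>

lemma scale_weight_lower: "1 + real (nrm x) \<le> 2 ^ 34 * scale_weight x ^ 32"
proof (cases "nrm x \<le> 2")
  case True
  then have "1 + real (nrm x) \<le> 2 ^ 34 * 1" by simp
  also have "\<dots> \<le> 2 ^ 34 * scale_weight x ^ 32"
    by (intro mult_left_mono one_le_power scale_weight_ge_1) auto
  finally show ?thesis .
next
  case False
  define J where "J = {j. 2 * 2 ^ (32 * j) < nrm x}"
  have fJ: "finite J" unfolding J_def by (rule finite_scales)
  have "0 \<in> J" using False by (simp add: J_def)
  define j where "j = Max J"
  have jJ: "j \<in> J" unfolding j_def using fJ \<open>0 \<in> J\<close> by (intro Max_in) auto
  have "Suc j \<notin> J" using Max_ge[OF fJ, of "Suc j"] by (auto simp: j_def)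
  then have "nrm x \<le> 2 * 2 ^ (32 * Suc j)" by (simp add: J_def)
  then have "real (nrm x) \<le> real (2 * 2 ^ (32 * Suc j))" by (rule of_nat_mono)
  also have "\<dots> = 2 ^ 33 * (2 ^ j) ^ 32" by (simp add: power_add power_mult mult.commute)
  finally have n: "real (nrm x) \<le> 2 ^ 33 * (2 ^ j) ^ 32" .
  have "(2::real) ^ j \<le> (\<Sum>j\<in>J. 2 ^ j)" using jJ fJ by (intro member_le_sum) auto
  then have "(2::real) ^ j \<le> scale_weight x" by (simp add: scale_weight_def J_def)
  then have "((2::real) ^ j) ^ 32 \<le> scale_weight x ^ 32" by (intro power_mono) auto
  moreover have "1 \<le> scale_weight x ^ 32" by (intro one_le_power scale_weight_ge_1)
  ultimately show ?thesis using n by simp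
qed

text \<open>Source of the threshold 64 d: the weight grows like the 32nd root of the norm, so 32 *
  2d of its powers reach the exponent 2d of \<open>wgt\<close>.\<close>

lemma scale_weight_power_le:
  fixes x :: "int^'d::finite"
  assumes "64 * CARD('d) \<le> n"
  shows "1 / scale_weight x ^ n \<le> 2 ^ (68 * CARD('d)) * wgt x"
proof -
  have "1 / scale_weight x ^ n \<le> 1 / scale_weight x ^ (64 * CARD('d))"
    using scale_weight_ge_1[of x] assms by (intro divide_left_mono power_increasing mult_pos_pos) auto
  also have "\<dots> = 2 ^ (68 * CARD('d)) / (2 ^ 34 * scale_weight x ^ 32) ^ (2 * CARD('d))"
  proof -
    have "(2::real) ^ (68 * CARD('d)) = (2 ^ 34) ^ (2 * CARD('d))" by (simp only: power_mult[symmetric]) simp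
    moreover have "(scale_weight x ^ 32) ^ (2 * CARD('d)) = scale_weight x ^ (64 * CARD('d))"
      by (simp only: power_mult[symmetric]) simp
    ultimately show ?thesis by (simp only: power_mult_distrib) simp
  qed
  also have "\<dots> \<le> 2 ^ (68 * CARD('d)) / (1 + real (nrm x)) ^ (2 * CARD('d))"
    using scale_weight_lower[of x] scale_weight_ge_1[of x]
    by (intro divide_left_mono power_mono mult_pos_pos zero_less_power) (auto intro: add_pos_nonneg)
  finally show ?thesis by (simp add: wgt_def)
qed

lemma l1_le_sq_sum:
  fixes u :: "int^'d::finite \<Rightarrow> real"
  assumes "l1_le u W" shows "sq_sum R u \<le> W * W"
proof -
  have W: "0 \<le> W" using l1_le_abs[OF assms, of undefined] by linarith
  have "sq_sum R u \<le> (\<Sum>x\<in>bll R. W * \<bar>u x\<bar>)"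
    unfolding sq_sum_def
  proof (rule sum_mono)
    fix x
    have "(u x)\<^sup>2 = \<bar>u x\<bar> * \<bar>u x\<bar>" by (simp add: power2_eq_square)
    also have "\<dots> \<le> W * \<bar>u x\<bar>" by (intro mult_right_mono l1_le_abs[OF assms]) auto
    finally show "(u x)\<^sup>2 \<le> W * \<bar>u x\<bar>" .
  qed
  also have "\<dots> \<le> W * W" using assms W by (simp add: l1_le_def mult_left_mono flip: sum_distrib_left)
  finally show ?thesis .
qed

lemma l1_le_mono:
  assumes "l1_le u W" "\<And>x. \<bar>w x\<bar> \<le> \<bar>u x\<bar>" shows "l1_le w W"
  unfolding l1_le_def
proof (intro allI impI)
  fix B :: "'a set" assume "finite B"
  then have "(\<Sum>x\<in>B. \<bar>u x\<bar>) \<le> W" using assms(1) by (simp add: l1_le_def)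
  moreover have "(\<Sum>x\<in>B. \<bar>w x\<bar>) \<le> (\<Sum>x\<in>B. \<bar>u x\<bar>)" by (intro sum_mono assms)
  ultimately show "(\<Sum>x\<in>B. \<bar>w x\<bar>) \<le> W" by linarith
qed

lemma has_sum_finite_support:
  fixes f :: "'a \<Rightarrow> real"
  assumes "finite A" "\<And>x. x \<notin> A \<Longrightarrow> f x = 0" shows "(f has_sum sum f A) UNIV"
proof -
  have "(f has_sum sum f A) A" using assms(1) by (rule has_sum_finite)
  then show ?thesis using assms(2) has_sum_cong_neutral[of UNIV A f f] by simp
qed

lemma powr_power_32:
  fixes t :: real
  assumes t: "0 < t"
  shows "(t ^ 32) powr (65 / 32) = t ^ 65" "(t ^ 32) powr (1 / 32) = t"
proof -
  have "t ^ 32 = t powr 32" using t by (simp add: powr_numeral)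
  then have "(t ^ 32) powr (65 / 32) = t powr 65" "(t ^ 32) powr (1 / 32) = t powr 1" 
    by (simp_all only: powr_powr) simp_all
  then show "(t ^ 32) powr (65 / 32) = t ^ 65" "(t ^ 32) powr (1 / 32) = t" using t by (simp_all add: powr_numeral)
qed

context
  fixes l :: real and a :: "'d::finite field" and K :: real
  assumes l: "0 < l" and a: "unit_field a" and d: "3 \<le> CARD('d)" and K: "1 \<le> K" and co: "coercive a K"
begin

abbreviation "G \<equiv> green l a"

lemma hardy_const_card: "1 \<le> hardy_const CARD('d)"
  using d by (intro hardy_const_ge_1) simp

lemma hardy_coercive:
  assumes "energy_le a v E" "l1_le v W" "1 \<le> R"
  shows "sq_sum R v \<le> hardy_const CARD('d) * K * E * real R powr (65 / 32)"
proof -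
  have "sq_sum R v \<le> hardy_const CARD('d) * (K * E) * real R powr (65 / 32)"
    using l1_le_sq_sum[OF assms(2)] co assms(1)
    by (intro hardy[OF d _ _ assms(3), where M="W * W"]) (auto simp: coercive_def)
  then show ?thesis by (simp add: mult.assoc)
qed

text \<open>Test the Green equation with v and drop the nonnegative mass term. Truncations of the
  Green function satisfy the hypothesis with u = v, and their energy is then at most their
  height.\<close>

lemma green_energy:
  assumes v: "\<And>x. 0 \<le> v x \<and> v x \<le> V" and u: "\<And>b. (grad u b)\<^sup>2 \<le> grad G b * grad v b"
  shows "energy_le a u (v 0)"
  unfolding energy_le_def
proof (intro allI impI)
  fix B :: "'d bond set" assume B: "finite B"
  have vb: "\<bar>v x\<bar> \<le> V" for x using v[of x] by simp
  note T = green_test[where v=v and V=V, OF l a vb]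
  have nn: "0 \<le> a b * grad G b * grad v b" for b
    using unit_fieldD[OF a, of b] order_trans[OF zero_le_power2 u[of b]] by (simp add: mult.assoc)
  have "(\<Sum>b\<in>B. a b * (grad u b)\<^sup>2) \<le> (\<Sum>b\<in>B. a b * grad G b * grad v b)"
    using u unit_fieldD[OF a] by (intro sum_mono) (simp add: mult.assoc mult_left_mono)
  also have "\<dots> \<le> (\<Sum>i\<in>UNIV. \<Sum>\<^sub>\<infinity>x. a (x, i) * grad G (x, i) * grad v (x, i))"
    by (rule sum_bonds_le_infsum[OF B]) (rule nn, rule T(2))
  also have "\<dots> \<le> v 0"
  proof -
    have "0 \<le> (\<Sum>\<^sub>\<infinity>x. v x * G x)" using v green_nonneg[OF l a] by (intro infsum_nonneg) simp
    then have "0 \<le> l * (\<Sum>\<^sub>\<infinity>x. v x * G x)" using l by simp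
    then show ?thesis using T(3) by linarith
  qed
  finally show "(\<Sum>b\<in>B. a b * (grad u b)\<^sup>2) \<le> v 0" .
qed

lemma green_bounds: "0 \<le> G x \<and> G x \<le> 1 / l"
  using green_nonneg[OF l a, of x] green_bound[OF l a, of x] by simp

lemma green_energy_origin: "energy_le a G (G 0)"
  by (rule green_energy[where V="1 / l", OF green_bounds]) (simp add: power2_eq_square)

text \<open>Hardy at radius 1 bounds the square of \<open>G 0\<close> by its energy, which is at
  most \<open>G 0\<close> itself; one factor cancels and \<open>l\<close> has disappeared.\<close>

lemma green_0_le: "G 0 \<le> hardy_const CARD('d) * K"
proof -
  have "(G 0)\<^sup>2 \<le> sq_sum 1 G"
    unfolding sq_sum_def by (rule member_le_sum[where f="\<lambda>x. (G x)\<^sup>2"], auto, simp add: bll_def)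
  also have "\<dots> \<le> hardy_const CARD('d) * K * G 0 * real 1 powr (65 / 32)"
    by (rule hardy_coercive[OF green_energy_origin green_l1[OF l a]]) simp
  finally have "G 0 * G 0 \<le> (hardy_const CARD('d) * K) * G 0" by (simp add: power2_eq_square)
  moreover have "0 \<le> hardy_const CARD('d) * K" using hardy_const_card K by simp
  ultimately show ?thesis using green_nonneg[OF l a, of 0] by (cases "G 0 = 0") (auto simp: mult_le_cancel_right)
qed

text \<open>At radius \<open>t^32\<close> the loss in coercivity is \<open>t\<close>, and the Hardy inequality alone gives \<open>t^65\<close>. The part of the
  Green function below the level \<open>t^(-8)\<close> has energy at most \<open>t^(-8)\<close>; the part above it has small support and
  is averaged over cubes of side \<open>t^28\<close>. The exponent 57 is less than 64, as the Caccioppoli inequality needs.\<close>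
lemma green_sq_sum:
  assumes t: "1 \<le> (t::nat)"
  shows "sq_sum (t ^ 32) G \<le> decay_const CARD('d) * K ^ 3 * real t ^ 57"
proof -
  let ?d = "CARD('d)"
  define T where "T = real t"
  define D where "D = 1 + real ?d"
  define k where "k = 1 / T ^ 8"
  define S where "S = (1 + ?d) * t ^ 32"
  have T: "1 \<le> T" using t by (simp add: T_def)
  have D: "1 \<le> D" by (simp add: D_def)
  have k: "0 < k" using T by (simp add: k_def)
  have HK: "0 \<le> hardy_const CARD('d) * K" using hardy_const_card K by simp
  have S1: "1 \<le> S" unfolding S_def using t mult_le_mono[of 1 "1 + ?d" 1 "t ^ 32"] by simp
  have Sr: "real S = D * T ^ 32" by (simp add: S_def D_def T_def algebra_simps)
  have S65: "real S powr (65 / 32) \<le> D ^ 3 * T ^ 65"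
  proof -
    have "real S powr (65 / 32) = D powr (65 / 32) * T ^ 65"
      using D T by (simp add: Sr powr_mult powr_power_32)
    also have "D powr (65 / 32) \<le> D powr 3" using D by (intro powr_mono) auto
    also have "D powr 3 = D ^ 3" using D by (simp add: powr_numeral)
    finally show ?thesis using T by (simp add: mult_right_mono)
  qed
  have S1': "real S powr (1 / 32) \<le> D * T"
  proof -
    have "real S powr (1 / 32) = D powr (1 / 32) * T"
      using D T by (simp add: Sr powr_mult powr_power_32)
    also have "D powr (1 / 32) \<le> D powr 1" using D by (intro powr_mono) auto
    finally show ?thesis using T D by (simp add: mult_right_mono)
  qed
  have S_ge: "t ^ 32 + ?d * t ^ 28 \<le> S"
    using power_increasing[of 28 32 t] t by (simp add: S_def)
  define u1 where "u1 x = min (G x) k" for x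
  define u2 where "u2 x = max (G x - k) 0" for x
  have G0: "0 \<le> G x" for x using green_nonneg[OF l a] .
  have e1: "energy_le a u1 (u1 0)"
  proof (rule green_energy[where V="1 / l"])
    show "0 \<le> u1 x \<and> u1 x \<le> 1 / l" for x using green_bounds[of x] k by (auto simp: u1_def)
    fix b
    define g where "g = G (x_b b)"
    define g' where "g' = G (y_b b)"
    \<comment> \<open>Truncation is monotone and 1-Lipschitz: its increment has the sign of g' - g
      and is no larger.\<close>
    have "(min g' k - min g k)\<^sup>2 \<le> (g' - g) * (min g' k - min g k)"
    proof -
      have "0 \<le> (g' - g - (min g' k - min g k)) * (min g' k - min g k)"
        by (cases "g \<le> k"; cases "g' \<le> k") (auto simp: min_def intro: mult_nonneg_nonneg mult_nonpos_nonpos)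
      then show ?thesis by (simp add: power2_eq_square algebra_simps)
    qed
    then show "(grad u1 b)\<^sup>2 \<le> grad G b * grad u1 b" by (simp add: grad_def u1_def g_def g'_def)
  qed
  have e2: "energy_le a u2 (u2 0)"
  proof (rule green_energy[where V="1 / l"])
    show "0 \<le> u2 x \<and> u2 x \<le> 1 / l" for x using green_bounds[of x] k l by (auto simp: u2_def)
    fix b
    define g where "g = G (x_b b)"
    define g' where "g' = G (y_b b)"
    have "(max (g' - k) 0 - max (g - k) 0)\<^sup>2 \<le> (g' - g) * (max (g' - k) 0 - max (g - k) 0)"
    proof -
      have "0 \<le> (g' - g - (max (g' - k) 0 - max (g - k) 0)) * (max (g' - k) 0 - max (g - k) 0)"
        by (cases "g \<le> k"; cases "g' \<le> k") (auto simp: max_def intro: mult_nonneg_nonneg mult_nonpos_nonpos)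
      then show ?thesis by (simp add: power2_eq_square algebra_simps)
    qed
    then show "(grad u2 b)\<^sup>2 \<le> grad G b * grad u2 b" by (simp add: grad_def u2_def g_def g'_def)
  qed
  have mono: "energy_le a u E \<Longrightarrow> E \<le> E' \<Longrightarrow> energy_le a u E'" for u E E'
    unfolding energy_le_def by (meson order_trans)
  have e1': "energy_le a u1 k" by (rule mono[OF e1]) (simp add: u1_def)
  have e2': "energy_le a u2 (hardy_const CARD('d) * K)"
    by (rule mono[OF e2]) (use k green_0_le HK in \<open>simp add: u2_def\<close>)
  have l1: "l1_le u1 (1 / l)" "l1_le u2 (1 / l)"
    by (rule l1_le_mono[OF green_l1[OF l a]]; use k G0 in \<open>simp add: u1_def u2_def\<close>)+
  have q1: "sq_sum (t ^ 32) u1 \<le> hardy_const CARD('d) * K * k * T ^ 65"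
    using hardy_coercive[OF e1' l1(1), of "t ^ 32"] t by (simp add: powr_power_32 T_def)
  have q1S: "sq_sum S u1 \<le> hardy_const CARD('d) * K * k * (D ^ 3 * T ^ 65)"
    using hardy_coercive[OF e1' l1(1) S1] S65 HK k
    by (meson mult_left_mono mult_nonneg_nonneg order_less_imp_le order_trans)
  have q2S: "sq_sum S u2 \<le> hardy_const CARD('d) * K * (hardy_const CARD('d) * K) * (D ^ 3 * T ^ 65)"
    using hardy_coercive[OF e2' l1(2) S1] S65 HK
    by (meson mult_left_mono mult_nonneg_nonneg order_trans)
  have g2: "grad_sum S u2 \<le> K * (hardy_const CARD('d) * K) * (D * T)"
  proof -
    have "grad_sum S u2 \<le> K * (hardy_const CARD('d) * K) * real S powr (1 / 32)" using co e2' S1 by (simp add: coercive_def)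
    also have "\<dots> \<le> K * (hardy_const CARD('d) * K) * (D * T)" using S1' hardy_const_card K by (intro mult_left_mono mult_nonneg_nonneg) auto
    finally show ?thesis .
  qed
  \<comment> \<open>Chebyshev: \<open>u1\<close> equals k wherever \<open>u2\<close> is nonzero. One
    factor k cancels against the small energy of \<open>u1\<close>, the other gives 73 = 65 +
    8.\<close>
  have N: "real (card {y \<in> bll S. u2 y \<noteq> 0}) \<le> hardy_const CARD('d) * K * D ^ 3 * T ^ 73"
  proof -
    have "real (card {y \<in> bll S. u2 y \<noteq> 0}) * k\<^sup>2 = (\<Sum>y\<in>{y \<in> bll S. u2 y \<noteq> 0}. (u1 y)\<^sup>2)"
      by (subst sum.cong[OF refl, of _ _ "\<lambda>_. k\<^sup>2"]) (auto simp: u1_def u2_def max_def min_def split: if_splits)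
    also have "\<dots> \<le> sq_sum S u1" unfolding sq_sum_def by (intro sum_mono2) auto
    also note q1S
    finally have "k * (real (card {y \<in> bll S. u2 y \<noteq> 0}) * k) \<le> k * (hardy_const CARD('d) * K * (D ^ 3 * T ^ 65))"
      by (simp add: power2_eq_square mult_ac)
    then have le: "real (card {y \<in> bll S. u2 y \<noteq> 0}) * k \<le> hardy_const CARD('d) * K * (D ^ 3 * T ^ 65)"
      using k by (simp only: mult_le_cancel_left_pos)
    have "real (card {y \<in> bll S. u2 y \<noteq> 0}) = real (card {y \<in> bll S. u2 y \<noteq> 0}) * k * T ^ 8"
      using T by (simp add: k_def)
    also have "\<dots> \<le> hardy_const CARD('d) * K * (D ^ 3 * T ^ 65) * T ^ 8"
      using T by (intro mult_right_mono le) auto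
    also have "\<dots> = hardy_const CARD('d) * K * D ^ 3 * (T ^ 65 * T ^ 8)" by (simp only: mult.assoc)
    also have "T ^ 65 * T ^ 8 = T ^ 73" by (simp flip: power_add)
    finally show ?thesis .
  qed
  \<comment> \<open>The gradient term gives 2 * 28 + 1 = 57, matching 65 - 8 for \<open>u1\<close>.
    The average gives 73 - 3 * 28 + 65 = 54, where three dimensions enter.\<close>
  have q2: "sq_sum (t ^ 32) u2 \<le> (2 * (real ?d)\<^sup>2 * D * hardy_const CARD('d) + 2 * hardy_const CARD('d) ^ 3 * D ^ 6) * K ^ 3 * T ^ 57"
  proof -
    have "sq_sum (t ^ 32) u2 \<le> 2 * (real ?d * real (t ^ 28))\<^sup>2 * grad_sum S u2 + 2 * (\<Sum>x\<in>bll (t ^ 32). (avg (t ^ 28) u2 x)\<^sup>2)"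
      using t by (intro sq_sum_le_avg S_ge) simp
    also have "2 * (real ?d * real (t ^ 28))\<^sup>2 * grad_sum S u2 \<le> 2 * (real ?d * real (t ^ 28))\<^sup>2 * (K * (hardy_const CARD('d) * K) * (D * T))"
      by (intro mult_left_mono g2) auto
    also have "\<dots> = 2 * (real ?d)\<^sup>2 * D * hardy_const CARD('d) * K\<^sup>2 * (T ^ 28 * T ^ 28 * T)"
      by (simp add: T_def power2_eq_square)
    also have "T ^ 28 * T ^ 28 * T = T ^ 57" by (simp flip: power_add power_Suc2)
    also have "2 * (real ?d)\<^sup>2 * D * hardy_const CARD('d) * K\<^sup>2 * T ^ 57 \<le> 2 * (real ?d)\<^sup>2 * D * hardy_const CARD('d) * K ^ 3 * T ^ 57"
      using K D hardy_const_card T by (intro mult_right_mono mult_left_mono power_increasing) auto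
    also have "(\<Sum>x\<in>bll (t ^ 32). (avg (t ^ 28) u2 x)\<^sup>2) \<le> hardy_const CARD('d) ^ 3 * D ^ 6 * K ^ 3 * T ^ 57"
    proof -
      have "(\<Sum>x\<in>bll (t ^ 32). (avg (t ^ 28) u2 x)\<^sup>2) \<le> (hardy_const CARD('d) * K * D ^ 3 * T ^ 73) / real (t ^ 28) ^ ?d * sq_sum S u2"
        using t by (intro avg_le_support S_ge N) simp
      also have "\<dots> \<le> (hardy_const CARD('d) * K * D ^ 3 * T ^ 73) / (T ^ 28) ^ 3 * (hardy_const CARD('d) * K * (hardy_const CARD('d) * K) * (D ^ 3 * T ^ 65))"
      proof (intro mult_mono q2S sq_sum_nonneg divide_left_mono)
        show "(T ^ 28) ^ 3 \<le> real (t ^ 28) ^ ?d"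
          using power_increasing[OF d, of "T ^ 28"] T by (simp add: T_def)
      qed (use HK D T t in auto)
      also have "\<dots> = hardy_const CARD('d) ^ 3 * D ^ 6 * K ^ 3 * T ^ 54"
      proof -
        have "T ^ 73 * T ^ 65 = T ^ 54 * (T ^ 28) ^ 3" by (simp flip: power_add power_mult)
        then have "T ^ 73 / (T ^ 28) ^ 3 * T ^ 65 = T ^ 54" using T by (simp add: field_simps)
        moreover have "(h * k * q * P) / M * (h * k * (h * k) * (q * Q)) = (h * (h * h)) * (q * q) * (k * (k * k)) * (P / M * Q)"
          for h k q P M Q :: real by simp
        moreover have "D ^ 3 * D ^ 3 = D ^ 6" by (simp flip: power_add)
        moreover have "x * (x * x) = x ^ 3" for x :: real by (simp add: power3_eq_cube)
        ultimately show ?thesis by (simp only:)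
      qed
      also have "\<dots> \<le> hardy_const CARD('d) ^ 3 * D ^ 6 * K ^ 3 * T ^ 57"
        using K D hardy_const_card T by (intro mult_left_mono power_increasing) auto
      finally show ?thesis .
    qed
    finally show ?thesis by (simp add: algebra_simps)
  qed
  have split: "sq_sum (t ^ 32) G \<le> 2 * sq_sum (t ^ 32) u1 + 2 * sq_sum (t ^ 32) u2"
  proof -
    have "(G x)\<^sup>2 \<le> 2 * (u1 x)\<^sup>2 + 2 * (u2 x)\<^sup>2" for x
    proof -
      have "G x = u1 x + u2 x" by (auto simp: u1_def u2_def)
      then show ?thesis using sum_squares_bound[of "u1 x" "u2 x"] by (simp add: power2_eq_square algebra_simps)
    qed
    then show ?thesis unfolding sq_sum_def sum_distrib_left sum.distrib[symmetric] by (intro sum_mono)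
  qed
  have "hardy_const CARD('d) * K * k * T ^ 65 = hardy_const CARD('d) * K * T ^ 57"
  proof -
    have "T ^ 65 = T ^ 8 * T ^ 57" by (simp flip: power_add)
    moreover have "k * T ^ 8 = 1" using T by (simp add: k_def)
    ultimately have "k * T ^ 65 = T ^ 57" by (simp only: mult.assoc[symmetric] mult_1)
    then show ?thesis by (simp only: mult.assoc)
  qed
  with q1 have "sq_sum (t ^ 32) u1 \<le> hardy_const CARD('d) * K * T ^ 57" by simp
  also have "\<dots> \<le> hardy_const CARD('d) * K ^ 3 * T ^ 57"
    using power_increasing[of 1 3 K] K hardy_const_card T by (intro mult_right_mono mult_left_mono) auto
  finally have "sq_sum (t ^ 32) G \<le> 2 * (hardy_const CARD('d) * K ^ 3 * T ^ 57) + 2 * ((2 * (real ?d)\<^sup>2 * D * hardy_const CARD('d) + 2 * hardy_const CARD('d) ^ 3 * D ^ 6) * K ^ 3 * T ^ 57)"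
    using q2 split by linarith
  also have "\<dots> = decay_const ?d * K ^ 3 * T ^ 57"
    by (simp add: decay_const_def D_def algebra_simps)
  finally show ?thesis by (simp add: T_def)
qed

text \<open>Caccioppoli inequality: test with \<open>c^2 * G\<close> for a cutoff \<open>c\<close> vanishing at the pole.\<close>
lemma green_tail:
  assumes R: "1 \<le> R" and B: "finite B" "\<And>b. b \<in> B \<Longrightarrow> 2 * R < nrm (x_b b)"
  shows "(\<Sum>b\<in>B. a b * (grad G b)\<^sup>2) \<le> real CARD('d) / (real R)\<^sup>2 * sq_sum (3 * R) G"
proof -
  define c where "c x = max 0 (min 1 ((real (nrm x) - real R) / real R))" for x :: "int^'d"
  define v where "v x = (c x)\<^sup>2 * G x" for x
  define p where "p b = a b * (G (x_b b) * G (y_b b) * (grad c b)\<^sup>2)" for b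
  have R0: "0 < real R" using R by simp
  have c01: "0 \<le> c x" "c x \<le> 1" for x by (auto simp: c_def)
  have c_out: "c x = 1" if "2 * R \<le> nrm x" for x using that R0 by (auto simp: c_def le_divide_eq)
  have c0: "c 0 = 0" using R0 by (auto simp: c_def)
  have gc: "\<bar>grad c b\<bar> \<le> 1 / real R" for b
  proof -
    have "nrm (y_b b) \<le> nrm (x_b b) + 1" "nrm (x_b b) \<le> nrm (y_b b) + 1"
      using nrm_triangle[of "x_b b" "unitv (snd b)"] nrm_diff[of "y_b b" "unitv (snd b)"] by (auto simp: x_b_def y_b_def)
    then have "\<bar>real (nrm (y_b b)) - real (nrm (x_b b))\<bar> \<le> 1" by linarith
    then have "\<bar>(real (nrm (y_b b)) - real R) / real R - (real (nrm (x_b b)) - real R) / real R\<bar> \<le> 1 / real R"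
      using R0 by (simp add: divide_right_mono flip: diff_divide_distrib)
    then show ?thesis unfolding grad_def c_def by linarith
  qed
  have G0: "0 \<le> G x" for x using green_nonneg[OF l a] .
  have vb: "\<bar>v x\<bar> \<le> 1 / l" for x
    using green_bounds[of x] c01[of x] mult_le_one[of "c x" "c x"] mult_left_le_one_le[of "G x" "(c x)\<^sup>2"]
    unfolding v_def by (simp add: power2_eq_square)
  note T = green_test[where v=v and V="1 / l", OF l a vb]
  \<comment> \<open>An exact discrete product rule: the error is the product of the two endpoint
    values of G times the squared cutoff gradient.\<close>
  have id: "a b * grad G b * grad v b + p b = a b * (grad (\<lambda>x. c x * G x) b)\<^sup>2" for b
    unfolding p_def v_def grad_def by (simp add: power2_eq_square algebra_simps)
  have p_out: "p (x, i) = 0" if "x \<notin> bll (2 * R)" for x i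
  proof -
    have "2 * R < nrm x" using that by (simp add: bll_def)
    moreover have "nrm x \<le> nrm (x + unitv i) + 1" using nrm_diff[of "x + unitv i" "unitv i"] by simp
    ultimately have "c x = 1" "c (x + unitv i) = 1" by (auto intro!: c_out)
    then show ?thesis by (simp add: p_def grad_pair)
  qed
  have ps: "((\<lambda>x. p (x, i)) has_sum (\<Sum>x\<in>bll (2 * R). p (x, i))) UNIV" for i
    by (rule has_sum_finite_support) (auto intro: p_out)
  have fs: "((\<lambda>x. a (x, i) * grad G (x, i) * grad v (x, i) + p (x, i)) has_sum
     ((\<Sum>\<^sub>\<infinity>x. a (x, i) * grad G (x, i) * grad v (x, i)) + (\<Sum>x\<in>bll (2 * R). p (x, i)))) UNIV" for i
    by (rule has_sum_add[OF has_sum_infsum[OF T(2)] ps])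
  have "(\<Sum>b\<in>B. a b * (grad G b)\<^sup>2) = (\<Sum>b\<in>B. a b * grad G b * grad v b + p b)"
  proof (rule sum.cong[OF refl])
    fix b assume "b \<in> B"
    \<comment> \<open>Strictness leaves room for the other endpoint to lie one step closer to the
      origin.\<close>
    then have n: "2 * R < nrm (x_b b)" by (rule B)
    moreover have "nrm (x_b b) \<le> nrm (y_b b) + 1" using nrm_diff[of "y_b b" "unitv (snd b)"] by (auto simp: x_b_def y_b_def)
    ultimately have "c (x_b b) = 1" "c (y_b b) = 1" by (auto intro!: c_out)
    then show "a b * (grad G b)\<^sup>2 = a b * grad G b * grad v b + p b" unfolding id by (simp add: grad_def)
  qed
  also have "\<dots> \<le> (\<Sum>i\<in>UNIV. \<Sum>\<^sub>\<infinity>x. a (x, i) * grad G (x, i) * grad v (x, i) + p (x, i))"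
  proof (rule sum_bonds_le_infsum[OF B(1)])
    show "0 \<le> a b * grad G b * grad v b + p b" for b unfolding id using unit_fieldD[OF a] by simp
    show "(\<lambda>x. a (x, i) * grad G (x, i) * grad v (x, i) + p (x, i)) summable_on UNIV" for i
      using fs[of i] summable_on_def by blast
  qed
  also have "\<dots> = (\<Sum>i\<in>UNIV. \<Sum>\<^sub>\<infinity>x. a (x, i) * grad G (x, i) * grad v (x, i)) + (\<Sum>i\<in>UNIV. \<Sum>x\<in>bll (2 * R). p (x, i))"
    by (simp add: infsumI[OF fs] sum.distrib)
  \<comment> \<open>The cutoff vanishes at the pole, so the right-hand side \<open>v 0\<close> of
    the tested equation is 0.\<close>
  also have "\<dots> \<le> (\<Sum>i\<in>UNIV. \<Sum>x\<in>bll (2 * R). p (x, i))"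
  proof -
    have "0 \<le> (\<Sum>\<^sub>\<infinity>x. v x * G x)" using G0 by (intro infsum_nonneg) (simp add: v_def)
    then have "0 \<le> l * (\<Sum>\<^sub>\<infinity>x. v x * G x)" using l by simp
    then show ?thesis using T(3) by (simp add: v_def c0)
  qed
  also have "\<dots> \<le> (\<Sum>i\<in>(UNIV::'d set). sq_sum (3 * R) G / (real R)\<^sup>2)"
  proof (rule sum_mono)
    fix i :: 'd
    have pp: "p (x, i) \<le> ((G x)\<^sup>2 + (G (x + unitv i))\<^sup>2) / (2 * (real R)\<^sup>2)" for x
    proof -
      have "p (x, i) \<le> G x * G (x + unitv i) * (grad c (x, i))\<^sup>2"
        using unit_fieldD[OF a] G0 by (simp add: p_def mult_left_le_one_le)
      also have "\<dots> \<le> (((G x)\<^sup>2 + (G (x + unitv i))\<^sup>2) / 2) * (1 / real R)\<^sup>2"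
      proof (intro mult_mono)
        show "G x * G (x + unitv i) \<le> ((G x)\<^sup>2 + (G (x + unitv i))\<^sup>2) / 2"
          using sum_squares_bound[of "G x" "G (x + unitv i)"] by (simp add: power2_eq_square)
        show "(grad c (x, i))\<^sup>2 \<le> (1 / real R)\<^sup>2"
          using gc[of "(x, i)"] R0 by (subst abs_le_square_iff[symmetric]) simp
      qed auto
      finally show ?thesis by (simp add: power_divide)
    qed
    have "(\<Sum>x\<in>bll (2 * R). p (x, i)) \<le> (\<Sum>x\<in>bll (2 * R). ((G x)\<^sup>2 + (G (x + unitv i))\<^sup>2) / (2 * (real R)\<^sup>2))"
      by (intro sum_mono pp)
    also have "\<dots> = (sq_sum (2 * R) G + (\<Sum>x\<in>bll (2 * R). (G (x + unitv i))\<^sup>2)) / (2 * (real R)\<^sup>2)"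
      by (simp add: sq_sum_def sum.distrib flip: sum_divide_distrib)
    also have "\<dots> \<le> (sq_sum (3 * R) G + sq_sum (3 * R) G) / (2 * (real R)\<^sup>2)"
    proof (intro divide_right_mono add_mono)
      show "sq_sum (2 * R) G \<le> sq_sum (3 * R) G" by (rule sq_sum_mono) simp
      have "(\<Sum>x\<in>bll (2 * R). (G (x + unitv i))\<^sup>2) \<le> sq_sum (2 * R + 1) G"
        unfolding sq_sum_def by (rule translate_sum_le) auto
      also have "\<dots> \<le> sq_sum (3 * R) G" using R by (intro sq_sum_mono) simp
      finally show "(\<Sum>x\<in>bll (2 * R). (G (x + unitv i))\<^sup>2) \<le> sq_sum (3 * R) G" .
    qed auto
    also have "\<dots> = sq_sum (3 * R) G / (real R)\<^sup>2" by simp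
    finally show "(\<Sum>x\<in>bll (2 * R). p (x, i)) \<le> sq_sum (3 * R) G / (real R)\<^sup>2" .
  qed
  finally show ?thesis by simp
qed

text \<open>The layer-cake form of the weight turns the sum into tail energies. At t = 2^j the tail
  decays like t^(57 - 64) = t^(-7) against the weight t.\<close>

lemma green_weighted_energy:
  assumes B: "finite B"
  shows "(\<Sum>b\<in>B. a b * (grad G b)\<^sup>2 * scale_weight (x_b b)) \<le> green_const CARD('d) * K ^ 3"
proof -
  define m where "m b = a b * (grad G b)\<^sup>2" for b
  define C where "C = real CARD('d) * 2 ^ 57 * decay_const CARD('d)"
  have m0: "0 \<le> m b" for b using unit_fieldD[OF a] by (simp add: m_def)
  have dc: "0 \<le> decay_const CARD('d)" using d by (intro decay_const_nonneg) simp
  have C0: "0 \<le> C" using dc by (simp add: C_def)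
  have tail: "(\<Sum>b\<in>A. m b) \<le> C * K ^ 3 / (2 ^ j) ^ 7"
    if A: "finite A" "\<And>b. b \<in> A \<Longrightarrow> 2 * 2 ^ (32 * j) < nrm (x_b b)" for A j
  proof -
    define t :: nat where "t = 2 ^ j"
    have t1: "1 \<le> t" by (simp add: t_def)
    have tt: "2 ^ (32 * j) = t ^ 32" by (simp add: t_def mult.commute flip: power_mult)
    have "(\<Sum>b\<in>A. m b) \<le> real CARD('d) / (real (t ^ 32))\<^sup>2 * sq_sum (3 * t ^ 32) G"
      unfolding m_def using A t1 by (intro green_tail) (auto simp: tt)
    also have "\<dots> \<le> real CARD('d) / (real (t ^ 32))\<^sup>2 * (decay_const CARD('d) * K ^ 3 * real (2 * t) ^ 57)"
    proof (rule mult_left_mono)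
      \<comment> \<open>The radius is enlarged to a 32nd power again; this produces the 2^57 in
        \<open>green_const\<close>.\<close>
      have "3 * t ^ 32 \<le> (2 * t) ^ 32" by (simp add: power_mult_distrib)
      then have "sq_sum (3 * t ^ 32) G \<le> sq_sum ((2 * t) ^ 32) G" by (rule sq_sum_mono)
      also have "\<dots> \<le> decay_const CARD('d) * K ^ 3 * real (2 * t) ^ 57" using t1 by (intro green_sq_sum) simp
      finally show "sq_sum (3 * t ^ 32) G \<le> decay_const CARD('d) * K ^ 3 * real (2 * t) ^ 57" .
    qed simp
    also have "\<dots> = C * K ^ 3 * (real t ^ 57 / (real t ^ 32)\<^sup>2)"
      by (simp add: C_def power_mult_distrib)
    also have "real t ^ 57 / (real t ^ 32)\<^sup>2 = 1 / real t ^ 7"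
    proof -
      have "(real t ^ 32)\<^sup>2 = real t ^ 57 * real t ^ 7" by (simp flip: power_add power_mult)
      moreover have "0 < real t" using t1 by simp
      ultimately show ?thesis by (simp only: nonzero_divide_mult_cancel_left power_not_zero less_numeral_extra(3) less_imp_neq[symmetric] not_False_eq_True)
    qed
    finally show ?thesis by (simp add: t_def)
  qed
  define J where "J = Max (insert 0 ((\<lambda>b. nrm (x_b b)) ` B))"
  have J: "nrm (x_b b) \<le> J" if "b \<in> B" for b unfolding J_def using B that by (intro Max_ge) auto
  have sw: "scale_weight (x_b b) = 1 + (\<Sum>j<J. if 2 * 2 ^ (32 * j) < nrm (x_b b) then 2 ^ j else 0)" if "b \<in> B" for b
  proof -
    have "{j. 2 * 2 ^ (32 * j) < nrm (x_b b)} \<subseteq> {..<J}"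
    proof
      fix j assume "j \<in> {j. 2 * 2 ^ (32 * j) < nrm (x_b b)}"
      then have "2 * 2 ^ (32 * j) < nrm (x_b b)" by simp
      moreover have "j < (2::nat) ^ j" by simp
      moreover have "(2::nat) ^ j \<le> 2 ^ (32 * j)" by (rule power_increasing) auto
      ultimately have "j < J" using J[OF that] by linarith
      then show "j \<in> {..<J}" by simp
    qed
    then have "(\<Sum>j | 2 * 2 ^ (32 * j) < nrm (x_b b). (2::real) ^ j) = (\<Sum>j<J. if 2 * 2 ^ (32 * j) < nrm (x_b b) then 2 ^ j else 0)"
      by (simp add: sum.If_cases Int_absorb1 Collect_conj_eq)
    then show ?thesis by (simp add: scale_weight_def)
  qed
  have "(\<Sum>b\<in>B. m b * scale_weight (x_b b)) = (\<Sum>b\<in>B. m b + (\<Sum>j<J. if 2 * 2 ^ (32 * j) < nrm (x_b b) then m b * 2 ^ j else 0))"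
    by (intro sum.cong refl) (simp add: sw distrib_left sum_distrib_left if_distrib[of "\<lambda>t. m _ * t"] cong: if_cong)
  also have "\<dots> = (\<Sum>b\<in>B. m b) + (\<Sum>j<J. \<Sum>b\<in>B. if 2 * 2 ^ (32 * j) < nrm (x_b b) then m b * 2 ^ j else 0)"
    by (simp add: sum.distrib sum.swap[of _ B])
  also have "(\<Sum>j<J. \<Sum>b\<in>B. if 2 * 2 ^ (32 * j) < nrm (x_b b) then m b * 2 ^ j else 0)
      \<le> (\<Sum>j<J. C * K ^ 3 * (1 / 2) ^ j)"
  proof (rule sum_mono)
    fix j
    have "(\<Sum>b\<in>B. if 2 * 2 ^ (32 * j) < nrm (x_b b) then m b * 2 ^ j else 0)
      = 2 ^ j * (\<Sum>b\<in>{b \<in> B. 2 * 2 ^ (32 * j) < nrm (x_b b)}. m b)"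
      using B by (subst sum.inter_filter) (auto simp: sum_distrib_left mult.commute intro!: sum.cong)
    also have "\<dots> \<le> 2 ^ j * (C * K ^ 3 / (2 ^ j) ^ 7)"
      using B by (intro mult_left_mono tail) auto
    also have "\<dots> = C * K ^ 3 * (1 / (2 ^ j) ^ 6)"
      by (simp add: power_Suc[of "2 ^ j :: real" 6, simplified])
    also have "\<dots> \<le> C * K ^ 3 * (1 / 2 ^ j)"
    proof (intro mult_left_mono divide_left_mono)
      show "(2::real) ^ j \<le> (2 ^ j) ^ 6" using power_increasing[of 1 6 "2 ^ j :: real"] by simp
    qed (use C0 K in auto)
    finally show "(\<Sum>b\<in>B. if 2 * 2 ^ (32 * j) < nrm (x_b b) then m b * 2 ^ j else 0) \<le> C * K ^ 3 * (1 / 2) ^ j"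
      by (simp add: power_divide)
  qed
  also have "\<dots> \<le> C * K ^ 3 * 2"
    unfolding sum_distrib_left[symmetric]
  proof (intro mult_left_mono)
    show "(\<Sum>j<J. (1 / 2) ^ j) \<le> (2::real)" by (simp add: sum_gp_strict)
  qed (use C0 K in auto)
  also have "(\<Sum>b\<in>B. m b) \<le> hardy_const CARD('d) * K ^ 3"
  proof -
    have "(\<Sum>b\<in>B. m b) \<le> G 0" using green_energy_origin B by (simp add: energy_le_def m_def)
    also note green_0_le
    also have "hardy_const CARD('d) * K \<le> hardy_const CARD('d) * K ^ 3" using power_increasing[of 1 3 K] K hardy_const_card by (intro mult_left_mono) auto
    finally show ?thesis .
  qed
  finally show ?thesis by (simp add: m_def green_const_def C_def algebra_simps)
qed

end

section \<open>The random environment\<close>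

text \<open>Monotone convergence along an enumeration; it reduces the sum over all bonds in the
  spectral gap to finite sets.\<close>

lemma nn_integral_count_space_le:
  fixes f :: "'a::countable \<Rightarrow> ennreal"
  assumes "\<And>B. finite B \<Longrightarrow> (\<Sum>b\<in>B. f b) \<le> C"
  shows "(\<integral>\<^sup>+b. f b \<partial>count_space UNIV) \<le> C"
proof -
  define A where "A n = {x :: 'a. to_nat x < n}" for n
  have fin: "finite (A n)" for n
    unfolding A_def by (rule finite_imageD[of to_nat]) (auto intro: finite_subset[of _ "{..<n}"] inj_on_subset[OF inj_to_nat])
  have mono: "incseq (\<lambda>n x. f x * indicator (A n) x)"
    by (auto simp: incseq_def le_fun_def A_def split: split_indicator)
  have "f x = (SUP n. f x * indicator (A n) x)" for x
  proof (rule antisym)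
    show "f x \<le> (SUP n. f x * indicator (A n) x)"
      by (rule SUP_upper2[of "Suc (to_nat x)"]) (auto simp: A_def)
    show "(SUP n. f x * indicator (A n) x) \<le> f x"
      by (rule SUP_least) (auto split: split_indicator)
  qed
  then have "(\<integral>\<^sup>+b. f b \<partial>count_space UNIV) = (\<integral>\<^sup>+b. (SUP n. f b * indicator (A n) b) \<partial>count_space UNIV)" by simp
  also have "\<dots> = (SUP n. \<integral>\<^sup>+b. f b * indicator (A n) b \<partial>count_space UNIV)"
    by (rule nn_integral_monotone_convergence_SUP[OF mono]) simp
  also have "\<dots> \<le> C"
  proof (rule SUP_least)
    fix n
    have "(\<integral>\<^sup>+b. f b * indicator (A n) b \<partial>count_space UNIV) = (\<Sum>b\<in>A n. f b * indicator (A n) b)"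
      by (rule nn_integral_count_space') (auto simp: fin)
    also have "\<dots> = (\<Sum>b\<in>A n. f b)" by (intro sum.cong) auto
    also have "\<dots> \<le> C" by (rule assms[OF fin])
    finally show "(\<integral>\<^sup>+b. f b * indicator (A n) b \<partial>count_space UNIV) \<le> C" .
  qed
  finally show ?thesis .
qed

lemma le_nn_integral_count_space:
  fixes f :: "'a \<Rightarrow> ennreal"
  assumes "finite B" shows "(\<Sum>b\<in>B. f b) \<le> (\<integral>\<^sup>+b. f b \<partial>count_space UNIV)"
proof -
  have "(\<Sum>b\<in>B. f b) = (\<Sum>b\<in>B. f b * indicator B b)" by (intro sum.cong) auto
  also have "\<dots> = (\<integral>\<^sup>+b. f b * indicator B b \<partial>count_space UNIV)"
    by (rule nn_integral_count_space'[symmetric]) (use assms in auto)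
  also have "\<dots> \<le> (\<integral>\<^sup>+b. f b \<partial>count_space UNIV)" by (rule nn_integral_mono) (auto split: split_indicator)
  finally show ?thesis .
qed

lemma space_Omega: "space (Omega :: 'd::finite field measure) = {a. unit_field a}"
  by (auto simp: Omega_def space_PiM space_restrict_space PiE_iff unit_field_def)

lemma measurable_into_Omega:
  assumes "\<And>b. (\<lambda>a. f a b) \<in> borel_measurable M" "\<And>a. a \<in> space M \<Longrightarrow> unit_field (f a)"
  shows "f \<in> measurable M (Omega :: 'd::finite field measure)"
  unfolding Omega_def
proof (rule measurable_PiM_single'[where f="\<lambda>b a. f a b", simplified])
  show "(\<lambda>a. f a b) \<in> measurable M (restrict_space borel {0..1})" for b
    using assms(1)[of b] unit_fieldD[OF assms(2), of _ b] by (intro measurable_restrict_space2) auto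
  show "f \<in> space M \<rightarrow> UNIV \<rightarrow>\<^sub>E space (restrict_space borel {0..1})"
    using unit_fieldD[OF assms(2)] by (auto simp: space_restrict_space PiE_iff)
qed

section \<open>Covariance under shifts, and detours around bonds\<close>

lemma shift_apply: "shift z a (x, i) = a (x + z, i)"
  by (simp add: shift_def)

lemma unit_field_shift: "unit_field a \<Longrightarrow> unit_field (shift z a)"
  by (auto simp: unit_field_def shift_def)

lemma jump_shift: "jump (shift z a) (\<lambda>x. u (x + z)) x = jump a u (x + z)"
  unfolding jump_def by (intro sum.cong) (auto simp: shift_apply algebra_simps)

lemma corr_rhs_shift: "corr_rhs e (shift z a) x = corr_rhs e a (x + z)"
  unfolding corr_rhs_def div_star_def
  by (intro arg_cong[where f=uminus] sum.cong) (auto simp: shift_apply e_field_def algebra_simps)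

text \<open>Each term of the series is covariant, so stationarity holds for every field, without an
  exceptional null set.\<close>

lemma corr_shift: "corr l e (shift z a) x = corr l e a (x + z)"
proof -
  have "(jump (shift z a) ^^ k) (corr_rhs e (shift z a)) = (\<lambda>x. (jump a ^^ k) (corr_rhs e a) (x + z))" for k
  proof (induction k)
    case 0 show ?case by (simp add: corr_rhs_shift)
  next
    case (Suc k) then show ?case by (simp add: jump_shift)
  qed
  then show ?thesis by (simp add: corr_def resolvent_def)
qed

lemma flux_grad_shift: "flux_grad l e (shift z a) (x, i) = flux_grad l e a (x + z, i)"
  by (simp add: flux_grad_def grad_pair corr_shift e_field_def algebra_simps)

lemma kill_shift: "kill_bond (shift z a) (x, i) = shift z (kill_bond a (x + z, i))"
  by (auto simp: kill_bond_def shift_def fun_eq_iff)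

definition bond_dist :: "'d::finite field \<Rightarrow> 'd bond \<Rightarrow> ennreal" where
  "bond_dist a b = chem_dist (kill_bond a b) (x_b b) (y_b b)"

lemma bond_dist_shift_le: "bond_dist a (x + z, i) \<le> bond_dist (shift z a) (x, i)"
  using chem_dist_shift_le[of "kill_bond a (x + z, i)" x z "x + unitv i"]
  by (simp add: bond_dist_def kill_shift algebra_simps)

text \<open>The summand 2 makes the length strictly larger than the distance and absorbs additive constants into powers.
  For an infinite distance it has the junk value 2; that event is null.\<close>
definition bond_len :: "'d::finite field \<Rightarrow> 'd bond \<Rightarrow> real" where
  "bond_len a b = 2 + enn2real (bond_dist a b)"

lemma bond_len_ge_2: "2 \<le> bond_len a b"
  by (simp add: bond_len_def)

lemma bond_dist_less_len:
  assumes "bond_dist a b < \<top>" shows "bond_dist a b < ennreal (bond_len a b)"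
  using assms by (cases "bond_dist a b") (auto simp: bond_len_def ennreal_less_iff)

locale ensemble = prob_space P for P :: "'d::finite field measure" +
  assumes sets_P: "sets P = sets Omega" and stationary: "A1 P"
begin

lemma space_P: "space P = {a. unit_field a}"
  using sets_eq_imp_space_eq[OF sets_P] space_Omega by simp

lemma measurable_to_P: "measurable M P = measurable M Omega"
  by (rule measurable_cong_sets[OF refl sets_P])

lemma eval_measurable [measurable]: "(\<lambda>a. a b) \<in> borel_measurable P"
proof -
  have "(\<lambda>a. a b) \<in> measurable Omega (restrict_space borel {0..1})"
    unfolding Omega_def by (rule measurable_component_singleton) simp
  then have "(\<lambda>a. a b) \<in> borel_measurable Omega" by (simp add: measurable_restrict_space2_iff)
  then show ?thesis using measurable_cong_sets[OF sets_P refl] by blast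
qed

lemma shift_measurable [measurable]: "shift z \<in> measurable P P"
  unfolding measurable_to_P
proof (rule measurable_into_Omega)
  show "(\<lambda>a. shift z a b) \<in> borel_measurable P" for b by (cases b) (simp add: shift_apply)
qed (simp add: space_P unit_field_shift)

lemma kill_measurable [measurable]: "(\<lambda>a. kill_bond a b) \<in> measurable P P"
  unfolding measurable_to_P
proof (rule measurable_into_Omega)
  show "(\<lambda>a. kill_bond a b b') \<in> borel_measurable P" for b' by (cases "b = b'") (auto simp: kill_bond_def)
qed (simp add: space_P unit_field_kill)

lemma nn_integral_shift:
  assumes "f \<in> borel_measurable P"
  shows "(\<integral>\<^sup>+a. f (shift z a) \<partial>P) = (\<integral>\<^sup>+a. f a \<partial>P)"
proof -
  have "distr P P (shift z) = P" using stationary by (simp add: A1_def)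
  then show ?thesis using nn_integral_distr[of "shift z" P P f] assms by simp
qed

lemma integral_shift:
  fixes f :: "'d field \<Rightarrow> real"
  assumes "f \<in> borel_measurable P"
  shows "(\<integral>a. f (shift z a) \<partial>P) = (\<integral>a. f a \<partial>P)"
proof -
  have "distr P P (shift z) = P" using stationary by (simp add: A1_def)
  then show ?thesis using integral_distr[of "shift z" P P f] assms by simp
qed

lemma integrable_shift:
  fixes f :: "'d field \<Rightarrow> real"
  assumes "integrable P f"
  shows "integrable P (\<lambda>a. f (shift z a))"
proof -
  have "distr P P (shift z) = P" using stationary by (simp add: A1_def)
  then show ?thesis using integrable_distr_eq[of "shift z" P P f] assms by simp
qed

text \<open>Paths are lists over a countable lattice, so the infimum is a countable one.\<close>

lemma bond_dist_measurable [measurable]: "(\<lambda>a. bond_dist a b) \<in> borel_measurable P"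
proof -
  have [measurable]: "(\<lambda>a. path_cost a xs) \<in> borel_measurable P" for xs
    unfolding path_cost_def by measurable
  have [measurable]: "(\<lambda>a. chem_dist a x y) \<in> borel_measurable P" for x y
    unfolding chem_dist_def by (intro borel_measurable_INF) auto
  show ?thesis unfolding bond_dist_def by (rule measurable_compose[OF kill_measurable]) measurable
qed

lemma bond_len_measurable [measurable]: "(\<lambda>a. bond_len a b) \<in> borel_measurable P"
  unfolding bond_len_def by measurable

lemma corr_measurable [measurable]: "(\<lambda>a. corr l e a x) \<in> borel_measurable P"
proof -
  have "(\<lambda>a. (jump a ^^ k) (corr_rhs e a) x) \<in> borel_measurable P" for k x
  proof (induction k arbitrary: x)
    case 0
    show ?case unfolding corr_rhs_def div_star_def by simp
  next
    case (Suc k)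
    note [measurable] = Suc
    show ?case unfolding funpow.simps o_apply jump_def[of _ "(jump _ ^^ k) _"] by measurable
  qed
  then show ?thesis unfolding corr_def resolvent_def by (intro borel_measurable_suminf borel_measurable_divide) auto
qed

lemma flux_grad_measurable [measurable]: "(\<lambda>a. flux_grad l e a b) \<in> borel_measurable P"
  unfolding flux_grad_def grad_def by measurable

text \<open>Invariance of the measure moves the shift from F to g. This is the counterpart of
  summation by parts for stationary fields, which are not summable in space.\<close>

lemma expectation_div_star:
  fixes g :: "'d field \<Rightarrow> real" and F :: "'d \<Rightarrow> 'd field \<Rightarrow> real"
  assumes [measurable]: "g \<in> borel_measurable P" "\<And>i. F i \<in> borel_measurable P"
    and i1: "\<And>i. integrable P (\<lambda>a. g a * F i a)"
    and i2: "\<And>i. integrable P (\<lambda>a. g (shift (unitv i) a) * F i a)"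
  shows "integrable P (\<lambda>a. g a * (\<Sum>i\<in>UNIV. F i (shift (- unitv i) a) - F i a))"
    and "(\<integral>a. g a * (\<Sum>i\<in>UNIV. F i (shift (- unitv i) a) - F i a) \<partial>P)
      = (\<Sum>i\<in>UNIV. \<integral>a. F i a * (g (shift (unitv i) a) - g a) \<partial>P)"
proof -
  have ss: "shift (unitv i) (shift (- unitv i) a) = a" for i and a :: "'d field"
    by (auto simp: shift_def fun_eq_iff)
  have j: "integrable P (\<lambda>a. g a * F i (shift (- unitv i) a))" for i
    using integrable_shift[OF i2[of i], of "- unitv i"] by (simp add: ss)
  have je: "(\<integral>a. g a * F i (shift (- unitv i) a) \<partial>P) = (\<integral>a. g (shift (unitv i) a) * F i a \<partial>P)" for i
    using integral_shift[of "\<lambda>a. g (shift (unitv i) a) * F i a" "- unitv i"] by (simp add: ss)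
  have e: "g a * (\<Sum>i\<in>UNIV. F i (shift (- unitv i) a) - F i a) = (\<Sum>i\<in>UNIV. g a * F i (shift (- unitv i) a) - g a * F i a)" for a
    by (simp add: sum_distrib_left right_diff_distrib)
  show "integrable P (\<lambda>a. g a * (\<Sum>i\<in>UNIV. F i (shift (- unitv i) a) - F i a))"
    unfolding e by (intro Bochner_Integration.integrable_sum Bochner_Integration.integrable_diff j i1)
  have "(\<integral>a. g a * (\<Sum>i\<in>UNIV. F i (shift (- unitv i) a) - F i a) \<partial>P)
     = (\<Sum>i\<in>UNIV. (\<integral>a. g a * F i (shift (- unitv i) a) \<partial>P) - (\<integral>a. g a * F i a \<partial>P))"
    unfolding e by (simp add: Bochner_Integration.integral_sum j i1)
  also have "\<dots> = (\<Sum>i\<in>UNIV. (\<integral>a. F i a * (g (shift (unitv i) a) - g a) \<partial>P))"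
    unfolding je by (intro sum.cong refl) (simp add: right_diff_distrib mult.commute i1[simplified mult.commute] i2[simplified mult.commute])
  finally show "(\<integral>a. g a * (\<Sum>i\<in>UNIV. F i (shift (- unitv i) a) - F i a) \<partial>P)
      = (\<Sum>i\<in>UNIV. \<integral>a. F i a * (g (shift (unitv i) a) - g a) \<partial>P)" .
qed

lemma subalgebra_others: "subalgebra P (others_alg P b)"
proof -
  have sub: "{(\<lambda>a. a b') -` A \<inter> space P | b' A. b' \<noteq> b \<and> A \<in> sets (borel :: real measure)} \<subseteq> sets P"
    using eval_measurable by (auto simp: measurable_sets)
  have "sets (others_alg P b) = sigma_sets (space P) {(\<lambda>a. a b') -` A \<inter> space P | b' A. b' \<noteq> b \<and> A \<in> sets (borel :: real measure)}"
    unfolding others_alg_def using sub sets.space_closed by (intro sets_measure_of) blast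
  then have "sets (others_alg P b) \<subseteq> sets P" using sets.sigma_sets_subset[OF sub] by simp
  moreover have "space (others_alg P b) = space P"
    unfolding others_alg_def using sub sets.space_closed by (intro space_measure_of) blast
  ultimately show ?thesis by (simp add: subalgebra_def)
qed

lemma eval_others_measurable:
  assumes "b' \<noteq> b" shows "(\<lambda>a. a b') \<in> borel_measurable (others_alg P b)"
proof (rule measurableI)
  fix A :: "real set" assume A: "A \<in> sets borel"
  have sp: "space (others_alg P b) = space P" using subalgebra_others by (simp add: subalgebra_def)
  have sub: "{(\<lambda>a. a b') -` A \<inter> space P | b' A. b' \<noteq> b \<and> A \<in> sets (borel :: real measure)} \<subseteq> Pow (space P)" by auto
  show "(\<lambda>a. a b') -` A \<inter> space (others_alg P b) \<in> sets (others_alg P b)"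
    unfolding sp unfolding others_alg_def sets_measure_of[OF sub]
    by (rule sigma_sets.Basic) (use assms A in blast)
qed simp

text \<open>The removed bond has a constant value, so the modified field depends on the other bonds
  only and competes with the conditional expectation.\<close>

lemma kill_others_measurable: "(\<lambda>a. kill_bond a b) \<in> measurable (others_alg P b) P"
  unfolding measurable_to_P
proof (rule measurable_into_Omega)
  show "(\<lambda>a. kill_bond a b b') \<in> borel_measurable (others_alg P b)" for b'
    using eval_others_measurable[of b' b] by (cases "b' = b") (auto simp: kill_bond_def)
next
  fix a assume "a \<in> space (others_alg P b)"
  then have "a \<in> space P" using subalgebra_others by (simp add: subalgebra_def)
  then show "unit_field (kill_bond a b)" by (simp add: space_P unit_field_kill)
qed

lemma bounded_integrable:
  fixes f :: "'d field \<Rightarrow> real"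
  assumes "f \<in> borel_measurable P" "\<And>a. a \<in> space P \<Longrightarrow> \<bar>f a\<bar> \<le> M"
  shows "integrable P f"
  using assms by (intro integrable_const_bound[of f M] AE_I2) auto

text \<open>The conditional expectation minimises the mean square distance, so it may be replaced
  by the value of the variable after removing the bond.\<close>
lemma cond_exp_le_kill:
  fixes z :: "'d field \<Rightarrow> real"
  assumes zm: "z \<in> borel_measurable P" and zb: "\<And>a. a \<in> space P \<Longrightarrow> \<bar>z a\<bar> \<le> M"
  shows "(\<integral>\<^sup>+a. ennreal ((z a - real_cond_exp P (others_alg P b) z a)\<^sup>2) \<partial>P)
    \<le> (\<integral>\<^sup>+a. ennreal ((z a - z (kill_bond a b))\<^sup>2) \<partial>P)"
proof -
  note [measurable] = zm
  interpret F: finite_measure_subalgebra P "others_alg P b"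
    by unfold_locales (rule subalgebra_others)
  define c where "c = real_cond_exp P (others_alg P b) z"
  define g where "g a = z (kill_bond a b)" for a
  have cF: "c \<in> borel_measurable (others_alg P b)" unfolding c_def by simp
  have gF: "g \<in> borel_measurable (others_alg P b)"
    unfolding g_def by (rule measurable_compose[OF kill_others_measurable zm])
  have [measurable]: "c \<in> borel_measurable P" unfolding c_def by simp
  have [measurable]: "g \<in> borel_measurable P" unfolding g_def by measurable
  have zi: "integrable P z" by (rule bounded_integrable[OF zm zb])
  have gb: "\<bar>g a\<bar> \<le> M" if "a \<in> space P" for a
    using zb[of "kill_bond a b"] that by (simp add: g_def space_P unit_field_kill)
  have cb: "AE a in P. \<bar>c a\<bar> \<le> M"
  proof -
    have "AE a in P. z a \<le> M" "AE a in P. - M \<le> z a"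
      using zb by (auto intro!: AE_I2 simp: abs_le_iff) (metis abs_le_iff minus_le_iff)
    then have "AE a in P. c a \<le> M" "AE a in P. - M \<le> c a"
      unfolding c_def using F.real_cond_exp_le_c[OF zi] F.real_cond_exp_ge_c[OF zi] by auto
    then show ?thesis by eventually_elim (simp add: abs_le_iff)
  qed
  have bi: "integrable P (\<lambda>a. u a * v a)"
    if [measurable]: "u \<in> borel_measurable P" "v \<in> borel_measurable P" and "AE a in P. \<bar>u a\<bar> \<le> A" "AE a in P. \<bar>v a\<bar> \<le> B" for u v and A B :: real
  proof (rule integrable_const_bound[of _ "A * B"])
    show "AE a in P. norm (u a * v a) \<le> A * B" using that(3,4)
    proof eventually_elim
      case (elim a)
      then show ?case unfolding real_norm_def abs_mult using abs_ge_zero[of "u a"] by (intro mult_mono) linarith+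
    qed
  qed measurable
  have zM: "AE a in P. \<bar>z a\<bar> \<le> M" and gM: "AE a in P. \<bar>g a\<bar> \<le> M" using zb gb by (auto intro: AE_I2)
  have cg: "AE a in P. \<bar>c a - g a\<bar> \<le> 2 * M" using cb gM by eventually_elim linarith
  have zc: "AE a in P. \<bar>z a - c a\<bar> \<le> 2 * M" using cb zM by eventually_elim linarith
  have i1: "integrable P (\<lambda>a. (z a - c a)\<^sup>2)" unfolding power2_eq_square by (rule bi[OF _ _ zc zc]) measurable
  have i2: "integrable P (\<lambda>a. (c a - g a)\<^sup>2)" unfolding power2_eq_square by (rule bi[OF _ _ cg cg]) measurable
  have i3: "integrable P (\<lambda>a. (c a - g a) * z a)" by (rule bi[OF _ _ cg zM]) measurable
  have i4: "integrable P (\<lambda>a. (c a - g a) * c a)" by (rule bi[OF _ _ cg cb]) measurable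
  have orth: "(\<integral>a. (c a - g a) * z a \<partial>P) = (\<integral>a. (c a - g a) * c a \<partial>P)"
    using F.real_cond_exp_intg(2)[OF i3 borel_measurable_diff[OF cF gF] zm] by (simp add: c_def)
  have "(\<integral>a. (z a - c a)\<^sup>2 \<partial>P) \<le> (\<integral>a. (z a - c a)\<^sup>2 \<partial>P) + (\<integral>a. (c a - g a)\<^sup>2 \<partial>P)"
    by simp
  also have "\<dots> = (\<integral>a. (z a - c a)\<^sup>2 + (c a - g a)\<^sup>2 + 2 * ((c a - g a) * z a - (c a - g a) * c a) \<partial>P)"
    using i1 i2 i3 i4 orth by simp
  also have "(\<lambda>a. (z a - c a)\<^sup>2 + (c a - g a)\<^sup>2 + 2 * ((c a - g a) * z a - (c a - g a) * c a)) = (\<lambda>a. (z a - g a)\<^sup>2)"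
    by (rule ext) (simp add: power2_eq_square algebra_simps)
  finally have le: "(\<integral>a. (z a - c a)\<^sup>2 \<partial>P) \<le> (\<integral>a. (z a - g a)\<^sup>2 \<partial>P)" .
  have i5: "integrable P (\<lambda>a. (z a - g a)\<^sup>2)"
  proof -
    have ae: "AE a in P. \<bar>z a - g a\<bar> \<le> 2 * M" using gM zM by eventually_elim linarith
    show ?thesis unfolding power2_eq_square by (rule bi[OF _ _ ae ae]) measurable
  qed
  show ?thesis using le i1 i5 unfolding c_def[symmetric] g_def[symmetric]
    by (simp add: nn_integral_eq_integral ennreal_leI)
qed

lemma spectral_gap_kill:
  fixes z :: "'d field \<Rightarrow> real"
  assumes A3: "A3 P \<rho>" and zm: "z \<in> borel_measurable P" and zb: "\<And>a. a \<in> space P \<Longrightarrow> \<bar>z a\<bar> \<le> M"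
  shows "ennreal (\<integral>a. (z a - (\<integral>a'. z a' \<partial>P))\<^sup>2 \<partial>P)
    \<le> ennreal (1 / \<rho>) * (\<integral>\<^sup>+b. (\<integral>\<^sup>+a. ennreal ((z a - z (kill_bond a b))\<^sup>2) \<partial>P) \<partial>count_space UNIV)"
proof -
  have "integrable P (\<lambda>a. (z a)\<^sup>2)"
  proof (rule bounded_integrable[where M="M\<^sup>2"])
    show "\<bar>(z a)\<^sup>2\<bar> \<le> M\<^sup>2" if "a \<in> space P" for a
      using power_mono[OF zb[OF that], of 2] by simp
  qed (use zm in measurable)
  then have "ennreal (\<integral>a. (z a - (\<integral>a'. z a' \<partial>P))\<^sup>2 \<partial>P)
    \<le> ennreal (1 / \<rho>) * (\<integral>\<^sup>+b. (\<integral>\<^sup>+a. ennreal ((z a - real_cond_exp P (others_alg P b) z a)\<^sup>2) \<partial>P) \<partial>count_space UNIV)"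
    using A3 zm unfolding A3_def by blast
  also have "\<dots> \<le> ennreal (1 / \<rho>) * (\<integral>\<^sup>+b. (\<integral>\<^sup>+a. ennreal ((z a - z (kill_bond a b))\<^sup>2) \<partial>P) \<partial>count_space UNIV)"
    by (intro mult_left_mono nn_integral_mono cond_exp_le_kill[OF zm zb]) auto
  finally show ?thesis .
qed

end

section \<open>Elementary inequalities\<close>

lemma abs_power_diff_le:
  fixes x y :: real
  assumes "\<bar>x\<bar> \<le> M" "\<bar>y\<bar> \<le> M"
  shows "\<bar>x ^ Suc k - y ^ Suc k\<bar> \<le> real (Suc k) * \<bar>x - y\<bar> * M ^ k"
proof -
  have M: "0 \<le> M" using assms by linarith
  have "\<bar>\<Sum>i<Suc k. y ^ (Suc k - Suc i) * x ^ i\<bar> \<le> (\<Sum>i<Suc k. M ^ k)"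
  proof (intro order_trans[OF sum_abs] sum_mono)
    fix i assume "i \<in> {..<Suc k}"
    then have "M ^ (Suc k - Suc i) * M ^ i = M ^ k" by (simp flip: power_add)
    moreover have "\<bar>y\<bar> ^ (Suc k - Suc i) * \<bar>x\<bar> ^ i \<le> M ^ (Suc k - Suc i) * M ^ i"
      using assms M by (intro mult_mono power_mono) auto
    ultimately show "\<bar>y ^ (Suc k - Suc i) * x ^ i\<bar> \<le> M ^ k" by (simp add: abs_mult power_abs)
  qed
  then have "\<bar>x - y\<bar> * \<bar>\<Sum>i<Suc k. y ^ (Suc k - Suc i) * x ^ i\<bar> \<le> \<bar>x - y\<bar> * (real (Suc k) * M ^ k)"
    by (intro mult_left_mono) auto
  then show ?thesis unfolding power_diff_sumr2[of x "Suc k" y] abs_mult by (simp add: mult_ac)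
qed

lemma power_mono_product_nonneg:
  fixes s t :: real
  assumes "0 \<le> s" "0 \<le> t" shows "0 \<le> (s - t) * (s ^ n - t ^ n)"
proof (cases "s \<le> t")
  case True
  then have "s ^ n \<le> t ^ n" using assms by (intro power_mono)
  then show ?thesis using True by (intro mult_nonpos_nonpos) auto
next
  case False
  then have "t ^ n \<le> s ^ n" using assms by (intro power_mono) auto
  then show ?thesis using False by simp
qed

text \<open>Twice the right side minus twice the left side factors as (q^2 - p^2) (q^(2n) - p^(2n)),
  whose factors have equal signs.\<close>

lemma odd_power_monotone:
  fixes p q :: real
  shows "(q - p)\<^sup>2 * (p ^ (2 * n) + q ^ (2 * n)) / 2 \<le> (q - p) * (q ^ Suc (2 * n) - p ^ Suc (2 * n))"
proof -
  have "0 \<le> (q\<^sup>2 - p\<^sup>2) * ((q\<^sup>2) ^ n - (p\<^sup>2) ^ n)" by (rule power_mono_product_nonneg) auto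
  then have "0 \<le> (q\<^sup>2 - p\<^sup>2) * (q ^ (2 * n) - p ^ (2 * n))" by (simp add: power_mult)
  also have "\<dots> = 2 * ((q - p) * (q ^ Suc (2 * n) - p ^ Suc (2 * n))) - (q - p)\<^sup>2 * (p ^ (2 * n) + q ^ (2 * n))"
    by (simp add: power2_eq_square algebra_simps)
  finally show ?thesis by simp
qed

lemma even_power_max_le:
  fixes p q :: real
  shows "max \<bar>p\<bar> \<bar>q\<bar> ^ (2 * n) \<le> p ^ (2 * n) + q ^ (2 * n)"
  by (cases "\<bar>p\<bar> \<le> \<bar>q\<bar>") (auto simp: max_def power_even_abs)

text \<open>Pointwise form of testing the corrector equation with an odd power; \<open>t\<close> stands for the constant field.\<close>
lemma flux_odd_power_lower:
  fixes a p q t :: real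
  assumes a: "0 \<le> a" "a \<le> 1" and t: "\<bar>t\<bar> \<le> 1"
  shows "a * (q - p)\<^sup>2 * (p ^ (2 * n) + q ^ (2 * n)) / 4 - (2 * real n + 1)\<^sup>2 * (p ^ (2 * n) + q ^ (2 * n))
    \<le> a * (q - p + t) * (q ^ Suc (2 * n) - p ^ Suc (2 * n))"
proof -
  define W where "W = p ^ (2 * n) + q ^ (2 * n)"
  define k where "k = 2 * real n + 1"
  have W0: "0 \<le> W" by (simp add: W_def)
  have k0: "0 \<le> k" by (simp add: k_def)
  have "\<bar>q ^ Suc (2 * n) - p ^ Suc (2 * n)\<bar> \<le> real (Suc (2 * n)) * \<bar>q - p\<bar> * max \<bar>p\<bar> \<bar>q\<bar> ^ (2 * n)"
    by (rule abs_power_diff_le) auto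
  also have "\<dots> \<le> k * \<bar>q - p\<bar> * W"
    unfolding W_def using even_power_max_le[of p q n] by (intro mult_mono) (auto simp: k_def)
  finally have lip: "\<bar>q ^ Suc (2 * n) - p ^ Suc (2 * n)\<bar> \<le> k * \<bar>q - p\<bar> * W" .
  have "0 \<le> (\<bar>q - p\<bar> / 2 - k)\<^sup>2" by simp
  then have yng: "k * \<bar>q - p\<bar> \<le> (q - p)\<^sup>2 / 4 + k\<^sup>2" by (simp add: power2_eq_square algebra_simps)
  have "\<bar>t * (q ^ Suc (2 * n) - p ^ Suc (2 * n))\<bar> \<le> 1 * (k * \<bar>q - p\<bar> * W)"
    unfolding abs_mult using t lip by (intro mult_mono) auto
  also have "\<dots> \<le> ((q - p)\<^sup>2 / 4 + k\<^sup>2) * W" using mult_right_mono[OF yng W0] by simp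
  finally have tb: "- (((q - p)\<^sup>2 / 4 + k\<^sup>2) * W) \<le> t * (q ^ Suc (2 * n) - p ^ Suc (2 * n))" by linarith
  have "(q - p)\<^sup>2 * W / 2 + - (((q - p)\<^sup>2 / 4 + k\<^sup>2) * W) \<le> (q - p) * (q ^ Suc (2 * n) - p ^ Suc (2 * n)) + t * (q ^ Suc (2 * n) - p ^ Suc (2 * n))"
    using odd_power_monotone[of q p n] tb unfolding W_def by (intro add_mono) auto
  then have "(q - p)\<^sup>2 * W / 4 - k\<^sup>2 * W \<le> (q - p + t) * (q ^ Suc (2 * n) - p ^ Suc (2 * n))"
    by (simp add: algebra_simps)
  then have "a * ((q - p)\<^sup>2 * W / 4 - k\<^sup>2 * W) \<le> a * ((q - p + t) * (q ^ Suc (2 * n) - p ^ Suc (2 * n)))"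
    using a(1) by (rule mult_left_mono)
  moreover have "a * (k\<^sup>2 * W) \<le> k\<^sup>2 * W" using a W0 by (simp add: mult_left_le_one_le)
  ultimately show ?thesis unfolding W_def[symmetric] k_def[symmetric] by (simp add: right_diff_distrib mult.assoc)
qed

text \<open>A crude substitute for Hoelder: the sum is at most E times the largest t, and the power
  of the largest t is at most the sum of the powers.\<close>

lemma sum_mult_power_le:
  fixes p t :: "'a \<Rightarrow> real"
  assumes B: "finite B" and p: "\<And>b. b \<in> B \<Longrightarrow> 0 \<le> p b" and t: "\<And>b. b \<in> B \<Longrightarrow> 0 \<le> t b" and E: "(\<Sum>b\<in>B. p b) \<le> E" and n: "0 < n"
  shows "(\<Sum>b\<in>B. p b * t b) ^ n \<le> E ^ n * (\<Sum>b\<in>B. t b ^ n)"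
proof (cases "B = {}")
  case True
  then show ?thesis using n by (simp add: zero_power)
next
  case False
  have E0: "0 \<le> E" using sum_nonneg[of B p] p E by simp
  obtain c where c: "c \<in> B" "\<And>b. b \<in> B \<Longrightarrow> t b \<le> t c"
  proof -
    have "Max (t ` B) \<in> t ` B" using B False by (intro Max_in) auto
    then obtain c where "c \<in> B" "t c = Max (t ` B)" by auto
    then show thesis using that[of c] B by simp
  qed
  have "(\<Sum>b\<in>B. p b * t b) \<le> (\<Sum>b\<in>B. p b * t c)" using c p by (intro sum_mono mult_left_mono) auto
  also have "\<dots> = (\<Sum>b\<in>B. p b) * t c" by (simp add: sum_distrib_right)
  also have "\<dots> \<le> E * t c" using E t[OF c(1)] by (rule mult_right_mono)
  finally have "(\<Sum>b\<in>B. p b * t b) ^ n \<le> (E * t c) ^ n" using p t by (intro power_mono sum_nonneg) auto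
  also have "\<dots> = E ^ n * t c ^ n" by (rule power_mult_distrib)
  also have "\<dots> \<le> E ^ n * (\<Sum>b\<in>B. t b ^ n)"
    using E0 t B c by (intro mult_left_mono member_le_sum) auto
  finally show ?thesis .
qed

lemma sum_power_le_power_sum:
  fixes s :: "'a \<Rightarrow> real"
  assumes "finite B" "\<And>b. b \<in> B \<Longrightarrow> 0 \<le> s b" "0 < n"
  shows "(\<Sum>b\<in>B. s b ^ n) \<le> (\<Sum>b\<in>B. s b) ^ n"
  using assms
proof (induction B rule: finite_induct)
  case empty then show ?case by simp
next
  case (insert x F)
  have sup: "u ^ n + v ^ n \<le> (u + v) ^ n" if "0 \<le> u" "0 \<le> v" for u v :: real
    using \<open>0 < n\<close>
  proof (induction n rule: nat_induct_non_zero)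
    case (Suc k)
    have "u ^ Suc k + v ^ Suc k \<le> u * (u + v) ^ k + v * (u + v) ^ k"
      using that by (intro add_mono) (auto intro!: mult_left_mono power_mono)
    then show ?case by (simp add: distrib_right)
  qed simp
  have "(\<Sum>b\<in>insert x F. s b ^ n) \<le> s x ^ n + (\<Sum>b\<in>F. s b) ^ n" using insert by simp
  also have "\<dots> \<le> (s x + (\<Sum>b\<in>F. s b)) ^ n" using insert by (intro sup sum_nonneg) auto
  finally show ?case using insert by simp
qed

text \<open>Either s is at most d * u, or u is at most s / d. The first term is the one absorbed
  later, for small d.\<close>

lemma young_split:
  fixes u s d :: real
  assumes "0 \<le> u" "0 \<le> s" "0 < d"
  shows "u ^ k * s \<le> d * u ^ Suc k + s ^ Suc k / d ^ k"
proof (cases "s \<le> d * u")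
  case True
  have "u ^ k * s \<le> u ^ k * (d * u)" using True assms by (intro mult_left_mono) auto
  moreover have "0 \<le> s ^ Suc k / d ^ k" using assms by simp
  ultimately show ?thesis by (simp add: mult_ac)
next
  case False
  have "u \<le> s / d" using False assms by (simp add: field_simps)
  then have "u ^ k * s \<le> (s / d) ^ k * s" using assms by (intro mult_right_mono power_mono) auto
  moreover have "0 \<le> d * u ^ Suc k" using assms by simp
  ultimately show ?thesis by (simp add: power_divide mult_ac)
qed

lemma add_power_le:
  fixes u v :: real
  assumes "0 \<le> u" "0 \<le> v" shows "(u + v) ^ k \<le> 2 ^ k * (u ^ k + v ^ k)"
proof -
  have "(u + v) ^ k \<le> (2 * max u v) ^ k" using assms by (intro power_mono) auto
  also have "\<dots> = 2 ^ k * max u v ^ k" by (rule power_mult_distrib)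
  also have "max u v ^ k \<le> u ^ k + v ^ k" using assms by (cases "u \<le> v") (auto simp: max_def)
  finally show ?thesis by simp
qed

text \<open>A chain rule for powers. The mixed term of order 2k in x and order 2 in the increments
  is split by Young, so that the moment of x appears with the small factor d and the rest is a power
  of the total variation S.\<close>

lemma power_variation_sum_le:
  fixes x d :: real and y :: "'a \<Rightarrow> real"
  assumes B: "finite B" and d: "0 < d"
  defines "S \<equiv> \<Sum>b\<in>B. (x - y b)\<^sup>2"
  shows "(\<Sum>b\<in>B. (x ^ Suc k - y b ^ Suc k)\<^sup>2)
    \<le> (real (Suc k))\<^sup>2 * 4 ^ k * (d * x ^ (2 * Suc k) + (1 + 1 / d ^ k) * S ^ Suc k)"
proof -
  have S0: "0 \<le> S" by (simp add: S_def sum_nonneg)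
  define C where "C = (real (Suc k))\<^sup>2 * 4 ^ k"
  have C0: "0 \<le> C" by (simp add: C_def)
  have pt: "(x ^ Suc k - y b ^ Suc k)\<^sup>2 \<le> C * ((x\<^sup>2) ^ k * (x - y b)\<^sup>2 + ((x - y b)\<^sup>2) ^ Suc k)" for b
  proof -
    define w where "w = x - y b"
    have "\<bar>x ^ Suc k - y b ^ Suc k\<bar> \<le> real (Suc k) * \<bar>w\<bar> * (\<bar>x\<bar> + \<bar>w\<bar>) ^ k"
      unfolding w_def by (rule abs_power_diff_le) auto
    then have "(x ^ Suc k - y b ^ Suc k)\<^sup>2 \<le> (real (Suc k) * \<bar>w\<bar> * (\<bar>x\<bar> + \<bar>w\<bar>) ^ k)\<^sup>2"
      by (subst abs_le_square_iff[symmetric]) (simp add: abs_mult)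
    also have "\<dots> = (real (Suc k))\<^sup>2 * w\<^sup>2 * ((\<bar>x\<bar> + \<bar>w\<bar>)\<^sup>2) ^ k"
      by (simp add: power_mult_distrib flip: power_mult) (simp add: mult.commute)
    finally have 1: "(x ^ Suc k - y b ^ Suc k)\<^sup>2 \<le> (real (Suc k))\<^sup>2 * w\<^sup>2 * ((\<bar>x\<bar> + \<bar>w\<bar>)\<^sup>2) ^ k" .
    have "((\<bar>x\<bar> + \<bar>w\<bar>)\<^sup>2) ^ k \<le> (2 * x\<^sup>2 + 2 * w\<^sup>2) ^ k"
      using sum_squares_bound[of "\<bar>x\<bar>" "\<bar>w\<bar>"] by (intro power_mono) (auto simp: power2_sum)
    also have "\<dots> = 2 ^ k * (x\<^sup>2 + w\<^sup>2) ^ k" by (simp flip: power_mult_distrib add: distrib_left)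
    also have "\<dots> \<le> 2 ^ k * (2 ^ k * ((x\<^sup>2) ^ k + (w\<^sup>2) ^ k))" by (intro mult_left_mono add_power_le) auto
    also have "\<dots> = 4 ^ k * ((x\<^sup>2) ^ k + (w\<^sup>2) ^ k)" by (simp flip: power_mult_distrib mult.assoc)
    finally have 2: "((\<bar>x\<bar> + \<bar>w\<bar>)\<^sup>2) ^ k \<le> 4 ^ k * ((x\<^sup>2) ^ k + (w\<^sup>2) ^ k)" .
    have "(x ^ Suc k - y b ^ Suc k)\<^sup>2 \<le> (real (Suc k))\<^sup>2 * w\<^sup>2 * (4 ^ k * ((x\<^sup>2) ^ k + (w\<^sup>2) ^ k))"
      by (rule order_trans[OF 1 mult_left_mono[OF 2]]) simp
    also have "\<dots> = C * ((x\<^sup>2) ^ k * w\<^sup>2 + (w\<^sup>2) ^ Suc k)" unfolding C_def power_Suc by (simp only: mult_ac distrib_left distrib_right)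
    finally show ?thesis unfolding w_def .
  qed
  have "(\<Sum>b\<in>B. (x ^ Suc k - y b ^ Suc k)\<^sup>2) \<le> (\<Sum>b\<in>B. C * ((x\<^sup>2) ^ k * (x - y b)\<^sup>2 + ((x - y b)\<^sup>2) ^ Suc k))"
    by (intro sum_mono pt)
  also have "\<dots> = C * ((x\<^sup>2) ^ k * S + (\<Sum>b\<in>B. ((x - y b)\<^sup>2) ^ Suc k))"
    by (simp add: S_def sum.distrib sum_distrib_left distrib_left)
  also have "\<dots> \<le> C * ((d * (x\<^sup>2) ^ Suc k + S ^ Suc k / d ^ k) + S ^ Suc k)"
  proof (intro mult_left_mono add_mono C0)
    show "(x\<^sup>2) ^ k * S \<le> d * (x\<^sup>2) ^ Suc k + S ^ Suc k / d ^ k" using S0 d by (intro young_split) auto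
    show "(\<Sum>b\<in>B. ((x - y b)\<^sup>2) ^ Suc k) \<le> S ^ Suc k"
      unfolding S_def by (rule sum_power_le_power_sum[OF B]) auto
  qed
  also have "\<dots> = C * (d * x ^ (2 * Suc k) + (1 + 1 / d ^ k) * S ^ Suc k)"
    by (simp only: power_mult) (simp add: algebra_simps)
  finally show ?thesis by (simp only: C_def)
qed

section \<open>Quenched oscillation estimate\<close>

definition coercivity_const :: "nat \<Rightarrow> nat \<Rightarrow> real \<Rightarrow> real" where
  "coercivity_const d q T = 2 * real d * 3 ^ d * (T powr (1 / real q)) ^ (d + 3)"

text \<open>In a ball of radius R the weighted bound makes all lengths at most h = (T (1 +
  R)^(2d))^(1/q). Comparing gradients with the energy costs h^(d + 3), which a large q turns into a
  small power of R.\<close>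

lemma coercive_bond_len:
  fixes a :: "'d::finite field"
  assumes a: "unit_field a" and fin: "\<And>b. bond_dist a b < \<top>" and q: "64 * CARD('d) * (CARD('d) + 3) \<le> q"
    and T: "1 \<le> T" and len: "\<And>b. wgt (x_b b) * bond_len a b ^ q \<le> T"
  shows "coercive a (coercivity_const CARD('d) q T)"
  unfolding coercive_def
proof (intro allI impI)
  let ?d = "CARD('d)"
  fix v E and R :: nat assume E: "energy_le a v E" and R: "1 \<le> R"
  have q0: "0 < q" using q by (metis le_zero_eq mult_is_0 neq0_conv numeral_neq_zero zero_less_card_finite add_is_0)
  define L where "L = 1 + real R"
  define h where "h = T powr (1 / real q) * L powr (2 * real ?d / real q)"
  have L1: "1 \<le> L" by (simp add: L_def)
  have h1: "1 \<le> h"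
  proof -
    have "1 \<le> T powr (1 / real q)" "1 \<le> L powr (2 * real ?d / real q)" using T L1 by (auto intro: ge_one_powr_ge_zero)
    then show ?thesis unfolding h_def using mult_mono[of 1 _ 1] by fastforce
  qed
  have hq: "h ^ q = T * L ^ (2 * ?d)"
  proof -
    have "h ^ q = (T powr (1 / real q)) ^ q * (L powr (2 * real ?d / real q)) ^ q" by (simp add: h_def power_mult_distrib)
    also have "(T powr (1 / real q)) ^ q = T powr 1" using T q0 by (simp add: powr_powr flip: powr_realpow')
    also have "(L powr (2 * real ?d / real q)) ^ q = L powr real (2 * ?d)" using L1 q0 by (simp add: powr_powr flip: powr_realpow')
    also have "\<dots> = L ^ (2 * ?d)" using L1 by (subst powr_realpow) auto
    finally show ?thesis using T by simp
  qed
  have len_le: "bond_len a (x, i) \<le> h" if x: "x \<in> bll R" for x i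
  proof -
    have "bond_len a (x, i) ^ q \<le> T * (1 + real (nrm x)) ^ (2 * ?d)"
      using len[of "(x, i)"] by (simp add: wgt_def pos_divide_le_eq add_nonneg_pos)
    also have "\<dots> \<le> T * L ^ (2 * ?d)"
      using T x by (intro mult_left_mono power_mono) (auto simp: L_def bll_def)
    also have "\<dots> = h ^ q" by (rule hq[symmetric])
    finally show ?thesis using h1 bond_len_ge_2[of a "(x, i)"] q0 by (subst (asm) power_mono_iff) auto
  qed
  have dist: "chem_dist a x (x + unitv i) < ennreal h" if x: "x \<in> bll R" for x i
  proof -
    have "chem_dist a x (x + unitv i) \<le> bond_dist a (x, i)"
      using chem_dist_kill_le[of a x "x + unitv i" "(x, i)"] unit_fieldD[OF a] by (simp add: bond_dist_def)
    also have "\<dots> < ennreal (bond_len a (x, i))" by (rule bond_dist_less_len[OF fin])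
    also have "\<dots> \<le> ennreal h" by (rule ennreal_leI[OF len_le[OF x]])
    finally show ?thesis .
  qed
  have E0: "0 \<le> E" using E unfolding energy_le_def by (metis finite.emptyI sum.empty)
  have hp: "h ^ (?d + 3) \<le> (T powr (1 / real q)) ^ (?d + 3) * (2 * real R powr (1 / 32))"
  proof -
    have "(L powr (2 * real ?d / real q)) ^ (?d + 3) = L powr (2 * real ?d / real q * real (?d + 3))"
      using L1 by (simp add: powr_powr flip: powr_realpow')
    also have "\<dots> \<le> L powr (1 / 32)"
    proof (rule powr_mono)
      \<comment> \<open>This is where q = 64 d (d + 3) comes from: it makes 2d (d + 3) / q equal to
        1/32.\<close>
      have "real (64 * ?d * (?d + 3)) \<le> real q" using q by (rule of_nat_mono)
      then show "2 * real ?d / real q * real (?d + 3) \<le> 1 / 32" using q0 by (simp add: field_simps)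
    qed (use L1 in auto)
    also have "\<dots> \<le> (2 * real R) powr (1 / 32)" using R by (intro powr_mono2) (auto simp: L_def)
    also have "\<dots> = 2 powr (1 / 32) * real R powr (1 / 32)" by (simp add: powr_mult)
    also have "\<dots> \<le> 2 powr 1 * real R powr (1 / 32)" by (intro mult_right_mono powr_mono) auto
    finally have "(L powr (2 * real ?d / real q)) ^ (?d + 3) \<le> 2 * real R powr (1 / 32)" by simp
    then show ?thesis unfolding h_def power_mult_distrib using T by (intro mult_left_mono) auto
  qed
  have "grad_sum R v \<le> real ?d * (3 * h) ^ ?d * h ^ 3 * E"
    by (rule grad_sum_le_energy[OF a h1 dist E])
  also have "\<dots> = real ?d * 3 ^ ?d * E * h ^ (?d + 3)" by (simp add: power_mult_distrib power_add)
  also have "\<dots> \<le> real ?d * 3 ^ ?d * E * ((T powr (1 / real q)) ^ (?d + 3) * (2 * real R powr (1 / 32)))"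
    using E0 by (intro mult_left_mono hp) auto
  finally show "grad_sum R v \<le> coercivity_const ?d q T * E * real R powr (1 / 32)"
    by (simp add: coercivity_const_def mult_ac)
qed

definition energy_const :: "nat \<Rightarrow> nat \<Rightarrow> real \<Rightarrow> real" where
  "energy_const d q T = green_const d * coercivity_const d q T ^ 3"

definition kill_diff :: "real \<Rightarrow> real^'d \<Rightarrow> 'd::finite field \<Rightarrow> 'd bond \<Rightarrow> real" where
  "kill_diff l e a b = corr l e a 0 - corr l e (kill_bond a b) 0"

text \<open>The scale weight is inserted and divided out again. Together with the Green energy it
  sums to at most E, while the n-th power of its inverse is dominated by the summable
  \<open>wgt\<close>.\<close>

lemma oscillation_power_le:
  fixes a :: "'d::finite field"
  assumes l: "0 < l" and a: "unit_field a" and e: "norm e \<le> 1" and d: "3 \<le> CARD('d)"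
    and fin: "\<And>b. bond_dist a b < \<top>" and q: "64 * CARD('d) * (CARD('d) + 3) \<le> q"
    and T: "1 \<le> T" and len: "\<And>b. wgt (x_b b) * bond_len a b ^ q \<le> T"
    and n: "64 * CARD('d) \<le> n" and B: "finite B"
  shows "(\<Sum>b\<in>B. (kill_diff l e a b)\<^sup>2) ^ n \<le> 2 ^ (68 * CARD('d)) *
    (\<Sum>b\<in>B. wgt (x_b b) * (energy_const CARD('d) q T * (4 * bond_len a b ^ 6) * (flux_grad l e a b)\<^sup>2) ^ n)"
proof -
  let ?d = "CARD('d)"
  define K where "K = coercivity_const ?d q T"
  define E where "E = energy_const ?d q T"
  define p where "p b = a b * (grad (green l a) b)\<^sup>2 * scale_weight (x_b b)" for b
  define Y where "Y b = 4 * bond_len a b ^ 6 * (flux_grad l e a b)\<^sup>2" for b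
  have n0: "0 < n" using n d by linarith
  have K1: "1 \<le> K"
  proof -
    have "1 \<le> T powr (1 / real q)" using T by (simp add: ge_one_powr_ge_zero)
    then have 1: "1 \<le> (T powr (1 / real q)) ^ (?d + 3)" by (rule one_le_power)
    have "1 * 1 \<le> (2 * real ?d) * 3 ^ ?d" using d by (intro mult_mono) auto
    then have "1 * 1 \<le> (2 * real ?d * 3 ^ ?d) * (T powr (1 / real q)) ^ (?d + 3)" using 1 by (intro mult_mono) auto
    then show ?thesis by (simp add: K_def coercivity_const_def)
  qed
  have co: "coercive a K" unfolding K_def by (rule coercive_bond_len[OF a fin q T len])
  have pE: "(\<Sum>b\<in>B. p b) \<le> E"
    unfolding p_def E_def energy_const_def using green_weighted_energy[OF l a d K1 co B] by (simp add: K_def)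
  have sw: "1 \<le> scale_weight (x_b b)" for b :: "'d bond" by (rule scale_weight_ge_1)
  have E0: "0 \<le> E" unfolding E_def energy_const_def using K1 green_const_ge_1[of ?d] d by (simp add: K_def)
  have Y0: "0 \<le> Y b" for b using bond_len_ge_2[of a b] by (simp add: Y_def)
  have p0: "0 \<le> p b" for b using unit_fieldD[OF a] sw[of b] by (simp add: p_def)
  have kd: "(kill_diff l e a b)\<^sup>2 \<le> p b * (Y b / scale_weight (x_b b))" for b
  proof -
    have h: "chem_dist (kill_bond a b) (x_b b) (y_b b) < ennreal (bond_len a b)"
      using bond_dist_less_len[OF fin, of b] by (simp add: bond_dist_def)
    have "(kill_diff l e a b)\<^sup>2 \<le> a b * (grad (green l a) b)\<^sup>2 * ((1 + bond_len a b ^ 3)\<^sup>2 * (flux_grad l e a b)\<^sup>2)"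
      unfolding kill_diff_def by (rule corr_kill_estimate[OF l a e h])
    also have "\<dots> \<le> a b * (grad (green l a) b)\<^sup>2 * Y b"
      unfolding Y_def
    proof (intro mult_left_mono mult_right_mono)
      \<comment> \<open>Lengths above 1 absorb the additive constant of the detour estimate.\<close>
      have "1 \<le> bond_len a b ^ 3" using bond_len_ge_2[of a b] by (intro one_le_power) auto
      then have "(1 + bond_len a b ^ 3)\<^sup>2 \<le> (2 * bond_len a b ^ 3)\<^sup>2" by (intro power_mono) auto
      also have "\<dots> = 4 * bond_len a b ^ 6" by (simp add: power_mult_distrib flip: power_mult)
      finally show "(1 + bond_len a b ^ 3)\<^sup>2 \<le> 4 * bond_len a b ^ 6" .
    qed (use unit_fieldD[OF a] in auto)
    also have "\<dots> = p b * (Y b / scale_weight (x_b b))" using sw[of b] by (simp add: p_def)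
    finally show ?thesis .
  qed
  have "(\<Sum>b\<in>B. (kill_diff l e a b)\<^sup>2) ^ n \<le> (\<Sum>b\<in>B. p b * (Y b / scale_weight (x_b b))) ^ n"
    by (intro power_mono sum_mono kd sum_nonneg) auto
  also have "\<dots> \<le> E ^ n * (\<Sum>b\<in>B. (Y b / scale_weight (x_b b)) ^ n)"
  proof (rule sum_mult_power_le[OF B _ _ pE n0])
    show "0 \<le> Y b / scale_weight (x_b b)" for b using Y0[of b] sw[of b] by simp
  qed (rule p0)
  also have "\<dots> \<le> E ^ n * (\<Sum>b\<in>B. 2 ^ (68 * ?d) * wgt (x_b b) * Y b ^ n)"
  proof (intro mult_left_mono sum_mono)
    fix b
    have "(Y b / scale_weight (x_b b)) ^ n = 1 / scale_weight (x_b b) ^ n * Y b ^ n" by (simp add: power_divide)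
    also have "\<dots> \<le> 2 ^ (68 * ?d) * wgt (x_b b) * Y b ^ n"
      using scale_weight_power_le[OF n, of "x_b b"] Y0[of b] by (intro mult_right_mono) auto
    finally show "(Y b / scale_weight (x_b b)) ^ n \<le> 2 ^ (68 * ?d) * wgt (x_b b) * Y b ^ n" .
  qed (use E0 in simp)
  also have "\<dots> = 2 ^ (68 * ?d) * (\<Sum>b\<in>B. wgt (x_b b) * (E * Y b) ^ n)"
    unfolding sum_distrib_left by (intro sum.cong refl) (simp add: power_mult_distrib mult_ac)
  finally show ?thesis by (simp add: E_def Y_def mult.assoc)
qed

lemma powr_root_power_le:
  assumes "1 \<le> T" "k \<le> q" "0 < q" shows "(T powr (1 / real q)) ^ k \<le> T"
proof -
  have "(T powr (1 / real q)) ^ k \<le> (T powr (1 / real q)) ^ q"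
    using assms by (intro power_increasing) (auto intro: ge_one_powr_ge_zero)
  also have "\<dots> = T" using assms by (simp add: powr_powr flip: powr_realpow')
  finally show ?thesis .
qed

text \<open>For large q every power of the constant that occurs costs a single factor T, so an
  expectation of T is all that is needed.\<close>

lemma energy_const_power_le:
  assumes "1 \<le> d" "1 \<le> T" "3 * (d + 3) * k \<le> q" "0 < q"
  shows "energy_const d q T ^ k \<le> (green_const d * (2 * real d * 3 ^ d) ^ 3) ^ k * T"
proof -
  have "energy_const d q T ^ k = (green_const d * (2 * real d * 3 ^ d) ^ 3) ^ k * (T powr (1 / real q)) ^ (3 * (d + 3) * k)"
  proof -
    have "(g * (c * u ^ (d + 3)) ^ 3) ^ k = (g * c ^ 3) ^ k * u ^ (3 * (d + 3) * k)" for g c u :: real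
    proof -
      have "((u ^ (d + 3)) ^ 3) ^ k = u ^ (3 * (d + 3) * k)" by (simp only: power_mult[symmetric] mult.commute)
      then show ?thesis by (simp only: power_mult_distrib mult.assoc)
    qed
    then show ?thesis by (simp only: energy_const_def coercivity_const_def)
  qed
  also have "\<dots> \<le> (green_const d * (2 * real d * 3 ^ d) ^ 3) ^ k * T"
    using assms green_const_ge_1[of d] by (intro mult_left_mono powr_root_power_le zero_le_power mult_nonneg_nonneg) auto
  finally show ?thesis .
qed

lemma energy_const_nonneg: "1 \<le> d \<Longrightarrow> 0 \<le> energy_const d q T"
  using green_const_ge_1[of d] by (simp add: energy_const_def coercivity_const_def)

section \<open>Moment bounds for the corrector\<close>

lemma sum_bond_wgt_le:
  assumes "finite (B :: 'd::finite bond set)"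
  shows "(\<Sum>b\<in>B. wgt (x_b b)) \<le> real CARD('d) * 4 ^ CARD('d)"
proof -
  have "(\<Sum>b\<in>B. wgt (x_b b)) \<le> (\<Sum>b\<in>fst ` B \<times> (UNIV :: 'd set). wgt (x_b b))"
    using assms by (intro sum_mono2) (auto intro: rev_image_eqI)
  also have "\<dots> = (\<Sum>x\<in>fst ` B. \<Sum>i\<in>(UNIV :: 'd set). wgt x)"
    by (simp only: sum.cartesian_product) (simp add: x_b_def split_beta)
  also have "\<dots> = real CARD('d) * (\<Sum>x\<in>fst ` B. wgt x)" by (simp add: sum_distrib_left)
  also have "\<dots> \<le> real CARD('d) * 4 ^ CARD('d)" using assms by (intro mult_left_mono sum_wgt_le) auto
  finally show ?thesis .
qed

definition closing_const :: "nat \<Rightarrow> real \<Rightarrow> real" where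
  "closing_const k \<rho> = 4 * (16 / \<rho>) ^ Suc k
     + 2 * (((real (Suc k))\<^sup>2 * 4 ^ k / \<rho>) * (1 + (4 * ((real (Suc k))\<^sup>2 * 4 ^ k) / \<rho>) ^ k))"

lemma closing_const_pos: "0 < \<rho> \<Longrightarrow> 0 < closing_const k \<rho>"
  unfolding closing_const_def by (intro add_pos_nonneg mult_pos_pos mult_nonneg_nonneg add_nonneg_nonneg) auto

text \<open>Here \<open>m\<close>, \<open>I\<close> and \<open>v\<close> are the moments of order \<open>2n\<close>, \<open>n\<close> and \<open>2\<close> for \<open>n = Suc k\<close>: the spectral gap bounds \<open>m\<close>
  only up to the square of \<open>I\<close>, which is interpolated between \<open>v\<close> and \<open>m\<close>.\<close>
lemma even_moment_closing:
  fixes m I v z \<rho> :: real and k :: nat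
  assumes \<rho>: "0 < \<rho>" and m: "0 \<le> m" and z: "0 < z" and I: "0 \<le> I"
    and var: "\<And>d. 0 < d \<Longrightarrow> m - I\<^sup>2 \<le> 1 / \<rho> * ((real (Suc k))\<^sup>2 * 4 ^ k * d * m + (real (Suc k))\<^sup>2 * 4 ^ k * (1 + 1 / d ^ k) * z)"
    and v: "\<And>c. 0 < c \<Longrightarrow> v \<le> 1 / \<rho> * (c + 1 / c ^ k * z)"
    and low: "\<And>t \<alpha>. 0 < t \<Longrightarrow> 0 < \<alpha> \<Longrightarrow> I \<le> t ^ Suc k + (\<alpha> * m + v / (t\<^sup>2 * \<alpha>)) / 2"
  shows "m \<le> closing_const k \<rho> * z"
proof (cases "m = 0")
  case True
  then show ?thesis using closing_const_pos[OF \<rho>, of k] z by simp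
next
  case False
  then have m: "0 < m" using m by simp
  \<comment> \<open>Balances the two terms of the bound for v, each of which becomes c.\<close>
  define c where "c = root (Suc k) z"
  have c: "0 < c" "c ^ Suc k = z" using z by (simp_all add: c_def del: power_Suc)
  then have "1 / c ^ k * z = c" by (auto simp: field_simps)
  then have v2: "v \<le> 2 * c / \<rho>" using v[OF c(1)] by simp
  \<comment> \<open>Chosen so that v / t^2 is at most 1 / 8.\<close>
  define t where "t = sqrt (16 * c / \<rho>)"
  have t: "0 < t" "t\<^sup>2 = 16 * c / \<rho>" using c \<rho> by (auto simp: t_def)
  have vt: "v / t\<^sup>2 \<le> 1 / 8" using v2 c \<rho> by (simp add: t(2) field_simps)
  \<comment> \<open>With \<alpha> = 1 / s, both \<open>\<alpha> * m\<close> and the bound for the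
    other term equal s / 8; squaring then leaves only m / 4.\<close>
  define s where "s = sqrt (8 * m)"
  have s: "0 < s" "s\<^sup>2 = 8 * m" using m by (auto simp: s_def)
  have "I \<le> t ^ Suc k + (1 / s * m + v / (t\<^sup>2 * (1 / s))) / 2" using s by (intro low t) auto
  also have "v / (t\<^sup>2 * (1 / s)) = v / t\<^sup>2 * s" by simp
  also have "v / t\<^sup>2 * s \<le> 1 / 8 * s" using vt s by (intro mult_right_mono) auto
  also have "1 / s * m = s / 8" using s by (simp add: field_simps power2_eq_square)
  finally have "I \<le> t ^ Suc k + s / 8" by simp
  then have "I\<^sup>2 \<le> (t ^ Suc k + s / 8)\<^sup>2" using I by (intro power_mono) auto
  also have "\<dots> \<le> 2 * (t ^ Suc k)\<^sup>2 + 2 * (s / 8)\<^sup>2"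
    using sum_squares_bound[of "t ^ Suc k" "s / 8"] by (simp add: power2_sum del: power_Suc)
  also have "(t ^ Suc k)\<^sup>2 = (t\<^sup>2) ^ Suc k" by (metis power_mult mult.commute)
  also have "(t\<^sup>2) ^ Suc k = (16 / \<rho>) ^ Suc k * z"
    unfolding t(2) c(2)[symmetric] by (simp only: power_mult_distrib[symmetric]) simp
  also have "2 * (s / 8)\<^sup>2 = m / 4" by (simp add: power_divide s(2))
  finally have I2: "I\<^sup>2 \<le> 2 * ((16 / \<rho>) ^ Suc k * z) + m / 4" .
  define C where "C = (real (Suc k))\<^sup>2 * 4 ^ k"
  have C: "0 < C" by (simp add: C_def)
  \<comment> \<open>This value of d costs another m / 4, so half of m can be absorbed.\<close>
  have "m - I\<^sup>2 \<le> 1 / \<rho> * (C * (\<rho> / (4 * C)) * m + C * (1 + 1 / (\<rho> / (4 * C)) ^ k) * z)"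
    unfolding C_def using \<rho> by (intro var) (auto simp: add_pos_nonneg)
  also have "\<dots> = m / 4 + (C / \<rho>) * (1 + (4 * C / \<rho>) ^ k) * z"
  proof -
    have "1 / (\<rho> / (4 * C)) ^ k = (4 * C / \<rho>) ^ k" by (simp add: power_divide)
    moreover have "C * (\<rho> / (4 * C)) = \<rho> / 4" using C by simp
    moreover have "1 / \<rho> * (\<rho> / 4 * m + C * X * z) = m / 4 + C / \<rho> * X * z" for X
      using \<rho> by (simp add: field_simps)
    ultimately show ?thesis by (simp only:)
  qed
  finally have "m / 2 \<le> 2 * ((16 / \<rho>) ^ Suc k * z) + (C / \<rho>) * (1 + (4 * C / \<rho>) ^ k) * z"
    using I2 by linarith
  then have "m \<le> 4 * ((16 / \<rho>) ^ Suc k * z) + 2 * ((C / \<rho>) * (1 + (4 * C / \<rho>) ^ k) * z)" by linarith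
  also have "\<dots> = closing_const k \<rho> * z"
    unfolding closing_const_def C_def[symmetric] by (simp only: distrib_right mult.assoc)
  finally show ?thesis .
qed

section \<open>Bounded random variables and the tested corrector equation\<close>

text \<open>The bound is deliberately left unnamed: it depends on \<open>l\<close> and serves
  integrability only.\<close>

definition bdd_rv :: "'a measure \<Rightarrow> ('a \<Rightarrow> real) \<Rightarrow> bool" where
  "bdd_rv M f \<longleftrightarrow> f \<in> borel_measurable M \<and> (\<exists>C. \<forall>a\<in>space M. \<bar>f a\<bar> \<le> C)"

lemma bdd_rvI: "f \<in> borel_measurable M \<Longrightarrow> (\<And>a. a \<in> space M \<Longrightarrow> \<bar>f a\<bar> \<le> C) \<Longrightarrow> bdd_rv M f"
  by (auto simp: bdd_rv_def)

lemma bdd_rv_measurable: "bdd_rv M f \<Longrightarrow> f \<in> borel_measurable M"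
  by (simp add: bdd_rv_def)

lemma bdd_rv_const: "bdd_rv M (\<lambda>_. c)"
  by (rule bdd_rvI[where C="\<bar>c\<bar>"]) auto

lemma bdd_rv_add:
  assumes "bdd_rv M f" "bdd_rv M g" shows "bdd_rv M (\<lambda>a. f a + g a)"
proof -
  obtain C D where "\<forall>a\<in>space M. \<bar>f a\<bar> \<le> C" "\<forall>a\<in>space M. \<bar>g a\<bar> \<le> D" using assms by (auto simp: bdd_rv_def)
  then have "\<bar>f a + g a\<bar> \<le> C + D" if "a \<in> space M" for a
    using that abs_triangle_ineq[of "f a" "g a"] by fastforce
  then show ?thesis using assms by (intro bdd_rvI[where C="C + D"]) (auto simp: bdd_rv_def)
qed

lemma bdd_rv_mult:
  assumes "bdd_rv M f" "bdd_rv M g" shows "bdd_rv M (\<lambda>a. f a * g a)"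
proof -
  obtain C D where CD: "\<forall>a\<in>space M. \<bar>f a\<bar> \<le> C" "\<forall>a\<in>space M. \<bar>g a\<bar> \<le> D" using assms by (auto simp: bdd_rv_def)
  have "\<bar>f a * g a\<bar> \<le> C * D" if "a \<in> space M" for a
  proof -
    have "\<bar>f a\<bar> \<le> C" "\<bar>g a\<bar> \<le> D" using CD that by auto
    then show ?thesis unfolding abs_mult using abs_ge_zero[of "f a"] by (intro mult_mono) linarith+
  qed
  then show ?thesis using assms by (intro bdd_rvI[where C="C * D"]) (auto simp: bdd_rv_def)
qed

lemma bdd_rv_diff:
  assumes "bdd_rv M f" "bdd_rv M g" shows "bdd_rv M (\<lambda>a. f a - g a)"
  using bdd_rv_add[OF assms(1) bdd_rv_mult[OF bdd_rv_const[of M "-1"] assms(2)]] by simp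

lemma bdd_rv_power: "bdd_rv M f \<Longrightarrow> bdd_rv M (\<lambda>a. f a ^ k)"
  by (induction k) (auto intro: bdd_rv_const bdd_rv_mult)

lemma bdd_rv_divide: "bdd_rv M f \<Longrightarrow> bdd_rv M (\<lambda>a. f a / c)"
  using bdd_rv_mult[OF _ bdd_rv_const[of M "1 / c"]] by fastforce

lemma bdd_rv_abs: "bdd_rv M f \<Longrightarrow> bdd_rv M (\<lambda>a. \<bar>f a\<bar>)"
  by (auto simp: bdd_rv_def)

lemmas bdd_rv_intros = bdd_rv_const bdd_rv_add bdd_rv_mult bdd_rv_diff bdd_rv_power bdd_rv_divide bdd_rv_abs

locale corrector_ensemble = ensemble P for P :: "'d::finite field measure" +
  fixes l \<rho> :: real and e :: "real^'d" and Mom :: "nat \<Rightarrow> real"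
  assumes l: "0 < l" and \<rho>: "0 < \<rho>" and e: "norm e = 1" and d: "3 \<le> CARD('d)" and A3: "A3 P \<rho>"
    and mom: "\<And>k b. (\<integral>\<^sup>+a. ennreal (bond_len a b ^ k) \<partial>P) \<le> ennreal (Mom k)" and Mom_nonneg: "\<And>k. 0 \<le> Mom k"
    and finite_dist: "AE a in P. \<forall>b. bond_dist a b < \<top>"
begin

abbreviation "phi a \<equiv> corr l e a 0"

lemma bdd_corr: "bdd_rv P (\<lambda>a. corr l e a x)"
  using corr_bound[OF l, of _ e x] e by (intro bdd_rvI[where C="2 * real CARD('d) / l"]) (auto simp: space_P)

lemma bdd_eval: "bdd_rv P (\<lambda>a. a b)"
proof (rule bdd_rvI[where C=1])
  fix a assume "a \<in> space P"
  then have "unit_field a" by (simp add: space_P)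
  then show "\<bar>a b\<bar> \<le> 1" using unit_fieldD[of a b] by simp
qed simp

lemma bdd_flux: "bdd_rv P (\<lambda>a. flux_grad l e a b)"
  unfolding flux_grad_def grad_def by (intro bdd_rv_intros bdd_corr)

lemma bdd_grad: "bdd_rv P (\<lambda>a. grad (corr l e a) b)"
  unfolding grad_def by (intro bdd_rv_intros bdd_corr)

lemma bdd_integrable:
  assumes "bdd_rv P f" shows "integrable P f"
proof -
  obtain C where "f \<in> borel_measurable P" "\<And>a. a \<in> space P \<Longrightarrow> \<bar>f a\<bar> \<le> C"
    using assms by (auto simp: bdd_rv_def)
  then show ?thesis by (rule bounded_integrable)
qed

lemma corr_stationary: "corr l e a x = phi (shift x a)"
  by (simp add: corr_shift)

text \<open>The equation at the origin, multiplied by g and averaged; differences of g under unit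
  shifts of the environment take the place of spatial gradients.\<close>

lemma corrector_test:
  assumes g: "bdd_rv P g" and gs: "\<And>i. bdd_rv P (\<lambda>a. g (shift (unitv i) a))"
  shows "(\<Sum>i\<in>UNIV. \<integral>a. a (0, i) * flux_grad l e a (0, i) * (g (shift (unitv i) a) - g a) \<partial>P) = - l * (\<integral>a. phi a * g a \<partial>P)"
proof -
  define F where "F i a = a (0, i) * flux_grad l e a (0, i)" for i :: 'd and a
  have Fb: "bdd_rv P (F i)" for i unfolding F_def by (intro bdd_rv_intros bdd_eval bdd_flux)
  have "(\<integral>a. g a * (\<Sum>i\<in>UNIV. F i (shift (- unitv i) a) - F i a) \<partial>P) = (\<Sum>i\<in>UNIV. \<integral>a. F i a * (g (shift (unitv i) a) - g a) \<partial>P)"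
    by (intro expectation_div_star bdd_rv_measurable[OF g] bdd_rv_measurable[OF Fb] bdd_integrable bdd_rv_mult g gs Fb)
  moreover have "g a * (\<Sum>i\<in>UNIV. F i (shift (- unitv i) a) - F i a) = - l * (phi a * g a)" if "a \<in> space P" for a
  proof -
    have "l * phi a + div_star (\<lambda>b. a b * flux_grad l e a b) 0 = 0"
      using that e by (intro corr_eq[OF l]) (auto simp: space_P)
    moreover have "div_star (\<lambda>b. a b * flux_grad l e a b) 0 = (\<Sum>i\<in>UNIV. F i (shift (- unitv i) a) - F i a)"
      by (simp add: div_star_def F_def shift_apply flux_grad_shift)
    ultimately have "(\<Sum>i\<in>UNIV. F i (shift (- unitv i) a) - F i a) = - l * phi a" by simp
    then show ?thesis by simp
  qed
  then have "(\<integral>a. g a * (\<Sum>i\<in>UNIV. F i (shift (- unitv i) a) - F i a) \<partial>P) = (\<integral>a. - l * (phi a * g a) \<partial>P)"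
    by (intro Bochner_Integration.integral_cong) auto
  ultimately show ?thesis by (simp add: F_def)
qed

text \<open>A constant test variable has no gradient, and the mass \<open>l\<close> is
  positive.\<close>

lemma corr_mean_zero: "(\<integral>a. phi a \<partial>P) = 0"
  using corrector_test[of "\<lambda>_. 1"] l by (simp add: bdd_rv_const)

definition even_moment :: "nat \<Rightarrow> real" where
  "even_moment n = (\<integral>a. phi a ^ (2 * n) \<partial>P)"

lemma even_moment_nonneg: "0 \<le> even_moment n"
  unfolding even_moment_def by (intro integral_nonneg_AE) auto

lemma corr_even_moment: "(\<integral>a. corr l e a x ^ (2 * n) \<partial>P) = even_moment n"
  unfolding even_moment_def corr_stationary[of _ x] by (rule integral_shift) measurable

definition weighted_energy :: "nat \<Rightarrow> 'd bond \<Rightarrow> 'd field \<Rightarrow> real" where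
  "weighted_energy n b a = a b * (grad (corr l e a) b)\<^sup>2 * (corr l e a (x_b b) ^ (2 * n) + corr l e a (y_b b) ^ (2 * n))"

lemma bdd_weighted_energy: "bdd_rv P (weighted_energy n b)"
  unfolding weighted_energy_def by (intro bdd_rv_intros bdd_eval bdd_grad bdd_corr)

lemma weighted_energy_nonneg: "a \<in> space P \<Longrightarrow> 0 \<le> weighted_energy n b a"
  by (auto simp: weighted_energy_def space_P unit_fieldD intro!: mult_nonneg_nonneg add_nonneg_nonneg)

text \<open>With the odd power as test variable the mass term is an even power and has the good
  sign. The equation controls only the sum over directions, hence the factor d.\<close>

lemma weighted_energy_origin_le:
  "(\<integral>a. weighted_energy n (0, i) a \<partial>P) \<le> 8 * real CARD('d) * (2 * real n + 1)\<^sup>2 * even_moment n"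
proof -
  define W where "W i a = phi a ^ (2 * n) + corr l e a (unitv i) ^ (2 * n)" for i a
  define k where "k = 2 * real n + 1"
  have Wb: "bdd_rv P (W i)" for i unfolding W_def by (intro bdd_rv_intros bdd_corr)
  have W: "(\<integral>a. W i a \<partial>P) = 2 * even_moment n" for i
    unfolding W_def by (subst Bochner_Integration.integral_add) (auto intro!: bdd_integrable bdd_rv_intros bdd_corr simp: corr_even_moment)
  have lower: "weighted_energy n (0, i) a / 4 - k\<^sup>2 * W i a
      \<le> a (0, i) * flux_grad l e a (0, i) * (phi (shift (unitv i) a) ^ Suc (2 * n) - phi a ^ Suc (2 * n))"
    if "a \<in> space P" for i a
  proof -
    have "unit_field a" using that by (simp add: space_P)
    note u = unit_fieldD[OF this, of "(0, i)"]
    have "\<bar>e_field e (0, i)\<bar> \<le> 1" using e_field_bound[of e] e by simp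
    from flux_odd_power_lower[OF u this, of "corr l e a (unitv i)" "phi a" n] show ?thesis
      by (simp add: weighted_energy_def W_def k_def flux_grad_def grad_pair corr_shift del: power_Suc)
  qed
  have "(\<Sum>i\<in>(UNIV :: 'd set). (\<integral>a. weighted_energy n (0, i) a \<partial>P) / 4 - k\<^sup>2 * (2 * even_moment n))
      = (\<Sum>i\<in>(UNIV :: 'd set). \<integral>a. weighted_energy n (0, i) a / 4 - k\<^sup>2 * W i a \<partial>P)"
    by (intro sum.cong refl, subst Bochner_Integration.integral_diff)
       (auto intro!: bdd_integrable bdd_rv_intros bdd_weighted_energy Wb simp: W)
  also have "\<dots> \<le> (\<Sum>i\<in>(UNIV :: 'd set). \<integral>a. a (0, i) * flux_grad l e a (0, i) * (phi (shift (unitv i) a) ^ Suc (2 * n) - phi a ^ Suc (2 * n)) \<partial>P)"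
  proof (intro sum_mono integral_mono_AE AE_I2 lower)
    fix i :: 'd
    show "integrable P (\<lambda>a. weighted_energy n (0, i) a / 4 - k\<^sup>2 * W i a)"
      by (intro bdd_integrable bdd_rv_intros bdd_weighted_energy Wb)
    show "integrable P (\<lambda>a. a (0, i) * flux_grad l e a (0, i) * (phi (shift (unitv i) a) ^ Suc (2 * n) - phi a ^ Suc (2 * n)))"
      unfolding corr_shift by (intro bdd_integrable bdd_rv_intros bdd_eval bdd_flux bdd_corr)
  qed
  also have "\<dots> = - l * (\<integral>a. phi a * phi a ^ Suc (2 * n) \<partial>P)"
    by (rule corrector_test) (unfold corr_shift, (intro bdd_rv_intros bdd_corr)+)
  also have "\<dots> \<le> 0"
  proof -
    have "0 \<le> phi a * phi a ^ Suc (2 * n)" for a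
    proof -
      have "phi a * phi a ^ Suc (2 * n) = (phi a ^ Suc n)\<^sup>2" by (simp add: power2_eq_square power_add mult_2)
      then show ?thesis by simp
    qed
    then have "0 \<le> (\<integral>a. phi a * phi a ^ Suc (2 * n) \<partial>P)" by (intro integral_nonneg_AE) auto
    then show ?thesis using l by simp
  qed
  finally have "(\<Sum>i\<in>(UNIV :: 'd set). \<integral>a. weighted_energy n (0, i) a \<partial>P) / 4 \<le> real CARD('d) * (k\<^sup>2 * (2 * even_moment n))"
    by (simp add: sum_subtractf sum_divide_distrib)
  moreover have "(\<integral>a. weighted_energy n (0, i) a \<partial>P) \<le> (\<Sum>i\<in>(UNIV :: 'd set). \<integral>a. weighted_energy n (0, i) a \<partial>P)"
    by (rule member_le_sum[where f="\<lambda>i. \<integral>a. weighted_energy n (0, i) a \<partial>P"])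
       (auto intro!: integral_nonneg_AE AE_I2 weighted_energy_nonneg)
  ultimately show ?thesis unfolding k_def[symmetric] by simp
qed

lemma weighted_energy_le:
  "(\<integral>\<^sup>+a. ennreal (weighted_energy n b a) \<partial>P) \<le> ennreal (8 * real CARD('d) * (2 * real n + 1)\<^sup>2 * even_moment n)"
proof -
  obtain x i where b: "b = (x, i)" by (cases b)
  have "weighted_energy n b a = weighted_energy n (0, i) (shift x a)" for a
    by (simp add: weighted_energy_def b shift_apply grad_pair corr_shift add.commute)
  then have "(\<integral>\<^sup>+a. ennreal (weighted_energy n b a) \<partial>P) = (\<integral>\<^sup>+a. ennreal (weighted_energy n (0, i) (shift x a)) \<partial>P)" by simp
  also have "\<dots> = (\<integral>\<^sup>+a. ennreal (weighted_energy n (0, i) a) \<partial>P)"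
    by (rule nn_integral_shift[where f="\<lambda>a. ennreal (weighted_energy n (0, i) a)"])
       (intro measurable_compose[OF bdd_rv_measurable[OF bdd_weighted_energy] measurable_ennreal])
  also have "\<dots> = ennreal (\<integral>a. weighted_energy n (0, i) a \<partial>P)"
    by (intro nn_integral_eq_integral bdd_integrable bdd_weighted_energy AE_I2 weighted_energy_nonneg)
  also have "\<dots> \<le> ennreal (8 * real CARD('d) * (2 * real n + 1)\<^sup>2 * even_moment n)"
    by (intro ennreal_leI weighted_energy_origin_le)
  finally show ?thesis .
qed

lemma weighted_sum_expectation_le:
  fixes f :: "'d bond \<Rightarrow> 'd field \<Rightarrow> ennreal"
  assumes [measurable]: "\<And>b. f b \<in> borel_measurable P" and f: "\<And>b. (\<integral>\<^sup>+a. f b a \<partial>P) \<le> ennreal c" and c: "0 \<le> c"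
  shows "(\<integral>\<^sup>+a. (\<integral>\<^sup>+b. ennreal (wgt (x_b b)) * f b a \<partial>count_space UNIV) \<partial>P) \<le> ennreal (real CARD('d) * 4 ^ CARD('d) * c)"
proof -
  have "(\<integral>\<^sup>+a. (\<integral>\<^sup>+b. ennreal (wgt (x_b b)) * f b a \<partial>count_space UNIV) \<partial>P)
     = (\<integral>\<^sup>+b. (\<integral>\<^sup>+a. ennreal (wgt (x_b b)) * f b a \<partial>P) \<partial>count_space UNIV)"
    by (rule nn_integral_count_space_nn_integral) auto
  also have "\<dots> \<le> ennreal (real CARD('d) * 4 ^ CARD('d) * c)"
  proof (rule nn_integral_count_space_le)
    fix B :: "'d bond set" assume B: "finite B"
    have "(\<Sum>b\<in>B. \<integral>\<^sup>+a. ennreal (wgt (x_b b)) * f b a \<partial>P) \<le> (\<Sum>b\<in>B. ennreal (wgt (x_b b)) * ennreal c)"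
      by (intro sum_mono) (simp add: nn_integral_cmult mult_left_mono f)
    also have "\<dots> = ennreal ((\<Sum>b\<in>B. wgt (x_b b)) * c)"
      using c by (simp add: sum_distrib_right ennreal_mult flip: sum_ennreal)
    also have "\<dots> \<le> ennreal (real CARD('d) * 4 ^ CARD('d) * c)"
      using c by (intro ennreal_leI mult_right_mono sum_bond_wgt_le[OF B])
    finally show "(\<Sum>b\<in>B. \<integral>\<^sup>+a. ennreal (wgt (x_b b)) * f b a \<partial>P) \<le> ennreal (real CARD('d) * 4 ^ CARD('d) * c)" .
  qed
  finally show ?thesis .
qed

text \<open>The interface to the spectral gap: \<psi> is the part to be absorbed, and the weights
  \<open>wgt\<close> turn a moment bound for Z that is uniform over bonds into a finite
  total.\<close>

lemma variance_le:
  fixes z \<psi> :: "'d field \<Rightarrow> real" and Z :: "'d bond \<Rightarrow> 'd field \<Rightarrow> real"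
  assumes z: "bdd_rv P z" and \<psi>: "bdd_rv P \<psi>" "\<And>a. 0 \<le> \<psi> a"
    and [measurable]: "\<And>b. Z b \<in> borel_measurable P" and Z0: "\<And>b a. 0 \<le> Z b a" and c: "0 \<le> c" and z0: "0 \<le> z0"
    and Z: "\<And>b. (\<integral>\<^sup>+a. ennreal (Z b a) \<partial>P) \<le> ennreal z0"
    and le: "AE a in P. \<forall>B. finite B \<longrightarrow> (\<Sum>b\<in>B. (z a - z (kill_bond a b))\<^sup>2) \<le> \<psi> a + c * (\<Sum>b\<in>B. wgt (x_b b) * Z b a)"
  shows "(\<integral>a. (z a - (\<integral>a'. z a' \<partial>P))\<^sup>2 \<partial>P) \<le> 1 / \<rho> * ((\<integral>a. \<psi> a \<partial>P) + c * (real CARD('d) * 4 ^ CARD('d) * z0))"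
proof -
  note [measurable] = bdd_rv_measurable[OF z] bdd_rv_measurable[OF \<psi>(1)]
  obtain M where M: "\<And>a. a \<in> space P \<Longrightarrow> \<bar>z a\<bar> \<le> M" using z by (auto simp: bdd_rv_def)
  define s where "s = (\<integral>a. \<psi> a \<partial>P) + c * (real CARD('d) * 4 ^ CARD('d) * z0)"
  have i0: "0 \<le> (\<integral>a. \<psi> a \<partial>P)" using \<psi>(2) by (intro integral_nonneg_AE) auto
  have s0: "0 \<le> s" using i0 c z0 by (simp add: s_def)
  have "(\<integral>\<^sup>+b. (\<integral>\<^sup>+a. ennreal ((z a - z (kill_bond a b))\<^sup>2) \<partial>P) \<partial>count_space UNIV) \<le> ennreal s"
  proof (rule nn_integral_count_space_le)
    fix B :: "'d bond set" assume B: "finite B"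
    have "(\<Sum>b\<in>B. \<integral>\<^sup>+a. ennreal ((z a - z (kill_bond a b))\<^sup>2) \<partial>P) = (\<integral>\<^sup>+a. (\<Sum>b\<in>B. ennreal ((z a - z (kill_bond a b))\<^sup>2)) \<partial>P)"
      by (rule nn_integral_sum[symmetric]) measurable
    also have "\<dots> \<le> (\<integral>\<^sup>+a. ennreal (\<psi> a) + (\<Sum>b\<in>B. ennreal (c * wgt (x_b b)) * ennreal (Z b a)) \<partial>P)"
    proof (rule nn_integral_mono_AE, use le in eventually_elim)
      fix a assume "\<forall>B. finite B \<longrightarrow> (\<Sum>b\<in>B. (z a - z (kill_bond a b))\<^sup>2) \<le> \<psi> a + c * (\<Sum>b\<in>B. wgt (x_b b) * Z b a)"
      then have "(\<Sum>b\<in>B. (z a - z (kill_bond a b))\<^sup>2) \<le> \<psi> a + (\<Sum>b\<in>B. c * wgt (x_b b) * Z b a)"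
        using B by (simp add: sum_distrib_left mult.assoc)
      then have "ennreal (\<Sum>b\<in>B. (z a - z (kill_bond a b))\<^sup>2) \<le> ennreal (\<psi> a + (\<Sum>b\<in>B. c * wgt (x_b b) * Z b a))"
        by (rule ennreal_leI)
      also have "\<dots> = ennreal (\<psi> a) + (\<Sum>b\<in>B. ennreal (c * wgt (x_b b)) * ennreal (Z b a))"
        using \<psi>(2) Z0 c by (simp add: ennreal_plus sum_nonneg ennreal_mult flip: sum_ennreal)
      finally show "(\<Sum>b\<in>B. ennreal ((z a - z (kill_bond a b))\<^sup>2)) \<le> ennreal (\<psi> a) + (\<Sum>b\<in>B. ennreal (c * wgt (x_b b)) * ennreal (Z b a))"
        by (simp add: sum_ennreal)
    qed
    also have "\<dots> = (\<integral>\<^sup>+a. ennreal (\<psi> a) \<partial>P) + (\<Sum>b\<in>B. ennreal (c * wgt (x_b b)) * (\<integral>\<^sup>+a. ennreal (Z b a) \<partial>P))"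
      by (subst nn_integral_add) (auto simp: nn_integral_sum nn_integral_cmult)
    also have "\<dots> \<le> ennreal (\<integral>a. \<psi> a \<partial>P) + (\<Sum>b\<in>B. ennreal (c * wgt (x_b b)) * ennreal z0)"
      using \<psi> by (intro add_mono sum_mono mult_left_mono Z) (auto simp: nn_integral_eq_integral bdd_integrable)
    also have "\<dots> = ennreal ((\<integral>a. \<psi> a \<partial>P) + c * ((\<Sum>b\<in>B. wgt (x_b b)) * z0))"
    proof -
      have "(\<Sum>b\<in>B. ennreal (c * wgt (x_b b)) * ennreal z0) = (\<Sum>b\<in>B. ennreal (c * wgt (x_b b) * z0))"
        using c z0 by (intro sum.cong refl) (simp add: ennreal_mult)
      also have "\<dots> = ennreal (\<Sum>b\<in>B. c * wgt (x_b b) * z0)" using c z0 by (intro sum_ennreal) simp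
      also have "(\<Sum>b\<in>B. c * wgt (x_b b) * z0) = c * ((\<Sum>b\<in>B. wgt (x_b b)) * z0)"
        by (simp add: sum_distrib_left sum_distrib_right mult.assoc)
      finally show ?thesis using i0 c z0 by (simp add: ennreal_plus sum_nonneg)
    qed
    also have "\<dots> \<le> ennreal s" unfolding s_def
      using c z0 by (intro ennreal_leI add_left_mono mult_left_mono mult_right_mono sum_bond_wgt_le[OF B])
    finally show "(\<Sum>b\<in>B. \<integral>\<^sup>+a. ennreal ((z a - z (kill_bond a b))\<^sup>2) \<partial>P) \<le> ennreal s" .
  qed
  then have "ennreal (1 / \<rho>) * (\<integral>\<^sup>+b. (\<integral>\<^sup>+a. ennreal ((z a - z (kill_bond a b))\<^sup>2) \<partial>P) \<partial>count_space UNIV) \<le> ennreal (1 / \<rho>) * ennreal s"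
    by (intro mult_left_mono) auto
  with spectral_gap_kill[OF A3 bdd_rv_measurable[OF z], of M] M
  have "ennreal (\<integral>a. (z a - (\<integral>a'. z a' \<partial>P))\<^sup>2 \<partial>P) \<le> ennreal (1 / \<rho>) * ennreal s" by (meson order_trans)
  also have "\<dots> = ennreal (1 / \<rho> * s)" using \<rho> s0 by (intro ennreal_mult[symmetric]) auto
  finally show ?thesis unfolding s_def[symmetric] using \<rho> s0 by (subst (asm) ennreal_le_iff) auto
qed

end

definition bond_count :: "nat \<Rightarrow> real" where
  "bond_count d = real d * 4 ^ d"

definition flux_const :: "nat \<Rightarrow> (nat \<Rightarrow> real) \<Rightarrow> nat \<Rightarrow> real" where
  "flux_const d Mom n = 2 ^ Suc (2 * n) * (Mom ((2 * n + 3 + 4 * d) * Suc (2 * n))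
     + 4 ^ n * (bond_count d * (8 * real d * (2 * real n + 1)\<^sup>2)) + 1)"

text \<open>Large enough for two purposes: the lengths in a ball of radius \<open>R\<close> lose at most \<open>R^(1/32)\<close> in coercivity, and
  every power of the quenched energy constant that occurs is dominated by \<open>len_bound\<close>, which is integrable.\<close>
definition len_exponent :: "nat \<Rightarrow> nat \<Rightarrow> nat" where
  "len_exponent d n = 64 * d * (d + 3) * (n * Suc (2 * n))"

definition amplitude_const :: "nat \<Rightarrow> (nat \<Rightarrow> real) \<Rightarrow> nat \<Rightarrow> real" where
  "amplitude_const d Mom n = (green_const d * (2 * real d * 3 ^ d) ^ 3) ^ (2 * (n * Suc (2 * n)))
       * (1 + bond_count d * Mom (len_exponent d n))
     + 16 ^ (n * Suc (2 * n)) * Mom (12 * (n * Suc (2 * n)))"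

definition moment_const :: "nat \<Rightarrow> (nat \<Rightarrow> real) \<Rightarrow> real \<Rightarrow> nat \<Rightarrow> real" where
  "moment_const d Mom \<rho> n = (let B = closing_const (n - 1) \<rho> * (2 ^ (68 * d) * bond_count d)
     in 1 + 2 * B * (amplitude_const d Mom n / (1 / (2 * B * flux_const d Mom n)) ^ (2 * n)))"

text \<open>Separates dependent random factors pointwise, at the price of a doubled order.\<close>

lemma square_exchange_power_le:
  fixes x y :: real shows "(x * y) ^ N \<le> x ^ (2 * N) + y ^ (2 * N)"
proof -
  have "2 * (x ^ N * y ^ N) \<le> (x ^ N)\<^sup>2 + (y ^ N)\<^sup>2" using sum_squares_bound[of "x ^ N" "y ^ N"] by simp
  moreover have "0 \<le> (x ^ N)\<^sup>2 + (y ^ N)\<^sup>2" by simp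
  ultimately have "x ^ N * y ^ N \<le> (x ^ N)\<^sup>2 + (y ^ N)\<^sup>2" by linarith
  then show ?thesis by (simp add: power_mult_distrib mult.commute[of 2] power_mult)
qed

context corrector_ensemble
begin

lemma count_sum_measurable:
  fixes f :: "'d bond \<Rightarrow> 'd field \<Rightarrow> ennreal"
  assumes f: "\<And>b. f b \<in> borel_measurable P"
  shows "(\<lambda>a. \<integral>\<^sup>+b. f b a \<partial>count_space UNIV) \<in> borel_measurable P"
proof -
  interpret C: sigma_finite_measure "count_space (UNIV :: 'd bond set)"
    by (rule sigma_finite_measure_count_space_countable) simp
  have "(\<lambda>p. f (snd p) (fst p)) \<in> borel_measurable (P \<Otimes>\<^sub>M count_space UNIV)"
    by (rule measurable_compose_countable'[where I=UNIV and g=snd and f="\<lambda>b p. f b (fst p)"])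
       (auto intro: measurable_compose[OF measurable_fst f])
  then show ?thesis by (intro C.borel_measurable_nn_integral) (simp add: split_beta')
qed

lemma flux_const_pos: "0 < flux_const CARD('d) Mom n"
  unfolding flux_const_def bond_count_def using Mom_nonneg by (intro mult_pos_pos add_nonneg_pos add_nonneg_nonneg) auto

text \<open>A path inside the environment leads to a bond b that carries a share of the gradient. Of
  its 2n + 2 powers, two form the energy density and 2n are bounded by corrector values at the ends
  of b. Only 2n + 1 powers are kept; the last one pays for the powers of the length.\<close>

lemma grad_power_le:
  assumes a: "unit_field a" and fin: "\<And>b. bond_dist a b < \<top>"
  obtains b where "\<bar>grad (corr l e a) (0, i)\<bar> ^ Suc (2 * n)
    \<le> bond_len a (0, i) ^ ((2 * n + 3 + 4 * CARD('d)) * Suc (2 * n)) + 4 ^ n * (wgt (x_b b) * weighted_energy n b a)"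
proof -
  let ?u = "corr l e a" and ?h = "bond_len a (0, i)"
  have h2: "2 \<le> ?h" by (rule bond_len_ge_2)
  have "chem_dist a 0 (unitv i) \<le> bond_dist a (0, i)"
    using chem_dist_kill_le[of a 0 "unitv i" "(0, i)"] unit_fieldD[OF a] by (simp add: bond_dist_def)
  also have "\<dots> < ennreal ?h" by (rule bond_dist_less_len[OF fin])
  finally have dist: "chem_dist a 0 (unitv i) < ennreal ?h" .
  have u01: "0 \<le> a b \<and> a b \<le> 1" for b using unit_fieldD[OF a] by blast
  have ne: "0 \<noteq> (unitv i :: int^'d)" by (metis unitv_nonzero)
  obtain b where b: "real (nrm (x_b b - 0)) \<le> ?h" "1 \<le> ?h * a b" "\<bar>?u (unitv i) - ?u 0\<bar> \<le> ?h * \<bar>grad ?u b\<bar>"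
    using chem_dist_witness[where a=a and u="?u", OF u01 dist ne] by metis
  define y where "y = \<bar>grad ?u (0, i)\<bar>"
  define y' where "y' = \<bar>grad ?u b\<bar>"
  define G where "G = ?h ^ (2 * n + 3 + 4 * CARD('d))"
  define V where "V = 4 ^ n * (wgt (x_b b) * weighted_energy n b a)"
  have y: "0 \<le> y" "y \<le> ?h * y'" using b(3) by (auto simp: y_def y'_def grad_pair)
  have W: "y' ^ (2 * n) \<le> 4 ^ n * (?u (x_b b) ^ (2 * n) + ?u (y_b b) ^ (2 * n))"
  proof -
    have "y' \<le> \<bar>?u (x_b b)\<bar> + \<bar>?u (y_b b)\<bar>" by (simp add: y'_def grad_def)
    then have "y' ^ (2 * n) \<le> (\<bar>?u (x_b b)\<bar> + \<bar>?u (y_b b)\<bar>) ^ (2 * n)" by (intro power_mono) (auto simp: y'_def)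
    also have "\<dots> \<le> 2 ^ (2 * n) * (\<bar>?u (x_b b)\<bar> ^ (2 * n) + \<bar>?u (y_b b)\<bar> ^ (2 * n))" by (rule add_power_le) auto
    finally show ?thesis by (simp add: power_mult power_even_abs)
  qed
  have e0: "0 \<le> weighted_energy n b a" using a by (intro weighted_energy_nonneg) (simp add: space_P)
  have V0: "0 \<le> V" using e0 by (simp add: V_def)
  \<comment> \<open>The bond b depends on the environment but lies within distance h, so more powers
    of h buy the weight that allows summing over all candidates.\<close>
  have w: "1 \<le> ?h ^ (4 * CARD('d)) * wgt (x_b b)"
  proof -
    have "1 + real (nrm (x_b b)) \<le> ?h * ?h" 
    proof -
      have "2 * ?h \<le> ?h * ?h" using h2 by (intro mult_right_mono) auto
      moreover have "real (nrm (x_b b)) \<le> ?h" using b(1) by simp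
      ultimately show ?thesis using h2 by linarith
    qed
    then have "(1 + real (nrm (x_b b))) ^ (2 * CARD('d)) \<le> (?h * ?h) ^ (2 * CARD('d))" by (intro power_mono) auto
    also have "\<dots> = ?h ^ (4 * CARD('d))" by (simp flip: power2_eq_square power_mult)
    finally show ?thesis by (simp add: wgt_def le_divide_eq add_nonneg_pos)
  qed
  have "y ^ (2 * n + 2) \<le> (?h * y') ^ (2 * n + 2)" using y by (intro power_mono)
  also have "\<dots> = ?h ^ (2 * n + 2) * (1 * y'\<^sup>2 * y' ^ (2 * n))" by (simp add: power_mult_distrib power_add power2_eq_square)
  also have "\<dots> \<le> ?h ^ (2 * n + 2) * ((?h * a b) * y'\<^sup>2 * (4 ^ n * (?u (x_b b) ^ (2 * n) + ?u (y_b b) ^ (2 * n))))"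
    using b(2) h2 by (intro mult_left_mono mult_mono W mult_right_mono) (auto simp: y'_def)
  also have "\<dots> = ?h ^ (2 * n + 3) * (4 ^ n * (1 * weighted_energy n b a))"
    by (simp add: weighted_energy_def y'_def power_add eval_nat_numeral)
  also have "\<dots> \<le> ?h ^ (2 * n + 3) * (4 ^ n * ((?h ^ (4 * CARD('d)) * wgt (x_b b)) * weighted_energy n b a))"
    using w e0 h2 by (intro mult_left_mono mult_right_mono) auto
  also have "\<dots> = G * V" by (simp add: G_def V_def power_add)
  finally have yG: "y ^ Suc (2 * n) * y \<le> V * G" by (simp add: mult.commute)
  have G0: "0 < G" using h2 by (simp add: G_def)
  \<comment> \<open>From y^(2n + 2) \<le> V * G: either y is at most G, or dividing by y > G leaves
    V.\<close>
  have "y ^ Suc (2 * n) \<le> G ^ Suc (2 * n) + V"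
  proof (cases "y \<le> G")
    case True
    then have "y ^ Suc (2 * n) \<le> G ^ Suc (2 * n)" using y by (intro power_mono)
    then show ?thesis using V0 by linarith
  next
    case False
    have "y ^ Suc (2 * n) * G \<le> y ^ Suc (2 * n) * y" using False y by (intro mult_left_mono zero_le_power) auto
    then have "y ^ Suc (2 * n) * G \<le> V * G" using yG by linarith
    then have "y ^ Suc (2 * n) \<le> V" using G0 by (simp only: mult_le_cancel_right_pos)
    moreover have "0 \<le> G ^ Suc (2 * n)" using G0 by (intro zero_le_power) auto
    ultimately show ?thesis by linarith
  qed
  then show thesis by (intro that[of b]) (simp only: y_def G_def V_def power_mult)
qed

lemma grad_moment_le:
  "(\<integral>\<^sup>+a. ennreal (\<bar>grad (corr l e a) (0, i)\<bar> ^ Suc (2 * n)) \<partial>P)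
    \<le> ennreal (Mom ((2 * n + 3 + 4 * CARD('d)) * Suc (2 * n)) + 4 ^ n * (bond_count CARD('d) * (8 * real CARD('d) * (2 * real n + 1)\<^sup>2 * even_moment n)))"
proof -
  let ?s = "(2 * n + 3 + 4 * CARD('d)) * Suc (2 * n)"
  let ?C = "8 * real CARD('d) * (2 * real n + 1)\<^sup>2 * even_moment n"
  define V where "V a = (\<integral>\<^sup>+b. ennreal (wgt (x_b b)) * ennreal (weighted_energy n b a) \<partial>count_space UNIV)" for a
  have [measurable]: "(\<lambda>a. weighted_energy n b a) \<in> borel_measurable P" for b
    by (rule bdd_rv_measurable[OF bdd_weighted_energy])
  have [measurable]: "V \<in> borel_measurable P"
    unfolding V_def by (rule count_sum_measurable) measurable
  have C0: "0 \<le> ?C" using even_moment_nonneg by simp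
  have "(\<integral>\<^sup>+a. ennreal (\<bar>grad (corr l e a) (0, i)\<bar> ^ Suc (2 * n)) \<partial>P)
     \<le> (\<integral>\<^sup>+a. ennreal (bond_len a (0, i) ^ ?s) + ennreal (4 ^ n) * V a \<partial>P)"
  proof (rule nn_integral_mono_AE, use finite_dist AE_space in eventually_elim)
    fix a assume fin: "\<forall>b. bond_dist a b < \<top>" and a: "a \<in> space P"
    have u: "unit_field a" using a by (simp add: space_P)
    obtain b where b: "\<bar>grad (corr l e a) (0, i)\<bar> ^ Suc (2 * n)
      \<le> bond_len a (0, i) ^ ?s + 4 ^ n * (wgt (x_b b) * weighted_energy n b a)"
      using grad_power_le[OF u, of i n] fin by metis
    have e0: "0 \<le> weighted_energy n b a" by (rule weighted_energy_nonneg[OF a])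
    have h0: "0 \<le> bond_len a (0, i) ^ ?s" using bond_len_ge_2[of a "(0, i)"] by (intro zero_le_power) simp
    have "ennreal (\<bar>grad (corr l e a) (0, i)\<bar> ^ Suc (2 * n)) \<le> ennreal (bond_len a (0, i) ^ ?s + 4 ^ n * (wgt (x_b b) * weighted_energy n b a))"
      by (rule ennreal_leI[OF b])
    also have "\<dots> = ennreal (bond_len a (0, i) ^ ?s) + ennreal (4 ^ n) * (ennreal (wgt (x_b b)) * ennreal (weighted_energy n b a))"
      using e0 h0 by (subst ennreal_plus) (auto simp: ennreal_mult)
    \<comment> \<open>The random bond is replaced by the weighted sum over all bonds, whose
      expectation is accessible.\<close>
    also have "ennreal (wgt (x_b b)) * ennreal (weighted_energy n b a) \<le> V a"
      using le_nn_integral_count_space[of "{b}" "\<lambda>b. ennreal (wgt (x_b b)) * ennreal (weighted_energy n b a)"] by (simp add: V_def)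
    finally show "ennreal (\<bar>grad (corr l e a) (0, i)\<bar> ^ Suc (2 * n)) \<le> ennreal (bond_len a (0, i) ^ ?s) + ennreal (4 ^ n) * V a"
      by (simp add: add_left_mono mult_left_mono)
  qed
  also have "\<dots> = (\<integral>\<^sup>+a. ennreal (bond_len a (0, i) ^ ?s) \<partial>P) + ennreal (4 ^ n) * (\<integral>\<^sup>+a. V a \<partial>P)"
    by (subst nn_integral_add) (auto simp: nn_integral_cmult)
  also have "\<dots> \<le> ennreal (Mom ?s) + ennreal (4 ^ n) * ennreal (bond_count CARD('d) * ?C)"
    unfolding V_def bond_count_def
    by (intro add_mono mom mult_left_mono weighted_sum_expectation_le weighted_energy_le C0) auto
  also have "\<dots> = ennreal (Mom ?s + 4 ^ n * (bond_count CARD('d) * ?C))"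
    using Mom_nonneg C0 by (simp add: ennreal_plus ennreal_mult bond_count_def)
  finally show ?thesis .
qed

lemma flux_moment_le:
  "(\<integral>\<^sup>+a. ennreal (\<bar>flux_grad l e a b\<bar> ^ Suc (2 * n)) \<partial>P) \<le> ennreal (flux_const CARD('d) Mom n * (1 + even_moment n))"
proof -
  obtain x i where b: "b = (x, i)" by (cases b)
  let ?s = "(2 * n + 3 + 4 * CARD('d)) * Suc (2 * n)"
  let ?c = "bond_count CARD('d) * (8 * real CARD('d) * (2 * real n + 1)\<^sup>2)"
  let ?g = "\<lambda>a. \<bar>grad (corr l e a) (0, i)\<bar> ^ Suc (2 * n)"
  have [measurable]: "(\<lambda>a. grad (corr l e a) (0, i)) \<in> borel_measurable P" by (rule bdd_rv_measurable[OF bdd_grad])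
  have m0: "0 \<le> even_moment n" by (rule even_moment_nonneg)
  have c0: "0 \<le> ?c" by (simp add: bond_count_def)
  have "(\<integral>\<^sup>+a. ennreal (\<bar>flux_grad l e a b\<bar> ^ Suc (2 * n)) \<partial>P) = (\<integral>\<^sup>+a. ennreal (\<bar>flux_grad l e (shift x a) (0, i)\<bar> ^ Suc (2 * n)) \<partial>P)"
    by (simp only: b flux_grad_shift add_0)
  also have "\<dots> = (\<integral>\<^sup>+a. ennreal (\<bar>flux_grad l e a (0, i)\<bar> ^ Suc (2 * n)) \<partial>P)"
    by (rule nn_integral_shift[where f="\<lambda>a. ennreal (\<bar>flux_grad l e a (0, i)\<bar> ^ Suc (2 * n))"]) measurable
  also have "\<dots> \<le> (\<integral>\<^sup>+a. ennreal (2 ^ Suc (2 * n)) * (ennreal (?g a) + 1) \<partial>P)"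
  proof (rule nn_integral_mono)
    fix a
    have "\<bar>flux_grad l e a (0, i)\<bar> \<le> \<bar>grad (corr l e a) (0, i)\<bar> + 1"
      using e_field_bound[of e "(0, i)"] e unfolding flux_grad_def by linarith
    then have "\<bar>flux_grad l e a (0, i)\<bar> ^ Suc (2 * n) \<le> (\<bar>grad (corr l e a) (0, i)\<bar> + 1) ^ Suc (2 * n)"
      by (intro power_mono) auto
    also have "\<dots> \<le> 2 ^ Suc (2 * n) * (?g a + 1 ^ Suc (2 * n))" by (rule add_power_le) auto
    finally have "ennreal (\<bar>flux_grad l e a (0, i)\<bar> ^ Suc (2 * n)) \<le> ennreal (2 ^ Suc (2 * n) * (?g a + 1))"
      by (intro ennreal_leI) simp
    also have "\<dots> = ennreal (2 ^ Suc (2 * n)) * (ennreal (?g a) + 1)"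
      by (subst ennreal_mult) (auto simp: ennreal_plus)
    finally show "ennreal (\<bar>flux_grad l e a (0, i)\<bar> ^ Suc (2 * n)) \<le> ennreal (2 ^ Suc (2 * n)) * (ennreal (?g a) + 1)" .
  qed
  also have "\<dots> = ennreal (2 ^ Suc (2 * n)) * ((\<integral>\<^sup>+a. ennreal (?g a) \<partial>P) + 1)"
    by (subst nn_integral_cmult, measurable, subst nn_integral_add) (auto simp: emeasure_space_1)
  also have "\<dots> \<le> ennreal (2 ^ Suc (2 * n)) * (ennreal (Mom ?s + 4 ^ n * (bond_count CARD('d) * (8 * real CARD('d) * (2 * real n + 1)\<^sup>2 * even_moment n))) + 1)"
    by (intro mult_left_mono add_right_mono grad_moment_le) auto
  also have "\<dots> = ennreal (2 ^ Suc (2 * n) * (Mom ?s + 4 ^ n * ?c * even_moment n + 1))"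
  proof -
    have e: "4 ^ n * (bond_count CARD('d) * (8 * real CARD('d) * (2 * real n + 1)\<^sup>2 * even_moment n)) = 4 ^ n * ?c * even_moment n"
      by simp
    have p: "0 \<le> Mom ?s + 4 ^ n * ?c * even_moment n"
      by (intro add_nonneg_nonneg mult_nonneg_nonneg Mom_nonneg c0 m0) simp
    have "ennreal (Mom ?s + 4 ^ n * ?c * even_moment n) + 1 = ennreal (Mom ?s + 4 ^ n * ?c * even_moment n + 1)"
      using ennreal_plus[OF p, of 1] by simp
    then show ?thesis unfolding e using p by (subst ennreal_mult) auto
  qed
  also have "\<dots> \<le> ennreal (flux_const CARD('d) Mom n * (1 + even_moment n))"
  proof (rule ennreal_leI)
    have "Mom ?s + 4 ^ n * ?c * even_moment n + 1 \<le> (Mom ?s + 4 ^ n * ?c + 1) * (1 + even_moment n)"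
      using Mom_nonneg[of ?s] c0 m0 by (simp add: distrib_left distrib_right)
    then have "2 ^ Suc (2 * n) * (Mom ?s + 4 ^ n * ?c * even_moment n + 1) \<le> 2 ^ Suc (2 * n) * ((Mom ?s + 4 ^ n * ?c + 1) * (1 + even_moment n))"
      by (rule mult_left_mono) simp
    then show "2 ^ Suc (2 * n) * (Mom ?s + 4 ^ n * ?c * even_moment n + 1) \<le> flux_const CARD('d) Mom n * (1 + even_moment n)"
      unfolding flux_const_def by (simp only: mult.assoc)
  qed
  finally show ?thesis .
qed

section \<open>The random constant of the quenched estimate\<close>

text \<open>Dominates the weighted length of every bond at once and still has finite expectation,
  unlike an unweighted supremum in general.\<close>

definition len_sum :: "nat \<Rightarrow> 'd field \<Rightarrow> ennreal" where
  "len_sum q a = (\<integral>\<^sup>+b. ennreal (wgt (x_b b)) * ennreal (bond_len a b ^ q) \<partial>count_space UNIV)"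

lemma len_sum_measurable [measurable]: "len_sum q \<in> borel_measurable P"
  unfolding len_sum_def by (rule count_sum_measurable) measurable

lemma len_sum_expectation: "(\<integral>\<^sup>+a. len_sum q a \<partial>P) \<le> ennreal (bond_count CARD('d) * Mom q)"
  unfolding len_sum_def bond_count_def by (intro weighted_sum_expectation_le mom Mom_nonneg) auto

lemma len_sum_finite: "AE a in P. len_sum q a < \<top>"
proof -
  have "(\<integral>\<^sup>+a. len_sum q a \<partial>P) \<noteq> \<infinity>" using len_sum_expectation[of q] by (auto simp: top_unique)
  then show ?thesis using nn_integral_PInf_AE[of "len_sum q" P] by (auto simp: less_top)
qed

text \<open>An infinite sum yields the default value 1; this happens on a null event only. The
  summand 1 provides the lower bound required of T.\<close>

definition len_bound :: "nat \<Rightarrow> 'd field \<Rightarrow> real" where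
  "len_bound q a = 1 + enn2real (len_sum q a)"

lemma len_bound_measurable [measurable]: "len_bound q \<in> borel_measurable P"
  unfolding len_bound_def by measurable

lemma len_bound_ge_1: "1 \<le> len_bound q a"
  by (simp add: len_bound_def)

lemma len_bound:
  assumes "len_sum q a < \<top>" shows "wgt (x_b b) * bond_len a b ^ q \<le> len_bound q a"
proof -
  have h0: "0 \<le> bond_len a b ^ q" using bond_len_ge_2[of a b] by (intro zero_le_power) simp
  have "ennreal (wgt (x_b b) * bond_len a b ^ q) = ennreal (wgt (x_b b)) * ennreal (bond_len a b ^ q)"
    using h0 by (simp add: ennreal_mult)
  also have "\<dots> \<le> len_sum q a"
    using le_nn_integral_count_space[of "{b}" "\<lambda>b. ennreal (wgt (x_b b)) * ennreal (bond_len a b ^ q)"] by (simp add: len_sum_def)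
  also have "\<dots> = ennreal (enn2real (len_sum q a))" using assms by simp
  finally show ?thesis by (simp add: len_bound_def)
qed

lemma len_bound_expectation: "(\<integral>\<^sup>+a. ennreal (len_bound q a) \<partial>P) \<le> ennreal (1 + bond_count CARD('d) * Mom q)"
proof -
  have "(\<integral>\<^sup>+a. ennreal (len_bound q a) \<partial>P) \<le> (\<integral>\<^sup>+a. 1 + len_sum q a \<partial>P)"
  proof (rule nn_integral_mono_AE, use len_sum_finite[of q] in eventually_elim)
    fix a assume "len_sum q a < \<top>"
    then show "ennreal (len_bound q a) \<le> 1 + len_sum q a" by (simp add: len_bound_def ennreal_plus)
  qed
  also have "\<dots> = 1 + (\<integral>\<^sup>+a. len_sum q a \<partial>P)" by (subst nn_integral_add) (auto simp: emeasure_space_1)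
  also have "\<dots> \<le> 1 + ennreal (bond_count CARD('d) * Mom q)" by (intro add_left_mono len_sum_expectation)
  also have "\<dots> = ennreal (1 + bond_count CARD('d) * Mom q)"
    using Mom_nonneg[of q] by (simp add: ennreal_plus bond_count_def)
  finally show ?thesis .
qed

text \<open>The random factor that multiplies the gradient power of order 2n in the oscillation
  estimate.\<close>

definition amplitude :: "nat \<Rightarrow> 'd bond \<Rightarrow> 'd field \<Rightarrow> real" where
  "amplitude n b a = (energy_const CARD('d) (len_exponent CARD('d) n) (len_bound (len_exponent CARD('d) n) a) * (4 * bond_len a b ^ 6)) ^ n"

lemma amplitude_measurable [measurable]: "amplitude n b \<in> borel_measurable P"
  unfolding amplitude_def energy_const_def coercivity_const_def by measurable

lemma amplitude_nonneg: "0 \<le> amplitude n b a"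
  using energy_const_nonneg[of "CARD('d)"] d bond_len_ge_2[of a b] unfolding amplitude_def
  by (intro zero_le_power mult_nonneg_nonneg) auto

lemma amplitude_moment_le:
  assumes n: "1 \<le> n"
  shows "(\<integral>\<^sup>+a. ennreal (amplitude n b a ^ Suc (2 * n)) \<partial>P) \<le> ennreal (amplitude_const CARD('d) Mom n)"
proof -
  let ?d = "CARD('d)"
  let ?N = "n * Suc (2 * n)" and ?q = "len_exponent CARD('d) n"
  let ?c = "(green_const ?d * (2 * real ?d * 3 ^ ?d) ^ 3) ^ (2 * ?N)"
  have q: "3 * (?d + 3) * (2 * ?N) \<le> ?q" "0 < ?q"
  proof -
    have "6 * ((?d + 3) * ?N) \<le> (64 * ?d) * ((?d + 3) * ?N)" using d by (intro mult_right_mono) auto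
    then show "3 * (?d + 3) * (2 * ?N) \<le> ?q" by (simp add: len_exponent_def algebra_simps)
    show "0 < ?q" using n by (simp add: len_exponent_def)
  qed
  have c0: "0 \<le> ?c" using green_const_ge_1[of ?d] d by (intro zero_le_power mult_nonneg_nonneg) auto
  have pt: "amplitude n b a ^ Suc (2 * n) \<le> ?c * len_bound ?q a + 16 ^ ?N * bond_len a b ^ (12 * ?N)" for a
  proof -
    let ?E = "energy_const ?d ?q (len_bound ?q a)"
    have "amplitude n b a ^ Suc (2 * n) = (?E * (4 * bond_len a b ^ 6)) ^ ?N"
      unfolding amplitude_def by (simp only: power_mult)
    also have "\<dots> \<le> ?E ^ (2 * ?N) + (4 * bond_len a b ^ 6) ^ (2 * ?N)" by (rule square_exchange_power_le)
    also have "?E ^ (2 * ?N) \<le> ?c * len_bound ?q a"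
      using d q by (intro energy_const_power_le len_bound_ge_1) auto
    also have "(4 * bond_len a b ^ 6) ^ (2 * ?N) = 16 ^ ?N * bond_len a b ^ (12 * ?N)"
    proof -
      have "(4 * bond_len a b ^ 6) ^ (2 * ?N) = ((4 * bond_len a b ^ 6)\<^sup>2) ^ ?N" by (rule power_mult)
      also have "(4 * bond_len a b ^ 6)\<^sup>2 = 16 * bond_len a b ^ 12" by (simp add: power_mult_distrib flip: power_mult)
      finally show ?thesis by (simp only: power_mult_distrib power_mult)
    qed
    finally show ?thesis by simp
  qed
  have "(\<integral>\<^sup>+a. ennreal (amplitude n b a ^ Suc (2 * n)) \<partial>P)
     \<le> (\<integral>\<^sup>+a. ennreal ?c * ennreal (len_bound ?q a) + ennreal (16 ^ ?N) * ennreal (bond_len a b ^ (12 * ?N)) \<partial>P)"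
  proof (rule nn_integral_mono)
    fix a
    have 1: "0 \<le> len_bound ?q a" using len_bound_ge_1[of ?q a] by linarith
    have 2: "0 \<le> bond_len a b ^ (12 * ?N)" using bond_len_ge_2[of a b] by (intro zero_le_power) simp
    have "ennreal (amplitude n b a ^ Suc (2 * n)) \<le> ennreal (?c * len_bound ?q a + 16 ^ ?N * bond_len a b ^ (12 * ?N))"
      by (rule ennreal_leI[OF pt])
    also have "\<dots> = ennreal (?c * len_bound ?q a) + ennreal (16 ^ ?N * bond_len a b ^ (12 * ?N))"
      by (rule ennreal_plus) (intro mult_nonneg_nonneg c0 1 2; simp)+
    also have "\<dots> = ennreal ?c * ennreal (len_bound ?q a) + ennreal (16 ^ ?N) * ennreal (bond_len a b ^ (12 * ?N))"
      using ennreal_mult[OF c0 1] ennreal_mult[OF _ 2, of "16 ^ ?N"] by simp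
    finally show "ennreal (amplitude n b a ^ Suc (2 * n)) \<le> ennreal ?c * ennreal (len_bound ?q a) + ennreal (16 ^ ?N) * ennreal (bond_len a b ^ (12 * ?N))" .
  qed
  also have "\<dots> = ennreal ?c * (\<integral>\<^sup>+a. ennreal (len_bound ?q a) \<partial>P) + ennreal (16 ^ ?N) * (\<integral>\<^sup>+a. ennreal (bond_len a b ^ (12 * ?N)) \<partial>P)"
    by (subst nn_integral_add) (auto simp: nn_integral_cmult)
  also have "\<dots> \<le> ennreal ?c * ennreal (1 + bond_count ?d * Mom ?q) + ennreal (16 ^ ?N) * ennreal (Mom (12 * ?N))"
    by (intro add_mono mult_left_mono len_bound_expectation mom) auto
  also have "\<dots> = ennreal (?c * (1 + bond_count ?d * Mom ?q) + 16 ^ ?N * Mom (12 * ?N))"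
  proof -
    have 1: "0 \<le> 1 + bond_count ?d * Mom ?q" using Mom_nonneg[of ?q] by (simp add: bond_count_def)
    have 2: "0 \<le> Mom (12 * ?N)" by (rule Mom_nonneg)
    have "ennreal (?c * (1 + bond_count ?d * Mom ?q) + 16 ^ ?N * Mom (12 * ?N)) = ennreal (?c * (1 + bond_count ?d * Mom ?q)) + ennreal (16 ^ ?N * Mom (12 * ?N))"
      by (rule ennreal_plus) (intro mult_nonneg_nonneg c0 1 2; simp)+
    then show ?thesis using ennreal_mult[OF c0 1] ennreal_mult[OF _ 2, of "16 ^ ?N"] by simp
  qed
  also have "\<dots> = ennreal (amplitude_const ?d Mom n)" by (simp only: amplitude_const_def)
  finally show ?thesis .
qed

lemma amplitude_const_nonneg: "0 \<le> amplitude_const CARD('d) Mom n"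
  unfolding amplitude_const_def bond_count_def using green_const_ge_1[of "CARD('d)"] d Mom_nonneg
  by (intro add_nonneg_nonneg mult_nonneg_nonneg zero_le_power) auto

text \<open>The second spare power at work: Young trades order 2n for order 2n + 1 of the gradient
  with a free small factor s, and the amplitude enters through its moment of order 2n + 1.\<close>

lemma sensitivity_moment_le:
  assumes n: "1 \<le> n" and s: "0 < s"
  shows "(\<integral>\<^sup>+a. ennreal (amplitude n b a * flux_grad l e a b ^ (2 * n)) \<partial>P)
    \<le> ennreal (s * (flux_const CARD('d) Mom n * (1 + even_moment n)) + amplitude_const CARD('d) Mom n / s ^ (2 * n))"
proof -
  let ?X = "\<lambda>a. \<bar>flux_grad l e a b\<bar> ^ Suc (2 * n)" and ?A = "\<lambda>a. amplitude n b a ^ Suc (2 * n)"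
  have "(\<integral>\<^sup>+a. ennreal (amplitude n b a * flux_grad l e a b ^ (2 * n)) \<partial>P)
     \<le> (\<integral>\<^sup>+a. ennreal s * ennreal (?X a) + ennreal (1 / s ^ (2 * n)) * ennreal (?A a) \<partial>P)"
  proof (rule nn_integral_mono)
    fix a
    have 2: "0 \<le> ?A a" using amplitude_nonneg[of n b a] by (rule zero_le_power)
    have "amplitude n b a * flux_grad l e a b ^ (2 * n) = \<bar>flux_grad l e a b\<bar> ^ (2 * n) * amplitude n b a"
      by (simp add: power_even_abs)
    also have "\<dots> \<le> s * ?X a + ?A a / s ^ (2 * n)" using s amplitude_nonneg[of n b a] by (intro young_split) auto
    finally have "ennreal (amplitude n b a * flux_grad l e a b ^ (2 * n)) \<le> ennreal (s * ?X a + 1 / s ^ (2 * n) * ?A a)"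
      by (intro ennreal_leI) simp
    also have "\<dots> = ennreal (s * ?X a) + ennreal (1 / s ^ (2 * n) * ?A a)"
      using s 2 by (intro ennreal_plus mult_nonneg_nonneg) auto
    also have "\<dots> = ennreal s * ennreal (?X a) + ennreal (1 / s ^ (2 * n)) * ennreal (?A a)"
      using ennreal_mult[of s "?X a"] ennreal_mult[OF _ 2, of "1 / s ^ (2 * n)"] s by simp
    finally show "ennreal (amplitude n b a * flux_grad l e a b ^ (2 * n)) \<le> ennreal s * ennreal (?X a) + ennreal (1 / s ^ (2 * n)) * ennreal (?A a)" .
  qed
  also have "\<dots> = ennreal s * (\<integral>\<^sup>+a. ennreal (?X a) \<partial>P) + ennreal (1 / s ^ (2 * n)) * (\<integral>\<^sup>+a. ennreal (?A a) \<partial>P)"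
    by (subst nn_integral_add) (auto simp: nn_integral_cmult simp del: power_Suc)
  also have "\<dots> \<le> ennreal s * ennreal (flux_const CARD('d) Mom n * (1 + even_moment n)) + ennreal (1 / s ^ (2 * n)) * ennreal (amplitude_const CARD('d) Mom n)"
    by (intro add_mono mult_left_mono flux_moment_le amplitude_moment_le n) auto
  also have "\<dots> = ennreal (s * (flux_const CARD('d) Mom n * (1 + even_moment n)) + amplitude_const CARD('d) Mom n / s ^ (2 * n))"
    using s flux_const_pos[of n] even_moment_nonneg[of n] amplitude_const_nonneg[of n]
    by (simp add: ennreal_plus flip: ennreal_mult)
  finally show ?thesis .
qed

theorem even_moment_le:
  assumes n: "64 * CARD('d) \<le> n" "even n"
  shows "even_moment n \<le> moment_const CARD('d) Mom \<rho> n"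
proof -
  let ?d = "CARD('d)" and ?q = "len_exponent CARD('d) n"
  define k where "k = n - 1"
  have n1: "1 \<le> n" using n d by linarith
  then have nk: "n = Suc k" by (simp add: k_def)
  define m where "m = even_moment n"
  define I where "I = (\<integral>a. phi a ^ n \<partial>P)"
  define v where "v = (\<integral>a. (phi a)\<^sup>2 \<partial>P)"
  define Z where "Z b a = amplitude n b a * flux_grad l e a b ^ (2 * n)" for b a
  define C2 where "C2 = flux_const ?d Mom n"
  define C3 where "C3 = amplitude_const ?d Mom n"
  define c4 where "c4 = (2::real) ^ (68 * ?d)"
  define B where "B = closing_const k \<rho> * (c4 * bond_count ?d)"
  \<comment> \<open>Makes the contribution B * s * C2 * (1 + m) equal to half of 1 + m.\<close>
  define s where "s = 1 / (2 * B * C2)"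
  define z0 where "z0 = s * (C2 * (1 + m)) + C3 / s ^ (2 * n)"
  define z where "z = c4 * (bond_count ?d * z0)"
  have m0: "0 \<le> m" unfolding m_def by (rule even_moment_nonneg)
  have C2: "0 < C2" unfolding C2_def by (rule flux_const_pos)
  have C3: "0 \<le> C3" unfolding C3_def by (rule amplitude_const_nonneg)
  have bc: "0 < bond_count ?d" by (simp add: bond_count_def)
  have B: "0 < B" unfolding B_def using closing_const_pos[OF \<rho>] bc by (simp add: c4_def)
  have s: "0 < s" using B C2 by (simp add: s_def)
  have z0: "0 < z0" unfolding z0_def using s C2 C3 m0 by (intro add_pos_nonneg) auto
  have z: "0 < z" unfolding z_def using z0 bc by (simp add: c4_def)
  have Zm [measurable]: "Z b \<in> borel_measurable P" for b unfolding Z_def by measurable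
  have Zn: "0 \<le> Z b a" for b a unfolding Z_def using amplitude_nonneg by simp
  have Zi: "(\<integral>\<^sup>+a. ennreal (Z b a) \<partial>P) \<le> ennreal z0" for b
    unfolding Z_def z0_def C2_def C3_def m_def by (rule sensitivity_moment_le[OF n1 s])
  have osc: "AE a in P. \<forall>A. finite A \<longrightarrow> (\<Sum>b\<in>A. (phi a - phi (kill_bond a b))\<^sup>2) ^ n \<le> c4 * (\<Sum>b\<in>A. wgt (x_b b) * Z b a)"
    using finite_dist len_sum_finite[of ?q] AE_space
  proof eventually_elim
    case (elim a)
    show ?case
    proof (intro allI impI)
      fix A :: "'d bond set" assume A: "finite A"
      have q: "64 * ?d * (?d + 3) \<le> ?q"
        unfolding len_exponent_def using n1 mult_le_mono2[of 1 "n * Suc (2 * n)" "64 * ?d * (?d + 3)"] by simp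
      have "(\<Sum>b\<in>A. (kill_diff l e a b)\<^sup>2) ^ n \<le> 2 ^ (68 * ?d) *
        (\<Sum>b\<in>A. wgt (x_b b) * (energy_const ?d ?q (len_bound ?q a) * (4 * bond_len a b ^ 6) * (flux_grad l e a b)\<^sup>2) ^ n)"
        using elim e by (intro oscillation_power_le[OF l _ _ d _ q len_bound_ge_1 len_bound n(1) A]) (auto simp: space_P)
      then show "(\<Sum>b\<in>A. (phi a - phi (kill_bond a b))\<^sup>2) ^ n \<le> c4 * (\<Sum>b\<in>A. wgt (x_b b) * Z b a)"
        by (simp add: kill_diff_def c4_def Z_def amplitude_def power_mult_distrib power_mult)
    qed
  qed
  have "m \<le> closing_const k \<rho> * z"
  proof (rule even_moment_closing[OF \<rho> m0 z, where I=I and v=v])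
    show "0 \<le> I" unfolding I_def using n(2) by (intro integral_nonneg_AE) (simp add: zero_le_even_power)
  next
    \<comment> \<open>Spectral gap for the n-th power of the corrector.\<close>
    fix \<delta> :: real assume \<delta>: "0 < \<delta>"
    let ?C = "(real (Suc k))\<^sup>2 * 4 ^ k"
    have "(\<integral>a. (phi a ^ n - I)\<^sup>2 \<partial>P) \<le> 1 / \<rho> * ((\<integral>a. ?C * \<delta> * phi a ^ (2 * n) \<partial>P) + (?C * (1 + 1 / \<delta> ^ k) * c4) * (real ?d * 4 ^ ?d * z0))"
      unfolding I_def
    proof (rule variance_le[OF _ _ _ Zm Zn _ _ Zi])
      show "bdd_rv P (\<lambda>a. phi a ^ n)" "bdd_rv P (\<lambda>a. ?C * \<delta> * phi a ^ (2 * n))" by (intro bdd_rv_intros bdd_corr)+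
      show "0 \<le> ?C * \<delta> * phi a ^ (2 * n)" for a using \<delta> by simp
      show "0 \<le> ?C * (1 + 1 / \<delta> ^ k) * c4" using \<delta> by (simp add: c4_def)
      show "0 \<le> z0" using z0 by simp
      show "AE a in P. \<forall>A. finite A \<longrightarrow> (\<Sum>b\<in>A. (phi a ^ n - phi (kill_bond a b) ^ n)\<^sup>2)
          \<le> ?C * \<delta> * phi a ^ (2 * n) + ?C * (1 + 1 / \<delta> ^ k) * c4 * (\<Sum>b\<in>A. wgt (x_b b) * Z b a)"
        using osc
      proof eventually_elim
        case (elim a)
        show ?case
        proof (intro allI impI)
          fix A :: "'d bond set" assume A: "finite A"
          have gen: "C * (x * p + y * (u * w)) = C * x * p + C * y * u * w" for C x p y u w :: real
            by (simp add: algebra_simps)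
          have "(\<Sum>b\<in>A. (phi a ^ n - phi (kill_bond a b) ^ n)\<^sup>2)
            \<le> ?C * (\<delta> * phi a ^ (2 * n) + (1 + 1 / \<delta> ^ k) * (\<Sum>b\<in>A. (phi a - phi (kill_bond a b))\<^sup>2) ^ n)"
            unfolding nk by (rule power_variation_sum_le[OF A \<delta>])
          also have "\<dots> \<le> ?C * (\<delta> * phi a ^ (2 * n) + (1 + 1 / \<delta> ^ k) * (c4 * (\<Sum>b\<in>A. wgt (x_b b) * Z b a)))"
            using elim A \<delta> by (intro mult_left_mono add_left_mono) auto
          finally show "(\<Sum>b\<in>A. (phi a ^ n - phi (kill_bond a b) ^ n)\<^sup>2)
            \<le> ?C * \<delta> * phi a ^ (2 * n) + ?C * (1 + 1 / \<delta> ^ k) * c4 * (\<Sum>b\<in>A. wgt (x_b b) * Z b a)"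
            unfolding gen .
        qed
      qed
    qed
    moreover have "(\<integral>a. (phi a ^ n - I)\<^sup>2 \<partial>P) = m - I\<^sup>2"
    proof -
      have "(\<integral>a. (phi a ^ n - I)\<^sup>2 \<partial>P) = (\<integral>a. (phi a ^ n)\<^sup>2 \<partial>P) - I\<^sup>2"
        unfolding I_def by (intro variance_eq bdd_integrable bdd_rv_intros bdd_corr)
      then show ?thesis by (simp add: m_def even_moment_def mult.commute flip: power_mult)
    qed
    moreover have "(\<integral>a. ?C * \<delta> * phi a ^ (2 * n) \<partial>P) = ?C * \<delta> * m" by (simp add: m_def even_moment_def)
    ultimately show "m - I\<^sup>2 \<le> 1 / \<rho> * (?C * \<delta> * m + ?C * (1 + 1 / \<delta> ^ k) * z)"
      by (simp only: z_def bond_count_def mult.assoc)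
  next
    \<comment> \<open>Spectral gap for the corrector itself, whose mean is zero.\<close>
    fix c :: real assume c: "0 < c"
    have "(\<integral>a. (phi a - (\<integral>a'. phi a' \<partial>P))\<^sup>2 \<partial>P) \<le> 1 / \<rho> * ((\<integral>a. c \<partial>P) + (1 / c ^ k * c4) * (real ?d * 4 ^ ?d * z0))"
    proof (rule variance_le[OF _ _ _ Zm Zn _ _ Zi])
      show "bdd_rv P phi" "bdd_rv P (\<lambda>_. c)" by (intro bdd_rv_intros bdd_corr)+
      show "0 \<le> c" "0 \<le> 1 / c ^ k * c4" using c by (auto simp: c4_def)
      show "0 \<le> z0" using z0 by simp
      show "AE a in P. \<forall>A. finite A \<longrightarrow> (\<Sum>b\<in>A. (phi a - phi (kill_bond a b))\<^sup>2)
          \<le> c + 1 / c ^ k * c4 * (\<Sum>b\<in>A. wgt (x_b b) * Z b a)"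
        using osc
      proof eventually_elim
        case (elim a)
        show ?case
        proof (intro allI impI)
          fix A :: "'d bond set" assume A: "finite A"
          let ?S = "\<Sum>b\<in>A. (phi a - phi (kill_bond a b))\<^sup>2"
          \<comment> \<open>Young with u = 1 replaces the variation by its n-th power, the only
            quantity for which a quenched bound is available.\<close>
          have "1 ^ k * ?S \<le> c * 1 ^ Suc k + ?S ^ Suc k / c ^ k"
            using c by (intro young_split sum_nonneg) auto
          also have "?S ^ Suc k / c ^ k \<le> (c4 * (\<Sum>b\<in>A. wgt (x_b b) * Z b a)) / c ^ k"
            using elim A c unfolding nk by (intro divide_right_mono) auto
          finally show "?S \<le> c + 1 / c ^ k * c4 * (\<Sum>b\<in>A. wgt (x_b b) * Z b a)" by simp
        qed
      qed
    qed
    then show "v \<le> 1 / \<rho> * (c + 1 / c ^ k * z)"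
      unfolding corr_mean_zero by (simp add: v_def z_def bond_count_def prob_space)
  next
    fix t \<alpha> :: real assume t: "0 < t" and \<alpha>: "0 < \<alpha>"
    \<comment> \<open>Above the level t one may insert |phi| / t, and Young splits the product into
      orders 2n and 2.\<close>
    have pt: "phi a ^ n \<le> t ^ n + (\<alpha> * phi a ^ (2 * n) + (phi a)\<^sup>2 / (t\<^sup>2 * \<alpha>)) / 2" for a
    proof -
      define f where "f = \<bar>phi a\<bar>"
      have f0: "0 \<le> f" by (simp add: f_def)
      have fe: "phi a ^ n = f ^ n" using n(2) by (simp add: f_def power_even_abs)
      have "0 \<le> (\<alpha> * f ^ n - f / t)\<^sup>2 / \<alpha>" using \<alpha> by simp
      also have "\<dots> = \<alpha> * (f ^ n)\<^sup>2 - 2 * (f ^ n * f / t) + f\<^sup>2 / (t\<^sup>2 * \<alpha>)"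
        using \<alpha> t by (simp add: power2_eq_square field_simps)
      finally have am: "f ^ n * f / t \<le> (\<alpha> * (f ^ n)\<^sup>2 + f\<^sup>2 / (t\<^sup>2 * \<alpha>)) / 2" by simp
      have "f ^ n \<le> t ^ n + f ^ n * f / t"
      proof (cases "f \<le> t")
        case True
        then have "f ^ n \<le> t ^ n" using f0 by (intro power_mono)
        moreover have "0 \<le> f ^ n * f / t" using f0 t by simp
        ultimately show ?thesis by linarith
      next
        case False
        then have "f ^ n * 1 \<le> f ^ n * (f / t)" using f0 t by (intro mult_left_mono) auto
        then show ?thesis using t by (simp add: add_increasing)
      qed
      also note am
      finally have "f ^ n \<le> t ^ n + (\<alpha> * (f ^ n)\<^sup>2 + f\<^sup>2 / (t\<^sup>2 * \<alpha>)) / 2" by simp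
      moreover have "(f ^ n)\<^sup>2 = phi a ^ (2 * n)" unfolding fe[symmetric] by (simp add: mult.commute flip: power_mult)
      moreover have "f\<^sup>2 = (phi a)\<^sup>2" by (simp add: f_def)
      ultimately show ?thesis unfolding fe by simp
    qed
    have "I \<le> (\<integral>a. t ^ n + (\<alpha> * phi a ^ (2 * n) + (phi a)\<^sup>2 / (t\<^sup>2 * \<alpha>)) / 2 \<partial>P)"
      unfolding I_def by (intro integral_mono pt bdd_integrable bdd_rv_intros bdd_corr)
    also have "\<dots> = t ^ n + (\<alpha> * m + v / (t\<^sup>2 * \<alpha>)) / 2"
    proof -
      have i: "integrable P (\<lambda>a. phi a ^ (2 * n))" "integrable P (\<lambda>a. (phi a)\<^sup>2)"
        by (intro bdd_integrable bdd_rv_intros bdd_corr)+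
      then show ?thesis by (simp add: m_def v_def even_moment_def prob_space)
    qed
    finally show "I \<le> t ^ Suc k + (\<alpha> * m + v / (t\<^sup>2 * \<alpha>)) / 2" by (simp only: nk)
  qed
  also have "\<dots> = B * z0" by (simp add: B_def z_def mult.assoc)
  also have "\<dots> = (1 + m) / 2 + B * (C3 / s ^ (2 * n))"
    using B C2 by (simp add: z0_def s_def distrib_left)
  finally have F: "m \<le> (1 + m) / 2 + B * (C3 / s ^ (2 * n))" .
  \<comment> \<open>Absorption is legitimate because for fixed \<open>l\<close> the corrector is
    bounded, so m is a genuine finite moment.\<close>
  have "x \<le> (1 + x) / 2 + y \<Longrightarrow> x \<le> 1 + 2 * y" for x y :: real by (simp add: field_simps)
  from this[OF F] have "m \<le> 1 + 2 * (B * (C3 / s ^ (2 * n)))" .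
  then have "m \<le> 1 + 2 * B * (C3 / s ^ (2 * n))" by (simp only: mult.assoc)
  then show ?thesis
    by (simp add: moment_const_def Let_def m_def B_def C3_def s_def C2_def c4_def k_def)
qed

end

section \<open>Identification of the modified corrector\<close>

lemma (in ensemble) square_integrable_mult:
  fixes f g :: "'d field \<Rightarrow> real"
  assumes [measurable]: "f \<in> borel_measurable P" "g \<in> borel_measurable P"
    and "integrable P (\<lambda>a. (f a)\<^sup>2)" "integrable P (\<lambda>a. (g a)\<^sup>2)"
  shows "integrable P (\<lambda>a. f a * g a)"
proof (rule Bochner_Integration.integrable_bound)
  show "integrable P (\<lambda>a. (f a)\<^sup>2 + (g a)\<^sup>2)" using assms by simp
  show "AE a in P. norm (f a * g a) \<le> norm ((f a)\<^sup>2 + (g a)\<^sup>2)"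
  proof (rule AE_I2)
    fix a
    have "2 * (\<bar>f a\<bar> * \<bar>g a\<bar>) \<le> (f a)\<^sup>2 + (g a)\<^sup>2" using sum_squares_bound[of "\<bar>f a\<bar>" "\<bar>g a\<bar>"] by simp
    moreover have "0 \<le> \<bar>f a\<bar> * \<bar>g a\<bar>" by simp
    ultimately have "\<bar>f a\<bar> * \<bar>g a\<bar> \<le> (f a)\<^sup>2 + (g a)\<^sup>2" by linarith
    then show "norm (f a * g a) \<le> norm ((f a)\<^sup>2 + (g a)\<^sup>2)" by (simp add: abs_mult)
  qed
qed measurable

text \<open>A stationary square integrable field need not be bounded on the lattice, so
  \<open>resolvent_unique\<close> does not apply. The difference is tested with itself in
  expectation instead: mass term and Dirichlet term are both nonnegative and add up to zero.\<close>

lemma (in ensemble) modified_corrector_unique: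
  assumes T: "0 < T" and e: "norm e = 1" and \<phi>: "is_modified_corrector P e T \<phi>"
  shows "AE a in P. \<phi> a 0 = corr (1 / T) e a 0"
proof -
  define l where "l = 1 / T"
  have l: "0 < l" using T by (simp add: l_def)
  have [measurable]: "(\<lambda>a. \<phi> a x) \<in> borel_measurable P" for x using \<phi> by (simp add: is_modified_corrector_def)
  have st: "AE a in P. \<phi> (shift z a) 0 = \<phi> a z" for z
  proof -
    have "\<forall>x z. AE a in P. \<phi> (shift z a) x = \<phi> a (x + z)" using \<phi> unfolding is_modified_corrector_def by blast
    then have "AE a in P. \<phi> (shift z a) 0 = \<phi> a (0 + z)" by blast
    then show ?thesis by simp
  qed
  have eq: "AE a in P. \<forall>x. l * \<phi> a x + div_star (\<lambda>b. a b * (grad (\<phi> a) b + e_field e b)) x = 0"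
    using \<phi> by (simp add: is_modified_corrector_def l_def)
  define g where "g a = \<phi> a 0 - corr l e a 0" for a
  define F where "F i a = a (0, i) * (g (shift (unitv i) a) - g a)" for i a
  have g [measurable]: "g \<in> borel_measurable P" unfolding g_def by measurable
  have gs [measurable]: "(\<lambda>a. g (shift z a)) \<in> borel_measurable P" for z by measurable
  have F [measurable]: "F i \<in> borel_measurable P" for i unfolding F_def by measurable
  have ci: "integrable P (\<lambda>a. (corr l e a 0)\<^sup>2)"
  proof (rule bounded_integrable[where M="(2 * real CARD('d) / l)\<^sup>2"])
    fix a assume "a \<in> space P"
    then have "\<bar>corr l e a 0\<bar> \<le> 2 * real CARD('d) / l" using e by (intro corr_bound[OF l]) (auto simp: space_P)
    from power_mono[OF this, of 2] show "\<bar>(corr l e a 0)\<^sup>2\<bar> \<le> (2 * real CARD('d) / l)\<^sup>2" by simp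
  qed measurable
  have pi: "integrable P (\<lambda>a. (\<phi> a 0)\<^sup>2)" using \<phi> by (simp add: is_modified_corrector_def)
  have g2: "integrable P (\<lambda>a. (g a)\<^sup>2)"
  proof (rule Bochner_Integration.integrable_bound)
    show "integrable P (\<lambda>a. 2 * (\<phi> a 0)\<^sup>2 + 2 * (corr l e a 0)\<^sup>2)" using ci pi by simp
    show "AE a in P. norm ((g a)\<^sup>2) \<le> norm (2 * (\<phi> a 0)\<^sup>2 + 2 * (corr l e a 0)\<^sup>2)"
    proof (rule AE_I2)
      fix a
      have "0 \<le> (\<phi> a 0 + corr l e a 0)\<^sup>2" by simp
      then have "(g a)\<^sup>2 \<le> 2 * (\<phi> a 0)\<^sup>2 + 2 * (corr l e a 0)\<^sup>2"
        by (simp add: g_def power2_eq_square algebra_simps)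
      then show "norm ((g a)\<^sup>2) \<le> norm (2 * (\<phi> a 0)\<^sup>2 + 2 * (corr l e a 0)\<^sup>2)" by simp
    qed
  qed measurable
  have gs2: "integrable P (\<lambda>a. (g (shift z a))\<^sup>2)" for z using integrable_shift[OF g2] .
  have F2: "integrable P (\<lambda>a. (F i a)\<^sup>2)" for i
  proof (rule Bochner_Integration.integrable_bound)
    show "integrable P (\<lambda>a. 2 * (g (shift (unitv i) a))\<^sup>2 + 2 * (g a)\<^sup>2)" using gs2 g2 by simp
    show "AE a in P. norm ((F i a)\<^sup>2) \<le> norm (2 * (g (shift (unitv i) a))\<^sup>2 + 2 * (g a)\<^sup>2)"
    proof (rule AE_I2)
      fix a assume a: "a \<in> space P"
      then have "unit_field a" by (simp add: space_P)
      then have "(a (0, i))\<^sup>2 \<le> 1" using unit_fieldD[of a "(0, i)"] by (simp add: power_le_one)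
      then have "(F i a)\<^sup>2 \<le> (g (shift (unitv i) a) - g a)\<^sup>2"
        unfolding F_def power_mult_distrib by (intro mult_left_le_one_le) auto
      also have "\<dots> \<le> 2 * (g (shift (unitv i) a))\<^sup>2 + 2 * (g a)\<^sup>2"
        using zero_le_power2[of "g (shift (unitv i) a) + g a"] by (simp add: power2_eq_square algebra_simps)
      finally show "norm ((F i a)\<^sup>2) \<le> norm (2 * (g (shift (unitv i) a))\<^sup>2 + 2 * (g a)\<^sup>2)" by simp
    qed
  qed measurable
  have i1: "integrable P (\<lambda>a. g a * F i a)" for i by (rule square_integrable_mult[OF g F g2 F2])
  have i2: "integrable P (\<lambda>a. g (shift (unitv i) a) * F i a)" for i by (rule square_integrable_mult[OF gs F gs2 F2])
  note D = expectation_div_star[OF g F i1 i2]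
  have ss: "shift (unitv i) (shift (- unitv i) a) = a" for i and a :: "'d field"
    by (auto simp: shift_def fun_eq_iff)
  \<comment> \<open>Countability of the lattice gives one null set for all shifts.\<close>
  have st_all: "AE a in P. \<forall>z. \<phi> (shift z a) 0 = \<phi> a z" using st by (simp add: AE_all_countable)
  have key: "AE a in P. g a * (\<Sum>i\<in>UNIV. F i (shift (- unitv i) a) - F i a) = - l * (g a)\<^sup>2"
    using st_all eq AE_space
  proof eventually_elim
    case (elim a)
    define w where "w x = \<phi> a x - corr l e a x" for x
    have gz: "g (shift z a) = w z" for z using elim by (simp add: g_def w_def corr_shift)
    have g0: "g a = w 0" by (simp add: g_def w_def)
    have Fi: "F i (shift (- unitv i) a) - F i a = a (0 - unitv i, i) * grad w (0 - unitv i, i) - a (0, i) * grad w (0, i)" for i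
      unfolding F_def ss by (simp add: shift_apply gz g0 grad_pair)
    have c: "l * corr l e a 0 + div_star (\<lambda>b. a b * flux_grad l e a b) 0 = 0"
      using elim e by (intro corr_eq[OF l]) (auto simp: space_P)
    have "div_star (\<lambda>b. a b * grad w b) 0 = div_star (\<lambda>b. a b * (grad (\<phi> a) b + e_field e b)) 0 - div_star (\<lambda>b. a b * flux_grad l e a b) 0"
      unfolding div_star_diff[symmetric] w_def grad_diff flux_grad_def by (simp add: algebra_simps)
    moreover have "l * \<phi> a 0 + div_star (\<lambda>b. a b * (grad (\<phi> a) b + e_field e b)) 0 = 0" using elim by blast
    ultimately have "div_star (\<lambda>b. a b * grad w b) 0 = - l * w 0" using c by (simp add: w_def algebra_simps)
    then have "(\<Sum>i\<in>UNIV. F i (shift (- unitv i) a) - F i a) = - l * w 0" unfolding Fi div_star_def .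
    then show ?case by (simp add: g0 power2_eq_square)
  qed
  have "(\<integral>a. g a * (\<Sum>i\<in>UNIV. F i (shift (- unitv i) a) - F i a) \<partial>P) = (\<integral>a. - l * (g a)\<^sup>2 \<partial>P)"
    using key by (intro integral_cong_AE) measurable
  then have "- l * (\<integral>a. (g a)\<^sup>2 \<partial>P) = (\<Sum>i\<in>UNIV. \<integral>a. F i a * (g (shift (unitv i) a) - g a) \<partial>P)"
    using D(2) by simp
  also have "0 \<le> \<dots>"
  proof (intro sum_nonneg integral_nonneg_AE AE_I2)
    fix i a assume "a \<in> space P"
    then have "0 \<le> a (0, i)" by (simp add: space_P unit_fieldD)
    moreover have "F i a * (g (shift (unitv i) a) - g a) = a (0, i) * (g (shift (unitv i) a) - g a)\<^sup>2"
      by (simp add: F_def power2_eq_square)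
    ultimately show "0 \<le> F i a * (g (shift (unitv i) a) - g a)" by simp
  qed
  finally have "(\<integral>a. (g a)\<^sup>2 \<partial>P) \<le> 0" using l by (simp add: mult_le_0_iff)
  moreover have "0 \<le> (\<integral>a. (g a)\<^sup>2 \<partial>P)" by (intro integral_nonneg_AE) auto
  ultimately have "(\<integral>a. (g a)\<^sup>2 \<partial>P) = 0" by simp
  then have "AE a in P. (g a)\<^sup>2 = 0" using integral_nonneg_eq_0_iff_AE[OF g2] by auto
  then show ?thesis by eventually_elim (simp add: g_def l_def)
qed

section \<open>Moments of the bond lengths\<close>

lemma enn_powr_mono:
  assumes "X \<le> Y" "0 \<le> p" shows "enn_powr X p \<le> enn_powr Y p"
proof (cases "Y = \<top>")
  case False
  then have X: "X \<noteq> \<top>" using assms(1) by (auto simp: top_unique)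
  have "enn2real X \<le> enn2real Y" using assms(1) False by (simp add: enn2real_mono less_top)
  then have "enn2real X powr p \<le> enn2real Y powr p" using assms(2) by (intro powr_mono2) auto
  then show ?thesis using False X by (simp add: enn_powr_def ennreal_leI)
qed (simp add: enn_powr_def)

lemma enn_powr_measurable [measurable]:
  assumes [measurable]: "f \<in> borel_measurable M"
  shows "(\<lambda>a. enn_powr (f a) p) \<in> borel_measurable M"
  unfolding enn_powr_def
proof (rule measurable_If)
  show "(\<lambda>a. ennreal (enn2real (f a) powr p)) \<in> borel_measurable M"
    by (intro measurable_compose[OF _ measurable_ennreal] powr_real_measurable) measurable
  show "{a \<in> space M. f a = \<top>} \<in> sets M"
    using measurable_sets[OF assms, of "{\<top>}"] by (simp add: vimage_def Int_def conj_commute)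
qed simp

definition len_moment :: "(nat \<Rightarrow> real) \<Rightarrow> nat \<Rightarrow> real" where
  "len_moment L k = 2 ^ k * (2 ^ k + L k)"

context ensemble
begin

text \<open>\<open>A2plus\<close> speaks of bonds at the origin; translating paths and invariance of
  the measure carry it to every bond.\<close>

lemma bond_dist_moment_le:
  assumes A2plus: "A2plus P \<Lambda>" and k: "0 < k"
  shows "(\<integral>\<^sup>+a. enn_powr (bond_dist a b) k \<partial>P) \<le> enn_powr (ennreal (\<Lambda> k)) k"
proof -
  obtain x i where b: "b = (x, i)" by (cases b)
  have "(\<integral>\<^sup>+a. enn_powr (bond_dist a b) k \<partial>P) \<le> (\<integral>\<^sup>+a. enn_powr (bond_dist (shift x a) (0, i)) k \<partial>P)"
    using bond_dist_shift_le[of _ 0 x i] k by (intro nn_integral_mono enn_powr_mono) (auto simp: b)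
  also have "\<dots> = (\<integral>\<^sup>+a. enn_powr (bond_dist a (0, i)) k \<partial>P)"
    by (rule nn_integral_shift[where f="\<lambda>a. enn_powr (bond_dist a (0, i)) k"]) measurable
  also have "\<dots> \<le> enn_powr (ennreal (\<Lambda> k)) k"
    using A2plus k unfolding A2plus_def moment_bound_def bond_dist_def by simp
  finally show ?thesis .
qed

lemma bond_dist_finite_AE:
  assumes "A2plus P \<Lambda>" shows "AE a in P. \<forall>b. bond_dist a b < \<top>"
proof -
  have "AE a in P. bond_dist a b < \<top>" for b
  proof -
    have "(\<integral>\<^sup>+a. enn_powr (bond_dist a b) 1 \<partial>P) \<noteq> \<infinity>"
      using bond_dist_moment_le[OF assms, of 1 b] by (auto simp: enn_powr_def top_unique)
    then have "AE a in P. enn_powr (bond_dist a b) 1 \<noteq> \<infinity>" by (intro nn_integral_PInf_AE) auto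
    then show ?thesis by eventually_elim (auto simp: enn_powr_def less_top split: if_splits)
  qed
  then show ?thesis by (simp add: AE_all_countable)
qed

lemma bond_len_moment_le:
  assumes A2plus: "A2plus P \<Lambda>"
  shows "(\<integral>\<^sup>+a. ennreal (bond_len a b ^ k) \<partial>P) \<le> ennreal (len_moment (\<lambda>k. max 0 (\<Lambda> k) powr k) k)"
proof (cases "k = 0")
  case True
  then show ?thesis by (simp add: emeasure_space_1 len_moment_def ennreal_ge_1)
next
  case False
  have pt: "ennreal (bond_len a b ^ k) \<le> ennreal (2 ^ k) * (ennreal (2 ^ k) + enn_powr (bond_dist a b) k)" for a
  proof (cases "bond_dist a b = \<top>")
    case True
    then show ?thesis by (simp add: enn_powr_def ennreal_mult_top)
  next
    case False
    define w where "w = enn2real (bond_dist a b)"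
    have w: "0 \<le> w" by (simp add: w_def)
    have "w powr real k = w ^ k" using w \<open>k \<noteq> 0\<close> by (cases "w = 0") (auto simp: powr_realpow)
    then have e: "enn_powr (bond_dist a b) k = ennreal (w ^ k)" using False by (simp add: enn_powr_def w_def)
    have "bond_len a b ^ k \<le> 2 ^ k * (2 ^ k + w ^ k)"
      unfolding bond_len_def w_def[symmetric] by (rule add_power_le) (use w in auto)
    then have "ennreal (bond_len a b ^ k) \<le> ennreal (2 ^ k * (2 ^ k + w ^ k))" by (rule ennreal_leI)
    also have "\<dots> = ennreal (2 ^ k) * (ennreal (2 ^ k) + ennreal (w ^ k))"
      using w by (subst ennreal_mult) (auto simp: ennreal_plus)
    finally show ?thesis by (simp add: e)
  qed
  have "(\<integral>\<^sup>+a. ennreal (bond_len a b ^ k) \<partial>P) \<le> (\<integral>\<^sup>+a. ennreal (2 ^ k) * (ennreal (2 ^ k) + enn_powr (bond_dist a b) k) \<partial>P)"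
    by (rule nn_integral_mono) (rule pt)
  also have "\<dots> = ennreal (2 ^ k) * (ennreal (2 ^ k) + (\<integral>\<^sup>+a. enn_powr (bond_dist a b) k \<partial>P))"
    by (subst nn_integral_cmult, measurable, subst nn_integral_add) (auto simp: emeasure_space_1)
  also have "\<dots> \<le> ennreal (2 ^ k) * (ennreal (2 ^ k) + enn_powr (ennreal (\<Lambda> k)) k)"
    using False by (intro mult_left_mono add_left_mono bond_dist_moment_le[OF A2plus]) auto
  \<comment> \<open>The modulus may take negative values, which \<open>ennreal\<close> reads as
    0.\<close>
  also have "enn_powr (ennreal (\<Lambda> k)) k = ennreal (max 0 (\<Lambda> k) powr k)"
    by (simp add: enn_powr_def max_def ennreal_neg enn2real_ennreal)
  also have "ennreal (2 ^ k) * (ennreal (2 ^ k) + ennreal (max 0 (\<Lambda> k) powr k)) = ennreal (len_moment (\<lambda>k. max 0 (\<Lambda> k) powr k) k)"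
    unfolding len_moment_def by (subst ennreal_mult) (auto simp: ennreal_plus)
  finally show ?thesis .
qed

end

lemma powr_le_even_power:
  fixes x p :: real
  assumes "0 \<le> p" "p \<le> real (2 * n)" shows "\<bar>x\<bar> powr p \<le> 1 + x ^ (2 * n)"
proof (cases "\<bar>x\<bar> \<le> 1")
  case True
  then have "\<bar>x\<bar> powr p \<le> 1" using assms by (intro powr_le1) auto
  moreover have "0 \<le> x ^ (2 * n)" by simp
  ultimately show ?thesis by linarith
next
  case False
  then have "\<bar>x\<bar> powr p \<le> \<bar>x\<bar> powr real (2 * n)" using assms by (intro powr_mono) auto
  also have "\<dots> = \<bar>x\<bar> ^ (2 * n)" using False by (intro powr_realpow) auto
  finally show ?thesis by (simp add: power_even_abs)
qed

theorem theorem1: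
  fixes p :: real and \<Lambda> :: "real \<Rightarrow> real" and \<rho> :: real
  assumes "CARD('d::finite) > 2" and "1 \<le> p" and "\<rho> > 0"
  shows "\<exists>C. \<forall>(P :: 'd field measure) (e :: real^'d) T \<phi>.
      prob_space P \<and> sets P = sets Omega \<and>
      A1 P \<and> A2 P \<Lambda> \<and> A2plus P \<Lambda> \<and> A3 P \<rho> \<and>
      norm e = 1 \<and> T > 0 \<and> is_modified_corrector P e T \<phi>
      \<longrightarrow> moment_bound P (\<lambda>a. ennreal \<bar>\<phi> a 0\<bar>) p C"
proof -
  define Mom where "Mom = len_moment (\<lambda>k. max 0 (\<Lambda> k) powr k)"
  \<comment> \<open>A multiple of 64 d is even and above the threshold; the rounded p puts 2n above
    p.\<close>
  define n where "n = 64 * CARD('d) * nat \<lceil>p\<rceil>"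
  define m where "m = max 0 (moment_const CARD('d) Mom \<rho> n)"
  have pn: "p \<le> real (nat \<lceil>p\<rceil>)" by linarith
  then have np: "1 \<le> nat \<lceil>p\<rceil>" using assms(2) by linarith
  have n: "64 * CARD('d) \<le> n" "even n" using np by (auto simp: n_def)
  have "nat \<lceil>p\<rceil> \<le> 2 * n" unfolding n_def using mult_le_mono1[of 1 "2 * (64 * CARD('d))" "nat \<lceil>p\<rceil>"] by (simp add: mult.assoc)
  then have p2n: "p \<le> real (2 * n)" using pn by linarith
  show ?thesis
  proof (intro exI[of _ "1 + m"] allI impI)
    fix P :: "'d field measure" and e :: "real^'d" and T \<phi>
    assume A: "prob_space P \<and> sets P = sets Omega \<and>
      A1 P \<and> A2 P \<Lambda> \<and> A2plus P \<Lambda> \<and> A3 P \<rho> \<and>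
      norm e = 1 \<and> T > 0 \<and> is_modified_corrector P e T \<phi>"
    interpret prob_space P using A by blast
    interpret E: ensemble P by unfold_locales (use A in auto)
    interpret C: corrector_ensemble P "1 / T" \<rho> e Mom
    proof unfold_locales
      show "(\<integral>\<^sup>+a. ennreal (bond_len a b ^ k) \<partial>P) \<le> ennreal (Mom k)" for k b
        unfolding Mom_def by (rule E.bond_len_moment_le) (use A in auto)
      show "0 \<le> Mom k" for k by (simp add: Mom_def len_moment_def)
      show "AE a in P. \<forall>b. bond_dist a b < \<top>" by (rule E.bond_dist_finite_AE) (use A in auto)
    qed (use A assms in auto)
    have u: "AE a in P. \<phi> a 0 = C.phi a" by (rule E.modified_corrector_unique) (use A in auto)
    have i: "integrable P (\<lambda>a. C.phi a ^ (2 * n))" by (intro C.bdd_integrable bdd_rv_intros C.bdd_corr)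
    have "(\<integral>\<^sup>+a. enn_powr (ennreal \<bar>\<phi> a 0\<bar>) p \<partial>P) \<le> (\<integral>\<^sup>+a. ennreal (1 + C.phi a ^ (2 * n)) \<partial>P)"
    proof (rule nn_integral_mono_AE, use u in eventually_elim)
      fix a assume "\<phi> a 0 = C.phi a"
      then have "enn_powr (ennreal \<bar>\<phi> a 0\<bar>) p = ennreal (\<bar>C.phi a\<bar> powr p)" by (simp add: enn_powr_def)
      also have "\<dots> \<le> ennreal (1 + C.phi a ^ (2 * n))"
        using assms(2) by (intro ennreal_leI powr_le_even_power p2n) simp
      finally show "enn_powr (ennreal \<bar>\<phi> a 0\<bar>) p \<le> ennreal (1 + C.phi a ^ (2 * n))" .
    qed
    also have "\<dots> = ennreal (\<integral>a. 1 + C.phi a ^ (2 * n) \<partial>P)"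
      using i by (intro nn_integral_eq_integral) auto
    also have "(\<integral>a. 1 + C.phi a ^ (2 * n) \<partial>P) = 1 + C.even_moment n"
      using i by (simp add: C.even_moment_def prob_space)
    also have "ennreal (1 + C.even_moment n) \<le> ennreal (1 + m)"
      using C.even_moment_le[OF n] by (intro ennreal_leI) (simp add: m_def)
    \<comment> \<open>Since 1 + m is at least 1, raising it to the power p only enlarges it, so 1 +
      m serves as the constant for the normalised moment.\<close>
    also have "ennreal (1 + m) \<le> ennreal ((1 + m) powr p)"
      using powr_mono[of 1 p "1 + m"] assms(2) by (intro ennreal_leI) (simp add: m_def)
    also have "\<dots> = enn_powr (ennreal (1 + m)) p"
      unfolding enn_powr_def by (simp add: m_def del: ennreal_plus)
    finally show "moment_bound P (\<lambda>a. ennreal \<bar>\<phi> a 0\<bar>) p (1 + m)"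
      by (simp add: moment_bound_def)
  qed
qed

end
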